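(* Let $M$ be a compact connected oriented Riemannian manifold without boundary, with volume form $\mu$. The Euler-Arnold equation of the homogeneous right-invariant metric given at the identity of $\mathfrak{D}(M)$ by $\langle u,v\rangle_{\dot H^1}=\frac14\int_M\mathrm{div}_\mu u\cdot\mathrm{div}_\mu v\,d\mu$ has the form $$\nabla\mathrm{div}_\mu u_t+\mathrm{div}_\mu u\cdot\nabla\mathrm{div}_\mu u+\nabla\langle u,\nabla\mathrm{div}_\mu u\rangle=0$$ or, equivalently, $$h_t+\langle u,\nabla h\rangle+\frac12h^2=-\frac{1}{2\mu(M)}\int_Mh^2\,d\mu,\qquad\text{where } h=\mathrm{div}_\mu u.$$
   Context: $\mathfrak{D}(M)$ is the Fréchet Lie group of smooth orientation-preserving diffeomorphisms of $M$; its Lie algebra $T_e\mathfrak{D}(M)$ is the space of smooth vector fields, with adjoint operator $\mathrm{ad}_vw=-[v,w]$, where $[v,w]$ is the usual Lie bracket of vector fields acting as derivations, $[v,w]f=v(wf)-w(vf)$. The unknown $u=u(t,x)$ is a smooth time-dependent vector field on $M$; $\mathrm{div}_\mu$ is the divergence with respect to $\mu$, $\nabla$ the gradient, and $\langle\cdot,\cdot\rangle$ inside the equations the Riemannian metric of $M$. The Euler-Arnold equation of a right-invariant metric with inner product $\langle\cdot,\cdot\rangle_e$ on the Lie algebra is $u_t=-\mathrm{ad}_u^{\top}u$, where $\langle\mathrm{ad}_v^\top u,w\rangle_e=\langle u,\mathrm{ad}_vw\rangle_e$ for all $w$. Since the $\dot H^1$ inner product is degenerate along divergence-free fields (it is a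 metric on the quotient $\mathfrak{D}_\mu(M)\backslash\mathfrak{D}(M)$, where $\mathfrak{D}_\mu(M)$ is the group of $\mu$-preserving diffeomorphisms), the equation is understood modulo divergence-free fields, i.e. as $\langle u_t,w\rangle_{\dot H^1}=-\langle u,\mathrm{ad}_uw\rangle_{\dot H^1}$ for all smooth vector fields $w$. *)

theory Defs
  imports "HOL-Analysis.Analysis"
begin

section \<open>Smooth maps between open subsets of normed spaces\<close>

primrec Ck_on :: "nat \<Rightarrow> 'a::real_normed_vector set \<Rightarrow> ('a \<Rightarrow> 'b::real_normed_vector) \<Rightarrow> bool" where
  "Ck_on 0 S f \<longleftrightarrow> continuous_on S f"
| "Ck_on (Suc k) S f \<longleftrightarrow>
     (\<forall>x\<in>S. f differentiable (at x)) \<and>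
     (\<forall>v. Ck_on k S (\<lambda>x. frechet_derivative f (at x) v))"

text \<open>Only meaningful for open \<open>S\<close>, because the derivatives are taken in the ambient space.\<close>

definition smooth_on :: "'a::real_normed_vector set \<Rightarrow> ('a \<Rightarrow> 'b::real_normed_vector) \<Rightarrow> bool" where
  "smooth_on S f \<longleftrightarrow> (\<forall>k. Ck_on k S f)"


section \<open>Oriented smooth manifolds without boundary\<close>

text \<open>
  The underlying set of the manifold is the whole of a Hausdorff topological type. A chart is a pair
  of an open domain \<open>U\<close> and a total function \<open>\<phi>\<close> whose values matter on \<open>U\<close> only. The manifold
  structure and the orientation are given by an atlas that is not assumed to be maximal; its
  charts are the positively oriented coordinate systems.
\<close>

type_synonym ('a, 'n) chart = "'a set \<times> ('a \<Rightarrow> real ^ 'n)"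

definition oriented_atlas :: "('a::t2_space, 'n::finite) chart set \<Rightarrow> bool" where
  "oriented_atlas A \<longleftrightarrow>
     (\<Union>(U, \<phi>)\<in>A. U) = UNIV \<and>
     (\<forall>(U, \<phi>)\<in>A. open U \<and> open (\<phi> ` U) \<and> homeomorphism U (\<phi> ` U) \<phi> (inv_into U \<phi>)) \<and>
     (\<forall>(U, \<phi>)\<in>A. \<forall>(V, \<psi>)\<in>A.
        smooth_on (\<phi> ` (U \<inter> V)) (\<psi> \<circ> inv_into U \<phi>) \<and>
        (\<forall>y\<in>\<phi> ` (U \<inter> V). det (matrix (frechet_derivative (\<psi> \<circ> inv_into U \<phi>) (at y))) > 0))"

definition smooth_near :: "('a::t2_space, 'n::finite) chart set \<Rightarrow> 'a \<Rightarrow> ('a \<Rightarrow> real) \<Rightarrow> bool" where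
  "smooth_near A p f \<longleftrightarrow>
     (\<exists>W. open W \<and> p \<in> W \<and>
        (\<forall>(U, \<phi>)\<in>A. smooth_on (\<phi> ` (U \<inter> W)) (f \<circ> inv_into U \<phi>)))"


section \<open>Tangent vectors and vector fields\<close>

text \<open>
  A tangent vector at \<open>p\<close> is a directional derivative acting on the functions that are smooth near
  \<open>p\<close>. It is set to \<open>0\<close> on all other functions, so that tangent vectors are equal as soon as they
  agree on the functions smooth near \<open>p\<close>; the zero vector is \<open>\<lambda>f. 0\<close>.
\<close>

type_synonym 'a tvec = "('a \<Rightarrow> real) \<Rightarrow> real"
type_synonym 'a vfield = "'a \<Rightarrow> 'a tvec"

definition chart_tvec ::
    "('a::t2_space, 'n::finite) chart set \<Rightarrow> ('a, 'n) chart \<Rightarrow> 'a \<Rightarrow> real ^ 'n \<Rightarrow> 'a tvec" where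
  "chart_tvec A c p \<xi> = (\<lambda>f. if smooth_near A p f
     then frechet_derivative (f \<circ> inv_into (fst c) (snd c)) (at (snd c p)) \<xi> else 0)"

definition coord_tvec ::
    "('a::t2_space, 'n::finite) chart set \<Rightarrow> ('a, 'n) chart \<Rightarrow> 'a \<Rightarrow> 'n \<Rightarrow> 'a tvec" where
  "coord_tvec A c p i = chart_tvec A c p (axis i 1)"

definition tangent_space :: "('a::t2_space, 'n::finite) chart set \<Rightarrow> 'a \<Rightarrow> 'a tvec set" where
  "tangent_space A p = {chart_tvec A c p \<xi> | c \<xi>. c \<in> A \<and> p \<in> fst c}"

text \<open>The components of a tangent vector \<open>v\<close> in a chart \<open>\<phi>\<close> are its values on the coordinate functions.\<close>

definition component :: "('a, 'n::finite) chart \<Rightarrow> 'n \<Rightarrow> 'a tvec \<Rightarrow> real" where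
  "component c i v = v (\<lambda>q. snd c q $ i)"

definition smooth_vfield :: "('a::t2_space, 'n::finite) chart set \<Rightarrow> 'a vfield \<Rightarrow> bool" where
  "smooth_vfield A X \<longleftrightarrow>
     (\<forall>p. X p \<in> tangent_space A p) \<and>
     (\<forall>(U, \<phi>)\<in>A. \<forall>i. smooth_on (\<phi> ` U) (\<lambda>y. component (U, \<phi>) i (X (inv_into U \<phi> y))))"

definition lie_bracket ::
    "('a::t2_space, 'n::finite) chart set \<Rightarrow> 'a vfield \<Rightarrow> 'a vfield \<Rightarrow> 'a vfield" where
  "lie_bracket A v w = (\<lambda>p f. if smooth_near A p f
     then v p (\<lambda>q. w q f) - w p (\<lambda>q. v q f) else 0)"

definition ad ::
    "('a::t2_space, 'n::finite) chart set \<Rightarrow> 'a vfield \<Rightarrow> 'a vfield \<Rightarrow> 'a vfield" where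
  "ad A v w = (\<lambda>p f. - lie_bracket A v w p f)"

text \<open>Smoothness is joint in time and space, over an open set \<open>J\<close> of times.\<close>

definition smooth_time_vfield ::
    "('a::t2_space, 'n::finite) chart set \<Rightarrow> real set \<Rightarrow> (real \<Rightarrow> 'a vfield) \<Rightarrow> bool" where
  "smooth_time_vfield A J u \<longleftrightarrow>
     (\<forall>t\<in>J. \<forall>p. u t p \<in> tangent_space A p) \<and>
     (\<forall>(U, \<phi>)\<in>A. \<forall>i. smooth_on (J \<times> \<phi> ` U)
        (\<lambda>(t, y). component (U, \<phi>) i (u t (inv_into U \<phi> y))))"

definition time_deriv :: "(real \<Rightarrow> 'a vfield) \<Rightarrow> real \<Rightarrow> 'a vfield" where
  "time_deriv u t = (\<lambda>p f. deriv (\<lambda>s. u s p f) t)"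


section \<open>Riemannian metrics and gradients\<close>

type_synonym 'a metric_tensor = "'a \<Rightarrow> 'a tvec \<Rightarrow> 'a tvec \<Rightarrow> real"

definition riemannian_metric ::
    "('a::t2_space, 'n::finite) chart set \<Rightarrow> 'a metric_tensor \<Rightarrow> bool" where
  "riemannian_metric A g \<longleftrightarrow>
     (\<forall>p. \<forall>v\<in>tangent_space A p. \<forall>w\<in>tangent_space A p. \<forall>z\<in>tangent_space A p. \<forall>a b.
        g p (\<lambda>f. a * v f + b * w f) z = a * g p v z + b * g p w z) \<and>
     (\<forall>p. \<forall>v\<in>tangent_space A p. \<forall>w\<in>tangent_space A p. g p v w = g p w v) \<and>
     (\<forall>p. \<forall>v\<in>tangent_space A p. v \<noteq> (\<lambda>f. 0) \<longrightarrow> g p v v > 0) \<and>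
     (\<forall>(U, \<phi>)\<in>A. \<forall>i j. smooth_on (\<phi> ` U)
        (\<lambda>y. let p = inv_into U \<phi> y in g p (coord_tvec A (U, \<phi>) p i) (coord_tvec A (U, \<phi>) p j)))"

definition gradient ::
    "('a::t2_space, 'n::finite) chart set \<Rightarrow> 'a metric_tensor \<Rightarrow> ('a \<Rightarrow> real) \<Rightarrow> 'a vfield" where
  "gradient A g f = (\<lambda>p. THE v. v \<in> tangent_space A p \<and> (\<forall>w\<in>tangent_space A p. g p v w = w f))"


section \<open>Volume forms, integration and divergence\<close>

text \<open>
  An \<open>n\<close>-form takes at each point a family of \<open>n\<close> tangent vectors indexed by the type \<open>'n\<close>. Listing
  the coordinate vectors of a chart by the same index type, \<open>form_density\<close> is the coefficient \<open>\<rho>\<close> in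
  \<open>\<mu> = \<rho> dx\<^sup>1 \<and> \<dots> \<and> dx\<^sup>n\<close>, as a function of the coordinates; no ordering of \<open>'n\<close> is needed.
\<close>

type_synonym ('a, 'n) top_form = "'a \<Rightarrow> ('n \<Rightarrow> 'a tvec) \<Rightarrow> real"

definition form_density ::
    "('a::t2_space, 'n::finite) chart set \<Rightarrow> ('a, 'n) top_form \<Rightarrow> ('a, 'n) chart \<Rightarrow> real ^ 'n \<Rightarrow> real" where
  "form_density A \<mu> c y = (let p = inv_into (fst c) (snd c) y in \<mu> p (coord_tvec A c p))"

text \<open>A smooth, alternating, multilinear \<open>n\<close>-form that is positive for the orientation.\<close>

definition volume_form ::
    "('a::t2_space, 'n::finite) chart set \<Rightarrow> ('a, 'n) top_form \<Rightarrow> bool" where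
  "volume_form A \<mu> \<longleftrightarrow>
     (\<forall>p v i. (\<forall>j. v j \<in> tangent_space A p) \<longrightarrow>
        (\<forall>x\<in>tangent_space A p. \<forall>y\<in>tangent_space A p. \<forall>a b.
           \<mu> p (v(i := (\<lambda>f. a * x f + b * y f))) = a * \<mu> p (v(i := x)) + b * \<mu> p (v(i := y)))) \<and>
     (\<forall>p v i j. (\<forall>k. v k \<in> tangent_space A p) \<longrightarrow> i \<noteq> j \<longrightarrow> v i = v j \<longrightarrow> \<mu> p v = 0) \<and>
     (\<forall>c\<in>A. smooth_on (snd c ` fst c) (form_density A \<mu> c)) \<and>
     (\<forall>c\<in>A. \<forall>y\<in>snd c ` fst c. form_density A \<mu> c y > 0)"

text \<open>The Borel measure \<open>d\<mu>\<close>: in every chart it has density \<open>\<rho>\<close> with respect to Lebesgue measure.\<close>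

definition form_measure ::
    "('a::t2_space, 'n::finite) chart set \<Rightarrow> ('a, 'n) top_form \<Rightarrow> 'a measure" where
  "form_measure A \<mu> = (THE m. sets m = sets borel \<and>
     (\<forall>(U, \<phi>)\<in>A. \<forall>B\<in>sets borel. B \<subseteq> U \<longrightarrow>
        emeasure m B = (\<integral>\<^sup>+y\<in>\<phi> ` B. ennreal (form_density A \<mu> (U, \<phi>) y) \<partial>lborel)))"

text \<open>
  The divergence is defined by \<open>L\<^bsub>X\<^esub> \<mu> = d (i\<^bsub>X\<^esub> \<mu>) = div X \<cdot> \<mu>\<close>. In a chart, with
  \<open>\<mu> = \<rho> dx\<^sup>1 \<and> \<dots> \<and> dx\<^sup>n\<close>, one has \<open>d (i\<^bsub>X\<^esub> \<mu>) = (\<Sum>i. \<partial>\<^sub>i (\<rho> X\<^sup>i)) dx\<^sup>1 \<and> \<dots> \<and> dx\<^sup>n\<close>; the result does not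
  depend on the chart.
\<close>

definition chart_divergence ::
    "('a::t2_space, 'n::finite) chart set \<Rightarrow> ('a, 'n) top_form \<Rightarrow> ('a, 'n) chart \<Rightarrow> 'a vfield \<Rightarrow> 'a \<Rightarrow> real" where
  "chart_divergence A \<mu> c X p =
     (\<Sum>i\<in>UNIV. frechet_derivative
        (\<lambda>y. form_density A \<mu> c y * component c i (X (inv_into (fst c) (snd c) y)))
        (at (snd c p)) (axis i 1)) / form_density A \<mu> c (snd c p)"

definition divergence ::
    "('a::t2_space, 'n::finite) chart set \<Rightarrow> ('a, 'n) top_form \<Rightarrow> 'a vfield \<Rightarrow> 'a \<Rightarrow> real" where
  "divergence A \<mu> X p = chart_divergence A \<mu> (SOME c. c \<in> A \<and> p \<in> fst c) X p"


section \<open>The Euler-Arnold equation\<close>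

definition H1dot_inner ::
    "('a::t2_space, 'n::finite) chart set \<Rightarrow> ('a, 'n) top_form \<Rightarrow> 'a vfield \<Rightarrow> 'a vfield \<Rightarrow> real" where
  "H1dot_inner A \<mu> u v = 1 / 4 * (\<integral>p. divergence A \<mu> u p * divergence A \<mu> v p \<partial>form_measure A \<mu>)"

text \<open>
  The equation \<open>u\<^sub>t = - ad\<^sub>u\<^sup>\<top> u\<close> of a right-invariant metric with inner product \<open>ip\<close> on smooth vector
  fields, in weak form. For a degenerate \<open>ip\<close> this is the equation modulo the kernel of \<open>ip\<close>.
\<close>

definition euler_arnold ::
    "('a::t2_space, 'n::finite) chart set \<Rightarrow> ('a vfield \<Rightarrow> 'a vfield \<Rightarrow> real) \<Rightarrow>
     real set \<Rightarrow> (real \<Rightarrow> 'a vfield) \<Rightarrow> bool" where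
  "euler_arnold A ip J u \<longleftrightarrow>
     (\<forall>t\<in>J. \<forall>w. smooth_vfield A w \<longrightarrow> ip (time_deriv u t) w = - ip (u t) (ad A (u t) w))"

end

theory Submission
  imports Defs
begin

text \<open>
  Write \<open>h = div u\<close> and \<open>F = h\<^sub>t + u h + h\<^sup>2 / 2\<close>, where \<open>u h\<close> is the derivative of \<open>h\<close> along \<open>u\<close>. Integration
  by parts, \<open>\<integral> f div X d\<mu> = - \<integral> X f d\<mu>\<close>, gives \<open>\<integral> h div [u, w] d\<mu> = - \<integral> [u, w] h d\<mu>\<close>; integrating by parts
  twice more and using \<open>h \<cdot> w h = w (h\<^sup>2) / 2\<close> turns the weak Euler-Arnold equation into \<open>\<integral> w F d\<mu> = 0\<close> for all
  smooth fields \<open>w\<close>. Taking for \<open>w\<close> a bump function times the coordinate gradient of \<open>F\<close> yields \<open>dF = 0\<close>.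
  This is the first equation, the gradient of \<open>F\<close> being its left-hand side. As the manifold is connected, it
  also says that \<open>F\<close> is constant, and integration identifies the constant, because \<open>\<integral> h\<^sub>t d\<mu> = 0\<close> and
  \<open>\<integral> u h d\<mu> = - \<integral> h\<^sup>2 d\<mu>\<close>.
\<close>

section \<open>Smooth functions\<close>

text \<open>At a fixed time the equation concerns two fields only, \<open>u t\<close> and
  \<open>time_deriv u t\<close>. Time enters through h_t = div u_t, which rests on the symmetry of
  second derivatives on the product of \<open>J\<close> with a chart range. Since h_t is then itself
  a divergence, its integral vanishes without differentiating under the integral sign.

  The main obstacle is that two global objects come from choice operators: the measure is a definite
  description, and the divergence is computed in an arbitrarily selected chart. For the measure,
  existence and uniqueness follow by cutting the manifold into finitely many pieces that each lie in
  one chart; that two charts agree on their overlap combines the change of variables formula with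
  the Jacobian rule for densities, the orientation making the Jacobian determinant positive. For the
  divergence, independence of the chart is deduced from integration instead of from a computation
  with Jacobians. Compactness supplies the finite covers, the finite total volume and the
  integrability of all smooth functions.\<close>

lemma Ck_on_cong:
  assumes "open S" "Ck_on k S f" "\<And>x. x \<in> S \<Longrightarrow> f x = g x"
  shows "Ck_on k S g"
  using assms(2,3)
proof (induction k arbitrary: f g)
  case 0
  then show ?case by (simp cong: continuous_on_cong)
next
  case (Suc k)
  have g: "(g has_derivative frechet_derivative f (at x)) (at x)" if "x \<in> S" for x
  proof -
    have "(f has_derivative frechet_derivative f (at x)) (at x)"
      using Suc.prems(1) that by (simp add: frechet_derivative_works)
    then show ?thesis
      by (rule has_derivative_transform_within_open[OF _ \<open>open S\<close> that Suc.prems(2)])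
  qed
  then have eq: "frechet_derivative f (at x) v = frechet_derivative g (at x) v" if "x \<in> S" for x v
    using that by (metis frechet_derivative_at)
  have "Ck_on k S (\<lambda>x. frechet_derivative f (at x) v)" for v
    using Suc.prems(1) by simp
  then have "Ck_on k S (\<lambda>x. frechet_derivative g (at x) v)" for v
    by (rule Suc.IH) (rule eq)
  then show ?case using g by (auto simp: differentiable_def)
qed

text \<open>Admits any explicit family of derivatives in place of \<open>frechet_derivative\<close>,
  so that the product, chain and quotient rules can be used in their usual form.\<close>

lemma Ck_on_SucI:
  assumes "open S" "\<And>x. x \<in> S \<Longrightarrow> (f has_derivative f' x) (at x)" "\<And>v. Ck_on k S (\<lambda>x. f' x v)"
  shows "Ck_on (Suc k) S f"
proof -
  have "f' x = frechet_derivative f (at x)" if "x \<in> S" for x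
    using assms(2)[OF that] by (metis frechet_derivative_at)
  then show ?thesis
    using assms(2) by (auto simp: differentiable_def intro!: Ck_on_cong[OF assms(1,3)])
qed

lemma Ck_on_has_derivative:
  "Ck_on (Suc k) S f \<Longrightarrow> x \<in> S \<Longrightarrow> (f has_derivative frechet_derivative f (at x)) (at x)"
  by (simp add: frechet_derivative_works)

lemma Ck_on_subset: "Ck_on k S f \<Longrightarrow> T \<subseteq> S \<Longrightarrow> Ck_on k T f"
  by (induction k arbitrary: f) (auto intro: continuous_on_subset)

lemma Ck_on_local:
  assumes "\<And>x. x \<in> S \<Longrightarrow> \<exists>T. open T \<and> x \<in> T \<and> Ck_on k T f"
  shows "Ck_on k S f"
  using assms
proof (induction k arbitrary: f)
  case 0
  have "isCont f x" if "x \<in> S" for x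
    using 0[OF that] by (auto simp: continuous_on_eq_continuous_at)
  then show ?case by (simp add: continuous_at_imp_continuous_on)
next
  case (Suc k)
  have "f differentiable (at x)" if "x \<in> S" for x
    using Suc.prems[OF that] by auto
  moreover have "Ck_on k S (\<lambda>x. frechet_derivative f (at x) v)" for v
    by (rule Suc.IH) (use Suc.prems in fastforce)
  ultimately show ?case by simp
qed

text \<open>Needed in the product and chain rules, where undifferentiated factors reappear at one
  order less.\<close>

lemma Ck_on_SucD: "Ck_on (Suc k) S f \<Longrightarrow> Ck_on k S f"
proof (induction k arbitrary: f)
  case 0
  then show ?case
    by (auto intro!: continuous_at_imp_continuous_on differentiable_imp_continuous_within)
next
  case (Suc k)
  then show ?case by (metis Ck_on.simps(2))
qed

lemma Ck_on_const [simp]: "Ck_on k S (\<lambda>x. c)"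
  by (induction k arbitrary: c) auto

lemma Ck_on_bounded_linear:
  assumes "bounded_linear L"
  shows "Ck_on k S L"
proof (cases k)
  case 0
  then show ?thesis by (simp add: assms linear_continuous_on)
next
  case (Suc m)
  have "frechet_derivative L (at x) = L" for x
    by (metis assms bounded_linear_imp_has_derivative frechet_derivative_at)
  then show ?thesis
    using Suc assms bounded_linear_imp_differentiable by auto
qed

lemma Ck_on_add:
  assumes "open S" "Ck_on k S f" "Ck_on k S g"
  shows "Ck_on k S (\<lambda>x. f x + g x)"
  using assms(2,3)
proof (induction k arbitrary: f g)
  case 0
  then show ?case by (simp add: continuous_on_add)
next
  case (Suc k)
  show ?case
    by (rule Ck_on_SucI[OF \<open>open S\<close> has_derivative_add[OF Ck_on_has_derivative Ck_on_has_derivative]])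
      (use Suc in auto)
qed

lemma Ck_on_sum:
  assumes "open S" "finite I" "\<And>i. i \<in> I \<Longrightarrow> Ck_on k S (f i)"
  shows "Ck_on k S (\<lambda>x. \<Sum>i\<in>I. f i x)"
  using assms(2,3) by (induction I rule: finite_induct) (simp_all del: Ck_on.simps add: Ck_on_add assms(1))

lemma Ck_on_bilinear:
  assumes "bounded_bilinear B" "open S" "Ck_on k S f" "Ck_on k S g"
  shows "Ck_on k S (\<lambda>x. B (f x) (g x))"
  using assms(3,4)
proof (induction k arbitrary: f g)
  case 0
  then show ?case by (auto intro: bounded_bilinear.continuous_on[OF assms(1)])
next
  case (Suc k)
  show ?case
  proof (rule Ck_on_SucI[OF \<open>open S\<close> bounded_bilinear.FDERIV[OF assms(1) Ck_on_has_derivative Ck_on_has_derivative]])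
    show "Ck_on k S (\<lambda>x. B (f x) (frechet_derivative g (at x) v) + B (frechet_derivative f (at x) v) (g x))" for v
      using Suc.prems Ck_on_SucD[OF Suc.prems(1)] Ck_on_SucD[OF Suc.prems(2)] by (intro Ck_on_add \<open>open S\<close> Suc.IH) auto
  qed (use Suc.prems in auto)
qed

lemma Ck_on_linear_image:
  assumes "bounded_linear L" "open S" "Ck_on k S f"
  shows "Ck_on k S (\<lambda>x. L (f x))"
  using assms(3)
proof (induction k arbitrary: f)
  case 0
  then show ?case by (auto intro: bounded_linear.continuous_on[OF assms(1)])
next
  case (Suc k)
  show ?case
    by (rule Ck_on_SucI[OF \<open>open S\<close> bounded_linear.has_derivative[OF assms(1) Ck_on_has_derivative]])
      (use Suc in auto)
qed

text \<open>The chain rule differentiates \<open>f\<close> in the direction Dg(x)v, which varies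
  with \<open>x\<close>, while the induction hypothesis speaks of fixed directions. Expanding Dg(x)v
  in a basis repairs this, whence the Euclidean space in the middle.\<close>

lemma Ck_on_compose:
  fixes g :: "'a::real_normed_vector \<Rightarrow> 'b::euclidean_space"
  assumes "open S" "Ck_on k T f" "Ck_on k S g" "g ` S \<subseteq> T"
  shows "Ck_on k S (\<lambda>x. f (g x))"
  using assms(2,3)
proof (induction k arbitrary: f)
  case 0
  then show ?case using assms(4) by (auto intro: continuous_on_compose2)
next
  case (Suc k)
  let ?f = "\<lambda>x. frechet_derivative f (at x)" and ?g = "\<lambda>x. frechet_derivative g (at x)"
  have der: "((\<lambda>x. f (g x)) has_derivative (\<lambda>v. \<Sum>b\<in>Basis. (?g x v \<bullet> b) *\<^sub>R ?f (g x) b)) (at x)" if "x \<in> S" for x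
  proof -
    have *: "(f has_derivative ?f (g x)) (at (g x))"
      using Suc.prems(1) that assms(4) by (auto intro!: Ck_on_has_derivative)
    have 1: "((\<lambda>x. f (g x)) has_derivative (\<lambda>v. ?f (g x) (?g x v))) (at x)"
      using has_derivative_compose[OF Ck_on_has_derivative[OF Suc.prems(2) that] *] by simp
    have 2: "?f (g x) w = (\<Sum>b\<in>Basis. (w \<bullet> b) *\<^sub>R ?f (g x) b)" for w
    proof -
      have lin: "linear (?f (g x))" using * by (rule has_derivative_linear)
      have "?f (g x) w = ?f (g x) (\<Sum>b\<in>Basis. (w \<bullet> b) *\<^sub>R b)" by (simp only: euclidean_representation)
      then show ?thesis by (simp only: linear_sum[OF lin] linear_scale[OF lin] o_def)
    qed
    show ?thesis by (rule has_derivative_eq_rhs[OF 1 ext]) (rule 2)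
  qed
  show ?case
  proof (rule Ck_on_SucI[OF \<open>open S\<close> der])
    fix v
    show "Ck_on k S (\<lambda>x. \<Sum>b\<in>Basis. (?g x v \<bullet> b) *\<^sub>R ?f (g x) b)"
    proof (intro Ck_on_sum Ck_on_bilinear[OF bounded_bilinear_scaleR] \<open>open S\<close> finite_Basis)
      fix b :: 'b
      show "Ck_on k S (\<lambda>x. ?g x v \<bullet> b)"
        using Suc.prems by (intro Ck_on_linear_image[OF bounded_linear_inner_left \<open>open S\<close>]) simp
      show "Ck_on k S (\<lambda>x. ?f (g x) b)"
        using Suc.IH[of "\<lambda>y. ?f y b"] Suc.prems(1) Ck_on_SucD[OF Suc.prems(2)] by simp
    qed
  qed auto
qed

lemma Ck_on_inverse:
  fixes f :: "'a::real_normed_vector \<Rightarrow> real"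
  assumes "open S" "Ck_on k S f" "\<And>x. x \<in> S \<Longrightarrow> f x \<noteq> 0"
  shows "Ck_on k S (\<lambda>x. inverse (f x))"
  using assms(2)
proof (induction k)
  case 0
  then show ?case using assms(3) by (simp add: continuous_on_inverse)
next
  case (Suc k)
  show ?case
  proof (rule Ck_on_SucI[OF \<open>open S\<close> Deriv.has_derivative_inverse[OF assms(3) Ck_on_has_derivative[where f = f]]])
    fix v
    have "Ck_on k S (\<lambda>x. inverse (f x))" using Suc.IH Suc.prems Ck_on_SucD by blast
    then have "Ck_on k S (\<lambda>x. inverse (f x) * frechet_derivative f (at x) v * inverse (f x))"
      using Suc.prems by (intro Ck_on_bilinear[OF bounded_bilinear_mult] \<open>open S\<close>) auto
    from Ck_on_linear_image[OF bounded_linear_minus[OF bounded_linear_ident] \<open>open S\<close> this]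
    show "Ck_on k S (\<lambda>x. - (inverse (f x) * frechet_derivative f (at x) v * inverse (f x)))" .
  qed (use Suc.prems in auto)
qed

named_theorems smooth_intros

lemma smooth_on_cong: "open S \<Longrightarrow> smooth_on S f \<Longrightarrow> (\<And>x. x \<in> S \<Longrightarrow> f x = g x) \<Longrightarrow> smooth_on S g"
  unfolding smooth_on_def using Ck_on_cong by blast

lemma smooth_on_subset: "smooth_on S f \<Longrightarrow> T \<subseteq> S \<Longrightarrow> smooth_on T f"
  unfolding smooth_on_def using Ck_on_subset by blast

lemma smooth_on_local:
  "(\<And>x. x \<in> S \<Longrightarrow> \<exists>T. open T \<and> x \<in> T \<and> smooth_on T f) \<Longrightarrow> smooth_on S f"
  unfolding smooth_on_def by (intro allI Ck_on_local) (meson)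

lemma smooth_on_has_derivative:
  "smooth_on S f \<Longrightarrow> x \<in> S \<Longrightarrow> (f has_derivative frechet_derivative f (at x)) (at x)"
  unfolding smooth_on_def using Ck_on_has_derivative by blast

lemma smooth_on_derivative [smooth_intros]:
  "smooth_on S f \<Longrightarrow> smooth_on S (\<lambda>x. frechet_derivative f (at x) v)"
  unfolding smooth_on_def using Ck_on.simps(2) by blast

lemma smooth_on_continuous: "smooth_on S f \<Longrightarrow> continuous_on S f"
  unfolding smooth_on_def by (metis Ck_on.simps(1))

lemma smooth_on_const [smooth_intros]: "smooth_on S (\<lambda>x. c)"
  by (simp add: smooth_on_def)

lemma smooth_on_bounded_linear: "bounded_linear L \<Longrightarrow> smooth_on S L"
  by (simp add: smooth_on_def Ck_on_bounded_linear)

lemma smooth_on_linear_image: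
  "bounded_linear L \<Longrightarrow> open S \<Longrightarrow> smooth_on S f \<Longrightarrow> smooth_on S (\<lambda>x. L (f x))"
  unfolding smooth_on_def using Ck_on_linear_image by blast

lemma smooth_on_ident [smooth_intros]: "smooth_on S (\<lambda>x. x)"
  by (simp add: smooth_on_bounded_linear bounded_linear_ident)

lemma smooth_on_add [smooth_intros]:
  "open S \<Longrightarrow> smooth_on S f \<Longrightarrow> smooth_on S g \<Longrightarrow> smooth_on S (\<lambda>x. f x + g x)"
  by (simp add: smooth_on_def Ck_on_add)

lemma smooth_on_minus [smooth_intros]:
  "open S \<Longrightarrow> smooth_on S f \<Longrightarrow> smooth_on S (\<lambda>x. - f x)"
  using smooth_on_linear_image[OF bounded_linear_minus[OF bounded_linear_ident]] .

lemma smooth_on_diff [smooth_intros]: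
  "open S \<Longrightarrow> smooth_on S f \<Longrightarrow> smooth_on S g \<Longrightarrow> smooth_on S (\<lambda>x. f x - g x)"
  using smooth_on_add[of S f "\<lambda>x. - g x"] smooth_on_minus[of S g] by simp

lemma smooth_on_sum [smooth_intros]:
  "open S \<Longrightarrow> finite I \<Longrightarrow> (\<And>i. i \<in> I \<Longrightarrow> smooth_on S (f i)) \<Longrightarrow> smooth_on S (\<lambda>x. \<Sum>i\<in>I. f i x)"
  by (simp add: smooth_on_def Ck_on_sum)

lemma smooth_on_bilinear:
  "bounded_bilinear B \<Longrightarrow> open S \<Longrightarrow> smooth_on S f \<Longrightarrow> smooth_on S g \<Longrightarrow> smooth_on S (\<lambda>x. B (f x) (g x))"
  by (simp add: smooth_on_def Ck_on_bilinear)

lemma smooth_on_mult [smooth_intros]: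
  fixes f :: "'a::real_normed_vector \<Rightarrow> 'b::real_normed_algebra"
  shows "open S \<Longrightarrow> smooth_on S f \<Longrightarrow> smooth_on S g \<Longrightarrow> smooth_on S (\<lambda>x. f x * g x)"
  by (rule smooth_on_bilinear[OF bounded_bilinear_mult])

lemma smooth_on_inverse:
  fixes f :: "'a::real_normed_vector \<Rightarrow> real"
  shows "open S \<Longrightarrow> smooth_on S f \<Longrightarrow> (\<And>x. x \<in> S \<Longrightarrow> f x \<noteq> 0) \<Longrightarrow> smooth_on S (\<lambda>x. inverse (f x))"
  by (simp add: smooth_on_def Ck_on_inverse)

lemma smooth_on_divide [smooth_intros]:
  fixes f :: "'a::real_normed_vector \<Rightarrow> real"
  shows "open S \<Longrightarrow> smooth_on S f \<Longrightarrow> smooth_on S g \<Longrightarrow> (\<And>x. x \<in> S \<Longrightarrow> g x \<noteq> 0)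
    \<Longrightarrow> smooth_on S (\<lambda>x. f x / g x)"
  by (simp add: divide_inverse smooth_on_mult smooth_on_inverse)

lemma smooth_on_compose:
  fixes g :: "'a::real_normed_vector \<Rightarrow> 'b::euclidean_space"
  assumes "open S" "smooth_on T f" "smooth_on S g" "g ` S \<subseteq> T"
  shows "smooth_on S (\<lambda>x. f (g x))"
  using assms unfolding smooth_on_def by (blast intro: Ck_on_compose)

section \<open>Symmetry of second derivatives\<close>

lemma line_derivative:
  assumes "(F has_derivative F') (at (p + s *\<^sub>R v))"
  shows "((\<lambda>s. F (p + s *\<^sub>R v)) has_real_derivative F' v) (at s)"
proof -
  have "((\<lambda>s. p + s *\<^sub>R v) has_derivative (\<lambda>h. h *\<^sub>R v)) (at s)"
    by (auto intro!: derivative_eq_intros)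
  from has_derivative_compose[OF this assms]
  have "((\<lambda>s. F (p + s *\<^sub>R v)) has_derivative (\<lambda>h. F' (h *\<^sub>R v))) (at s)" .
  moreover have "F' (h *\<^sub>R v) = F' v * h" for h
    using assms by (simp add: has_derivative_linear linear_scale)
  ultimately show ?thesis by (simp add: has_field_derivative_def mult.commute[of _ "F' v"])
qed

text \<open>The second difference on the left is symmetric in \<open>v\<close> and \<open>w\<close>,
  whereas the right-hand side differentiates in a prescribed order. The mean value theorem is
  applied along \<open>v\<close> to the increment in direction \<open>w\<close>, and then along
  \<open>w\<close> to the derivative in direction \<open>v\<close>.\<close>

lemma second_difference:
  fixes F :: "'a::real_normed_vector \<Rightarrow> real"
  assumes C: "Ck_on 2 S F" and h: "0 < h"
    and S: "\<And>s t. 0 \<le> s \<Longrightarrow> s \<le> h \<Longrightarrow> 0 \<le> t \<Longrightarrow> t \<le> h \<Longrightarrow> x + s *\<^sub>R v + t *\<^sub>R w \<in> S"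
  obtains s t where "0 < s" "s < h" "0 < t" "t < h"
    "F (x + h *\<^sub>R v + h *\<^sub>R w) - F (x + h *\<^sub>R v) - F (x + h *\<^sub>R w) + F x =
      h * h * frechet_derivative (\<lambda>y. frechet_derivative F (at y) v) (at (x + s *\<^sub>R v + t *\<^sub>R w)) w"
proof -
  let ?D = "\<lambda>y. frechet_derivative F (at y)"
  let ?f = "\<lambda>s. F ((x + h *\<^sub>R w) + s *\<^sub>R v) - F (x + s *\<^sub>R v)"
  have C1: "Ck_on (Suc 1) S F" "Ck_on (Suc 0) S (\<lambda>y. ?D y v)"
    using C by (auto simp: numeral_2_eq_2)
  have "(?f has_real_derivative ?D ((x + h *\<^sub>R w) + s *\<^sub>R v) v - ?D (x + s *\<^sub>R v) v) (at s)" if "0 \<le> s" "s \<le> h" for s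
    using S[of s h] S[of s 0] that h
    by (intro DERIV_diff line_derivative Ck_on_has_derivative[OF C1(1)]) (auto simp: algebra_simps)
  from MVT2[OF h this] obtain s where s: "0 < s" "s < h"
    and 1: "?f h - ?f 0 = (h - 0) * (?D ((x + h *\<^sub>R w) + s *\<^sub>R v) v - ?D (x + s *\<^sub>R v) v)"
    by blast
  have "((\<lambda>t. ?D ((x + s *\<^sub>R v) + t *\<^sub>R w) v) has_real_derivative
      frechet_derivative (\<lambda>y. ?D y v) (at ((x + s *\<^sub>R v) + t *\<^sub>R w)) w) (at t)" if "0 \<le> t" "t \<le> h" for t
    using S[of s t] that s by (intro line_derivative Ck_on_has_derivative[OF C1(2)]) auto
  from MVT2[OF h this] obtain t where t: "0 < t" "t < h"
    and 2: "?D ((x + s *\<^sub>R v) + h *\<^sub>R w) v - ?D ((x + s *\<^sub>R v) + 0 *\<^sub>R w) v =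
      (h - 0) * frechet_derivative (\<lambda>y. ?D y v) (at ((x + s *\<^sub>R v) + t *\<^sub>R w)) w"
    by blast
  show ?thesis
    using 1 2 by (intro that[OF s t]) (simp add: algebra_simps)
qed

text \<open>Both mixed derivatives, taken at two possibly different points near \<open>x\<close>,
  equal the same second difference divided by h^2. By continuity each stays within half the supposed
  gap of its value at \<open>x\<close>, so they could not be equal there.\<close>

lemma mixed_derivatives_commute:
  fixes F :: "'a::real_normed_vector \<Rightarrow> real"
  assumes S: "open S" "x \<in> S" and C: "Ck_on 2 S F"
  shows "frechet_derivative (\<lambda>y. frechet_derivative F (at y) v) (at x) w =
    frechet_derivative (\<lambda>y. frechet_derivative F (at y) w) (at x) v" (is "?A x = ?B x")
proof (rule ccontr)
  assume ne: "?A x \<noteq> ?B x"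
  let ?e = "\<bar>?A x - ?B x\<bar> / 2"
  have e: "?e > 0" using ne by simp
  have cont: "continuous_on S ?A" "continuous_on S ?B" using C by (auto simp: numeral_2_eq_2)
  obtain r where r: "r > 0" "ball x r \<subseteq> S" using S openE by blast
  obtain d1 where d1: "d1 > 0" "\<And>y. y \<in> S \<Longrightarrow> dist y x < d1 \<Longrightarrow> dist (?A y) (?A x) < ?e"
    using cont(1) S(2) e unfolding continuous_on_iff by blast
  obtain d2 where d2: "d2 > 0" "\<And>y. y \<in> S \<Longrightarrow> dist y x < d2 \<Longrightarrow> dist (?B y) (?B x) < ?e"
    using cont(2) S(2) e unfolding continuous_on_iff by blast
  define d where "d = min r (min d1 d2)"
  \<comment> \<open>Keeps the parallelogram spanned by \<open>h\<close> times \<open>v\<close> and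
    \<open>w\<close> within distance \<open>d\<close> of \<open>x\<close>; the summand 1 covers the
    case that both vectors vanish.\<close>
  define h where "h = d / (2 * (norm v + norm w + 1))"
  have d: "d > 0" using r d1 d2 by (simp add: d_def)
  then have h: "h > 0" by (simp add: h_def add_nonneg_pos)
  have "norm v + norm w + 1 > 0" by (simp add: add_nonneg_pos)
  then have hd: "h * (norm v + norm w) < d"
    using d by (simp add: h_def field_simps) (smt (verit) mult_nonneg_nonneg norm_ge_zero)
  \<comment> \<open>Only the sum of the norms is prescribed, so that the estimate serves both orders
    of \<open>v\<close> and \<open>w\<close>.\<close>
  have near: "dist (x + s *\<^sub>R v' + t *\<^sub>R w') x < d"
    if "0 \<le> s" "s \<le> h" "0 \<le> t" "t \<le> h" "norm v' + norm w' = norm v + norm w" for s t and v' w' :: 'a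
  proof -
    have "dist (x + s *\<^sub>R v' + t *\<^sub>R w') x \<le> s * norm v' + t * norm w'"
      using that norm_triangle_ineq[of "s *\<^sub>R v'" "t *\<^sub>R w'"] by (simp add: dist_norm)
    also have "\<dots> \<le> h * norm v' + h * norm w'" using that by (intro add_mono mult_right_mono) auto
    also have "\<dots> = h * (norm v + norm w)" by (metis distrib_left that(5))
    finally show ?thesis using hd by simp
  qed
  have inS: "x + s *\<^sub>R v' + t *\<^sub>R w' \<in> S"
    if "0 \<le> s" "s \<le> h" "0 \<le> t" "t \<le> h" "norm v' + norm w' = norm v + norm w" for s t v' w'
    using near[OF that] r by (auto simp: d_def dist_commute)
  obtain s t where st: "0 < s" "s < h" "0 < t" "t < h" and 1:
    "F (x + h *\<^sub>R v + h *\<^sub>R w) - F (x + h *\<^sub>R v) - F (x + h *\<^sub>R w) + F x = h * h * ?A (x + s *\<^sub>R v + t *\<^sub>R w)"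
    using second_difference[OF C h inS[of _ _ v w]] by auto
  obtain s' t' where st': "0 < s'" "s' < h" "0 < t'" "t' < h" and 2:
    "F (x + h *\<^sub>R w + h *\<^sub>R v) - F (x + h *\<^sub>R w) - F (x + h *\<^sub>R v) + F x = h * h * ?B (x + s' *\<^sub>R w + t' *\<^sub>R v)"
    using second_difference[OF C h inS[of _ _ w v]] by auto
  have "h * h * ?A (x + s *\<^sub>R v + t *\<^sub>R w) = h * h * ?B (x + s' *\<^sub>R w + t' *\<^sub>R v)"
    using 1 2 by (simp add: algebra_simps)
  then have "?A (x + s *\<^sub>R v + t *\<^sub>R w) = ?B (x + s' *\<^sub>R w + t' *\<^sub>R v)" using h by simp
  moreover have "dist (?A (x + s *\<^sub>R v + t *\<^sub>R w)) (?A x) < ?e"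
    using near[of s t v w] inS[of s t v w] st by (intro d1) (auto simp: d_def)
  moreover have "dist (?B (x + s' *\<^sub>R w + t' *\<^sub>R v)) (?B x) < ?e"
    using near[of s' t' w v] inS[of s' t' w v] st' by (intro d2) (auto simp: d_def)
  ultimately show False by (simp add: dist_real_def) argo
qed

section \<open>Bump functions\<close>

text \<open>The polynomial factor makes the family closed under differentiation, so that one
  differentiability proof gives smoothness of all orders; \<open>flat 1\<close> is the classical
  exp(-1/x).\<close>

definition flat :: "real poly \<Rightarrow> real \<Rightarrow> real" where
  "flat p x = (if x > 0 then poly p (1 / x) * exp (- (1 / x)) else 0)"

text \<open>With y = 1/x, the derivative of p(y) exp(-y) in x is y^2 (p(y) - p'(y)) exp(-y), and
  \<open>[:0, 0, 1:]\<close> is the polynomial y^2.\<close>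

definition flat_step :: "real poly \<Rightarrow> real poly" where
  "flat_step p = [:0, 0, 1:] * (p - pderiv p)"

lemma poly_exp_tendsto_0: "((\<lambda>y::real. poly p y * exp (- y)) \<longlongrightarrow> 0) at_top"
proof -
  have "((\<lambda>y::real. \<Sum>i\<le>degree p. coeff p i * (y ^ i / exp y)) \<longlongrightarrow> (\<Sum>i\<le>degree p. coeff p i * 0)) at_top"
    by (intro tendsto_sum tendsto_mult tendsto_const tendsto_power_div_exp_0)
  then show ?thesis
    by (simp add: poly_altdef sum_distrib_right exp_minus divide_inverse mult.assoc)
qed

text \<open>This is the difference quotient at 0, where the two branches meet. Dividing by
  \<open>x\<close> is multiplying by 1/x, which only shifts the polynomial.\<close>

lemma flat_tendsto_0: "((\<lambda>x. flat p x / x) \<longlongrightarrow> 0) (at 0)"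
proof -
  have "((\<lambda>x::real. poly (pCons 0 p) (inverse x) * exp (- (inverse x))) \<longlongrightarrow> 0) (at_right 0)"
    by (rule filterlim_compose[OF poly_exp_tendsto_0 filterlim_inverse_at_top_right])
  moreover have "eventually (\<lambda>x. poly (pCons 0 p) (inverse x) * exp (- (inverse x)) = flat p x / x) (at_right 0)"
    by (auto simp: eventually_at_right_field flat_def field_simps intro: exI[of _ 1])
  ultimately have "((\<lambda>x. flat p x / x) \<longlongrightarrow> 0) (at_right 0)"
    using Lim_transform_eventually by fast
  moreover have "((\<lambda>x. flat p x / x) \<longlongrightarrow> 0) (at_left 0)"
    by (rule tendsto_eventually) (auto simp: eventually_at_left_field flat_def intro: exI[of _ "-1"])
  ultimately show ?thesis using filterlim_split_at by blast
qed

lemma flat_DERIV: "(flat p has_real_derivative flat (flat_step p) x) (at x)"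
proof -
  consider "x > 0" | "x < 0" | "x = 0" by linarith
  then show ?thesis
  proof cases
    case 1
    have "((\<lambda>x. poly p (1 / x) * exp (- (1 / x))) has_real_derivative flat (flat_step p) x) (at x)"
      using 1 by (auto intro!: derivative_eq_intros DERIV_chain2[of "poly p"] poly_DERIV simp: flat_def flat_step_def field_simps power2_eq_square)
    then show ?thesis
      by (rule has_field_derivative_transform_within_open[of _ _ _ "{0<..}"]) (auto simp: flat_def 1)
  next
    case 2
    have "((\<lambda>x. 0) has_real_derivative flat (flat_step p) x) (at x)"
      using 2 by (simp add: flat_def)
    then show ?thesis
      by (rule has_field_derivative_transform_within_open[of _ _ _ "{..<0}"]) (auto simp: flat_def 2)
  next
    case 3
    then show ?thesis using flat_tendsto_0[of p] by (simp add: has_field_derivative_iff flat_def)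
  qed
qed

lemma Ck_on_flat: "Ck_on k UNIV (flat p)"
proof (induction k arbitrary: p)
  case 0
  then show ?case by (simp add: DERIV_continuous_on[OF flat_DERIV])
next
  case (Suc k)
  have "Ck_on k UNIV (\<lambda>x. flat (flat_step p) x * v)" for v
    by (intro Ck_on_bilinear[OF bounded_bilinear_mult] Suc) auto
  then show ?case
    by (intro Ck_on_SucI[of UNIV "flat p" "\<lambda>x v. flat (flat_step p) x * v"])
      (auto simp: flat_DERIV has_field_derivative_imp_has_derivative)
qed

text \<open>The squared distance is used because, unlike the distance, it is smooth at the centre as
  well.\<close>

definition bump :: "'a::euclidean_space \<Rightarrow> real \<Rightarrow> 'a \<Rightarrow> real" where
  "bump a r y = flat 1 (r\<^sup>2 - (y - a) \<bullet> (y - a))"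

lemma smooth_on_bump: "open S \<Longrightarrow> smooth_on S (bump a r)"
  unfolding bump_def
  by (rule smooth_on_compose[of _ UNIV])
    (auto intro!: smooth_intros smooth_on_bilinear[OF bounded_bilinear_inner] simp: Ck_on_flat smooth_on_def[of _ "flat 1"])

lemma bump_nonneg: "bump a r y \<ge> 0"
  by (simp add: bump_def flat_def)

lemma bump_pos_iff: "r > 0 \<Longrightarrow> bump a r y > 0 \<longleftrightarrow> y \<in> ball a r"
proof -
  assume "r > 0"
  then have "norm (y - a) < r \<longleftrightarrow> (norm (y - a))\<^sup>2 < r\<^sup>2"
    by (metis norm_ge_zero power_strict_mono power2_less_imp_less less_imp_le zero_less_numeral)
  then show ?thesis
    by (auto simp: bump_def flat_def dist_norm norm_minus_commute power2_norm_eq_inner[symmetric])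
qed

lemma bump_eq_0: "r > 0 \<Longrightarrow> y \<notin> ball a r \<Longrightarrow> bump a r y = 0"
  using bump_pos_iff[of r a y] bump_nonneg[of a r y] by linarith

section \<open>Alternating forms and determinants\<close>

text \<open>Alternation is expressed by equal entries, which makes sense for an index type without
  an order.\<close>

locale alternating_form =
  fixes E :: "('n::finite \<Rightarrow> real^'n) \<Rightarrow> real"
  assumes lin: "E (v(i := a *\<^sub>R x + b *\<^sub>R y)) = a * E (v(i := x)) + b * E (v(i := y))"
    and alt: "i \<noteq> j \<Longrightarrow> v i = v j \<Longrightarrow> E v = 0"
begin

lemma add: "E (v(i := x + y)) = E (v(i := x)) + E (v(i := y))"
  using lin[of v i 1 x 1 y] by simp

lemma scale: "E (v(i := a *\<^sub>R x)) = a * E (v(i := x))"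
  using lin[of v i a x 0 0] by simp

lemma swap:
  assumes "i \<noteq> j"
  shows "E (v(i := x, j := y)) = - E (v(i := y, j := x))"
proof -
  have z: "E (v(i := z, j := z)) = 0" for z using assms by (intro alt[of i j]) auto
  have 1: "E (v(i := x + y, j := w)) = E (v(i := x, j := w)) + E (v(i := y, j := w))" for w
    using add[of "v(j := w)" i x y] assms by (simp add: fun_upd_twist)
  have "0 = E (v(i := x + y, j := x + y))" by (simp add: z)
  also have "\<dots> = E (v(i := x, j := y)) + E (v(i := y, j := x))"
    by (simp add: add 1 z)
  finally show ?thesis by simp
qed

lemma scale_rows:
  "finite F \<Longrightarrow> E (\<lambda>i. if i \<in> F then c i *\<^sub>R w i else w i) = (\<Prod>i\<in>F. c i) * E w"
proof (induction F rule: finite_induct)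
  case (insert k F)
  let ?v = "\<lambda>i. if i \<in> F then c i *\<^sub>R w i else w i"
  have "(\<lambda>i. if i \<in> insert k F then c i *\<^sub>R w i else w i) = ?v(k := c k *\<^sub>R w k)"
    using insert by auto
  moreover have "?v(k := w k) = ?v" using insert by auto
  ultimately show ?case using insert by (simp add: scale del: fun_upd_apply)
qed simp

end

text \<open>Row operations reduce \<open>M\<close> to a diagonal matrix. The form is generalised in
  the induction because a swap of columns does not act on the arguments of \<open>E\<close>: it is
  absorbed into \<open>E\<close>, and the induction hypothesis is used for the form with permuted
  coordinates.\<close>

lemma alternating_form_eq_det:
  fixes E :: "('n::finite \<Rightarrow> real^'n) \<Rightarrow> real"
  assumes "alternating_form E"
  shows "E (\<lambda>i. M $ i) = det M * E (\<lambda>i. axis i 1)"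
  using assms
proof (induction M arbitrary: E rule: induct_matrix_row_operations[case_names zero_row diagonal swap_cols row_op])
  case (zero_row A i)
  interpret alternating_form E by fact
  have "A $ i = 0" using zero_row by (simp add: row_def vec_eq_iff)
  then have "(\<lambda>i. A $ i) = (\<lambda>i. A $ i)(i := 0 *\<^sub>R A $ i)" by auto
  then have "E (\<lambda>i. A $ i) = 0" using scale[of "\<lambda>i. A $ i" i 0 "A $ i"] by simp
  then show ?case using det_zero_row(1) zero_row by (metis mult_zero_left)
next
  case (diagonal A)
  interpret alternating_form E by fact
  have "A $ i = A $ i $ i *\<^sub>R axis i 1" for i
    using diagonal(1) by (simp add: vec_eq_iff axis_def)
  then have "(\<lambda>i. A $ i) = (\<lambda>i. if i \<in> UNIV then A $ i $ i *\<^sub>R axis i 1 else axis i 1)" by auto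
  then have "E (\<lambda>i. A $ i) = E (\<lambda>i. if i \<in> UNIV then A $ i $ i *\<^sub>R axis i 1 else axis i 1)"
    by (rule arg_cong)
  also have "\<dots> = (\<Prod>i\<in>UNIV. A $ i $ i) * E (\<lambda>i. axis i 1)"
    by (rule scale_rows) simp
  also have "(\<Prod>i\<in>UNIV. A $ i $ i) = det A"
    by (rule det_diagonal[symmetric]) (rule diagonal(1))
  finally show ?case .
next
  case (swap_cols A m n)
  interpret alternating_form E by fact
  let ?p = "Transposition.transpose m n"
  let ?E = "\<lambda>v. E (\<lambda>i. \<chi> j. v i $ ?p j)"
  have "alternating_form ?E"
  proof
    fix v :: "'n \<Rightarrow> real^'n" and i a b and x y :: "real^'n"
    have "(\<lambda>k. \<chi> j. (v(i := z)) k $ ?p j) = (\<lambda>k. \<chi> j. v k $ ?p j)(i := \<chi> j. z $ ?p j)" for z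
      by auto
    moreover have "(\<chi> j. (a *\<^sub>R x + b *\<^sub>R y) $ ?p j) = a *\<^sub>R (\<chi> j. x $ ?p j) + b *\<^sub>R (\<chi> j. y $ ?p j)"
      by (simp add: vec_eq_iff)
    ultimately show "?E (v(i := a *\<^sub>R x + b *\<^sub>R y)) = a * ?E (v(i := x)) + b * ?E (v(i := y))"
      by (simp only: lin)
  next
    fix i j and v :: "'n \<Rightarrow> real^'n"
    assume "i \<noteq> j" "v i = v j"
    then show "?E v = 0" by (intro alt[of i j]) auto
  qed
  from swap_cols(1)[OF this]
  have "E (\<lambda>i. \<chi> j. A $ i $ ?p j) = det A * E (\<lambda>i. \<chi> j. axis i 1 $ ?p j)" .
  also have "(\<lambda>i. \<chi> j. axis i (1::real) $ ?p j) = (\<lambda>i. axis (?p i) 1)"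
    by (auto simp: vec_eq_iff axis_def Transposition.transpose_def)
  also have "\<dots> = (\<lambda>i. axis i 1)(m := axis n 1, n := axis m 1)"
    using \<open>m \<noteq> n\<close> by (auto simp: Transposition.transpose_def)
  also have "E \<dots> = - E ((\<lambda>i. axis i 1)(m := axis m 1, n := axis n 1))"
    by (rule swap) fact
  also have "(\<lambda>i. axis i (1::real))(m := axis m 1, n := axis n 1) = (\<lambda>i. axis i 1)" by auto
  finally have "E (\<lambda>i. \<chi> j. A $ i $ ?p j) = - det A * E (\<lambda>i. axis i 1)"
    by simp
  moreover have "det (\<chi> i j. A $ i $ ?p j) = - det A"
    using \<open>m \<noteq> n\<close> by (subst det_permute_columns) (auto simp: permutes_swap_id sign_swap_id)
  ultimately show ?case by simp
next
  case (row_op A m n c)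
  interpret alternating_form E by fact
  let ?v = "\<lambda>i. A $ i"
  have r: "row i A = A $ i" for i by (simp add: row_def vec_eq_iff)
  have "(\<lambda>i. (\<chi> i. if i = m then row m A + c *\<^sub>R row n A else row i A) $ i) = ?v(m := A $ m + c *\<^sub>R A $ n)"
    by (auto simp: r)
  moreover have "E (?v(m := A $ m + c *\<^sub>R A $ n)) = E ?v + c * E (?v(m := A $ n))"
    by (simp add: add scale fun_upd_triv)
  moreover have "E (?v(m := A $ n)) = 0"
    using \<open>m \<noteq> n\<close> by (intro alt[of m n]) auto
  moreover have "det (\<chi> i. if i = m then row m A + c *\<^sub>R row n A else row i A) = det A"
  proof -
    have "(\<chi> i. if i = m then row m A + c *\<^sub>R row n A else row i A) =
        (\<chi> i. if i = m then row m A + c *s row n A else row i A)"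
      by (simp add: vec_eq_iff)
    then show ?thesis using det_row_operation[OF \<open>m \<noteq> n\<close>, of A c] by simp
  qed
  ultimately show ?case using row_op(1)[OF row_op(3)] by (simp add: r fun_upd_def)
qed

section \<open>Change of variables\<close>

text \<open>
  The library proves the change of variables formula for \<open>real ^ 'm\<close> with a well-ordered index type.
  Every finite type has a well-ordered copy, which transfers the formula to all finite index types.
\<close>

typedef 'n wo = "UNIV :: 'n set"
  by simp

instance wo :: (finite) finite
proof
  have "UNIV = range (Abs_wo :: 'a \<Rightarrow> 'a wo)" by (metis Abs_wo_cases surjI UNIV_I)
  then show "finite (UNIV :: 'a wo set)" by (metis finite finite_imageI)
qed

instantiation wo :: (finite) wellorder
begin

definition less_eq_wo :: "'a wo \<Rightarrow> 'a wo \<Rightarrow> bool" where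
  "less_eq_wo x y \<longleftrightarrow> to_nat (Rep_wo x) \<le> to_nat (Rep_wo y)"

definition less_wo :: "'a wo \<Rightarrow> 'a wo \<Rightarrow> bool" where
  "less_wo x y \<longleftrightarrow> to_nat (Rep_wo x) < to_nat (Rep_wo y)"

instance
proof
  fix P :: "'a wo \<Rightarrow> bool" and a
  assume *: "\<And>x. (\<And>y. y < x \<Longrightarrow> P y) \<Longrightarrow> P x"
  show "P a"
    by (induction a rule: measure_induct_rule[of "\<lambda>x. to_nat (Rep_wo x)"]) (rule *, simp add: less_wo_def)
qed (auto simp: less_eq_wo_def less_wo_def Rep_wo_inject)

end

lemma bij_Rep_wo: "bij Rep_wo"
  by (metis Abs_wo_inverse Rep_wo_inverse UNIV_I bijI' surj_def)

definition of_wo :: "real ^ 'n::finite wo \<Rightarrow> real ^ 'n" where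
  "of_wo x = (\<chi> i. x $ Abs_wo i)"

definition to_wo :: "real ^ 'n::finite \<Rightarrow> real ^ 'n wo" where
  "to_wo x = (\<chi> i. x $ Rep_wo i)"

lemma of_to_wo [simp]: "of_wo (to_wo x) = x"
  by (simp add: of_wo_def to_wo_def Abs_wo_inverse vec_eq_iff)

lemma to_of_wo [simp]: "to_wo (of_wo x) = x"
  by (simp add: of_wo_def to_wo_def Rep_wo_inverse vec_eq_iff)

lemma bounded_linear_of_wo: "bounded_linear of_wo"
  unfolding linear_conv_bounded_linear[symmetric] by (auto simp: linear_iff of_wo_def vec_eq_iff)

lemma bounded_linear_to_wo: "bounded_linear to_wo"
  unfolding linear_conv_bounded_linear[symmetric] by (auto simp: linear_iff to_wo_def vec_eq_iff)

lemma measurable_of_wo [measurable]: "of_wo \<in> borel_measurable borel"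
  by (simp add: bounded_linear_of_wo borel_measurable_continuous_onI linear_continuous_on)

lemma prod_Basis_vec: "(\<Prod>b\<in>Basis. (x :: real ^ 'n::finite) \<bullet> b) = (\<Prod>i\<in>UNIV. x $ i)"
proof -
  have B: "Basis = range (\<lambda>i::'n. axis i (1::real))" by (auto simp: Basis_vec_def)
  have I: "inj (\<lambda>i::'n. axis i (1::real))" by (auto simp: inj_on_def axis_eq_axis)
  show ?thesis
    using prod.reindex[OF I, of "\<lambda>b. x \<bullet> b"] by (simp add: B inner_axis)
qed

text \<open>Lebesgue measure is determined by its values on boxes, and relabelling the coordinates
  takes boxes to boxes with the same side lengths.\<close>

lemma lborel_of_wo: "(lborel :: (real ^ 'n::finite) measure) = distr lborel borel of_wo"
proof (rule lborel_eqI)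
  fix l u :: "real ^ 'n"
  assume le: "\<And>b. b \<in> Basis \<Longrightarrow> l \<bullet> b \<le> u \<bullet> b"
  have le': "l $ i \<le> u $ i" for i
    using le[of "axis i 1"] by (simp add: inner_axis axis_in_Basis_iff)
  have vimage: "of_wo -` box l u = box (to_wo l) (to_wo u)"
  proof (intro set_eqI)
    fix x :: "real ^ 'n wo"
    have "(\<forall>i. l $ i < x $ Abs_wo i \<and> x $ Abs_wo i < u $ i) \<longleftrightarrow>
        (\<forall>j. l $ Rep_wo j < x $ j \<and> x $ j < u $ Rep_wo j)"
      by (metis Abs_wo_inverse Rep_wo_inverse UNIV_I)
    then show "x \<in> of_wo -` box l u \<longleftrightarrow> x \<in> box (to_wo l) (to_wo u)"
      by (simp add: mem_box_cart of_wo_def to_wo_def)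
  qed
  have "(\<Prod>b\<in>Basis. (to_wo u - to_wo l) \<bullet> b) = (\<Prod>i\<in>UNIV. (u - l) $ Rep_wo i)"
    by (simp add: prod_Basis_vec to_wo_def)
  also have "\<dots> = (\<Prod>i\<in>UNIV. (u - l) $ i)"
    using prod.reindex_bij_betw[OF bij_Rep_wo] .
  finally have eq: "(\<Prod>b\<in>Basis. (to_wo u - to_wo l) \<bullet> b) = (\<Prod>b\<in>Basis. (u - l) \<bullet> b)"
    by (simp add: prod_Basis_vec)
  have "b \<in> Basis \<Longrightarrow> to_wo l \<bullet> b \<le> to_wo u \<bullet> b" for b
    by (auto simp: Basis_vec_def inner_axis to_wo_def le')
  then show "emeasure (distr lborel borel of_wo) (box l u) = (\<Prod>b\<in>Basis. (u - l) \<bullet> b)"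
    by (simp add: emeasure_distr vimage emeasure_lborel_box eq)
qed simp

text \<open>The relabelled determinant is an alternating form over the original index type with
  value 1 on the unit vectors. Uniqueness of such forms replaces a comparison of permutations and
  their signs.\<close>

lemma det_reindex_wo: "det (\<chi> i j. M $ Rep_wo i $ Rep_wo j) = det (M :: real ^ 'n::finite ^ 'n)"
proof -
  let ?E = "\<lambda>v :: 'n \<Rightarrow> real ^ 'n. det (\<chi> i. to_wo (v (Rep_wo i)))"
  have "alternating_form ?E"
  proof
    fix v :: "'n \<Rightarrow> real ^ 'n" and i a b and x y :: "real ^ 'n"
    have upd: "(\<chi> k. to_wo ((v(i := z)) (Rep_wo k))) =
      (\<chi> k. if k = Abs_wo i then to_wo z else to_wo (v (Rep_wo k)))" for z
      by (auto simp: vec_eq_iff Abs_wo_inverse Rep_wo_inverse)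
    have "to_wo (a *\<^sub>R x + b *\<^sub>R y) = a *s to_wo x + b *s to_wo y"
      by (simp add: to_wo_def vec_eq_iff)
    then show "?E (v(i := a *\<^sub>R x + b *\<^sub>R y)) = a * ?E (v(i := x)) + b * ?E (v(i := y))"
      unfolding upd
      by (simp only: det_row_add[of "Abs_wo i" "\<lambda>_. a *s to_wo x" "\<lambda>_. b *s to_wo y"]
          det_row_mul[of "Abs_wo i" _ "\<lambda>_. to_wo x"] det_row_mul[of "Abs_wo i" _ "\<lambda>_. to_wo y"])
  next
    fix i j and v :: "'n \<Rightarrow> real ^ 'n"
    assume "i \<noteq> j" "v i = v j"
    then show "?E v = 0"
      by (intro det_identical_rows[of "Abs_wo i" "Abs_wo j"])
        (auto simp: Abs_wo_inject Abs_wo_inverse row_def)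
  qed
  from alternating_form_eq_det[OF this, of M]
  have "det (\<chi> i. to_wo (M $ Rep_wo i)) = det M * det ((\<chi> i. to_wo (axis (Rep_wo i) 1)) :: real ^ 'n wo ^ 'n wo)" .
  also have "(\<chi> i. to_wo (axis (Rep_wo i) 1)) = (mat 1 :: real ^ 'n wo ^ 'n wo)"
    by (auto simp: vec_eq_iff to_wo_def mat_def axis_def Rep_wo_inject)
  finally show ?thesis by (simp add: to_wo_def)
qed

text \<open>Scalar functions are treated as functions into \<open>real^1\<close>.\<close>

lemma absolute_integral_change_of_variables_real:
  fixes f :: "real ^ 'n::{finite,wellorder} \<Rightarrow> real" and g :: "real ^ 'n::_ \<Rightarrow> real ^ 'n::_"
  assumes "S \<in> sets lebesgue"
    and "\<And>x. x \<in> S \<Longrightarrow> (g has_derivative g' x) (at x within S)"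
    and "inj_on g S"
  shows "(\<lambda>x. \<bar>det (matrix (g' x))\<bar> * f (g x)) absolutely_integrable_on S \<and>
      integral S (\<lambda>x. \<bar>det (matrix (g' x))\<bar> * f (g x)) = b
    \<longleftrightarrow> f absolutely_integrable_on (g ` S) \<and> integral (g ` S) f = b"
  using has_absolute_integral_change_of_variables[OF assms, of "\<lambda>x. vec (f x) :: real^1" "vec b"]
  unfolding absolutely_integrable_on_1_iff integral_on_1_eq by (simp add: vec_eq_iff)

text \<open>Bridge between the gauge integral, for which the change of variables is available, and
  the nonnegative integral that defines the measure.\<close>

lemma nn_integral_eq_iff_has_integral:
  fixes f :: "'a::euclidean_space \<Rightarrow> real"
  assumes nonneg: "\<And>x. x \<in> S \<Longrightarrow> 0 \<le> f x" and "0 \<le> r"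
    and meas: "(\<lambda>x. indicator S x * f x) \<in> borel_measurable borel"
  shows "(\<integral>\<^sup>+x. ennreal (indicator S x * f x) \<partial>lborel) = ennreal r \<longleftrightarrow>
    f absolutely_integrable_on S \<and> integral S f = r"
proof
  assume "(\<integral>\<^sup>+x. ennreal (indicator S x * f x) \<partial>lborel) = ennreal r"
  then have "((\<lambda>x. indicator S x * f x) has_integral r) UNIV"
    using assms by (intro nn_integral_has_integral) (auto simp: indicator_def)
  moreover have "(\<lambda>x. indicator S x * f x) = (\<lambda>x. if x \<in> S then f x else 0)"
    by (auto simp: indicator_def)
  ultimately have "(f has_integral r) S"
    by (simp add: has_integral_restrict_UNIV)
  then show "f absolutely_integrable_on S \<and> integral S f = r"
    using nonneg by (auto simp: absolutely_integrable_on_iff_nonneg has_integral_iff)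
next
  assume "f absolutely_integrable_on S \<and> integral S f = r"
  then have "(f has_integral r) S"
    by (auto simp: has_integral_iff absolutely_integrable_on_def)
  from nn_integral_has_integral_lebesgue[OF nonneg this]
  show "(\<integral>\<^sup>+x. ennreal (indicator S x * f x) \<partial>lborel) = ennreal r" .
qed

text \<open>If one side is infinite, the hypothesis excludes every finite value for the other.
  Equivalences between finite integrals thus become an equality that also covers infinite
  ones.\<close>

lemma ennreal_eq_if_same_reals:
  fixes x y :: ennreal
  assumes "\<And>r. r \<ge> 0 \<Longrightarrow> x = ennreal r \<longleftrightarrow> y = ennreal r"
  shows "x = y"
  by (metis assms ennreal_cases)

lemma nn_integral_change_of_variables_wellorder:
  fixes f :: "real ^ 'n::{finite,wellorder} \<Rightarrow> real" and g :: "real ^ 'n::_ \<Rightarrow> real ^ 'n::_"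
  assumes S: "S \<in> sets borel"
    and der: "\<And>x. x \<in> S \<Longrightarrow> (g has_derivative g' x) (at x)"
    and inj: "inj_on g S"
    and nonneg: "\<And>x. x \<in> S \<Longrightarrow> 0 \<le> f (g x)"
    and meas: "(\<lambda>y. indicator (g ` S) y * f y) \<in> borel_measurable borel"
      "(\<lambda>x. indicator S x * (\<bar>det (matrix (g' x))\<bar> * f (g x))) \<in> borel_measurable borel"
  shows "(\<integral>\<^sup>+y. ennreal (indicator (g ` S) y * f y) \<partial>lborel) =
    (\<integral>\<^sup>+x. ennreal (indicator S x * (\<bar>det (matrix (g' x))\<bar> * f (g x))) \<partial>lborel)"
proof (rule ennreal_eq_if_same_reals)
  fix r :: real assume r: "r \<ge> 0"
  have "S \<in> sets lebesgue" using S by simp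
  moreover have "(g has_derivative g' x) (at x within S)" if "x \<in> S" for x
    using der[OF that] has_derivative_at_withinI by blast
  ultimately have "(\<lambda>x. \<bar>det (matrix (g' x))\<bar> * f (g x)) absolutely_integrable_on S \<and>
      integral S (\<lambda>x. \<bar>det (matrix (g' x))\<bar> * f (g x)) = r
    \<longleftrightarrow> f absolutely_integrable_on (g ` S) \<and> integral (g ` S) f = r"
    using inj by (intro absolute_integral_change_of_variables_real)
  then show "(\<integral>\<^sup>+y. ennreal (indicator (g ` S) y * f y) \<partial>lborel) = ennreal r \<longleftrightarrow>
    (\<integral>\<^sup>+x. ennreal (indicator S x * (\<bar>det (matrix (g' x))\<bar> * f (g x))) \<partial>lborel) = ennreal r"
    using nonneg r meas by (subst (1 2) nn_integral_eq_iff_has_integral) auto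
qed

text \<open>Everything is conjugated by the relabelling of coordinates, which preserves both
  Lebesgue measure and the Jacobian determinant.\<close>

lemma nn_integral_change_of_variables:
  fixes f :: "real ^ 'n::finite \<Rightarrow> real" and g :: "real ^ 'n \<Rightarrow> real ^ 'n"
  assumes S [measurable]: "S \<in> sets borel"
    and der: "\<And>x. x \<in> S \<Longrightarrow> (g has_derivative g' x) (at x)"
    and inj: "inj_on g S"
    and nonneg: "\<And>x. x \<in> S \<Longrightarrow> 0 \<le> f (g x)"
    and meas [measurable]: "(\<lambda>y. indicator (g ` S) y * f y) \<in> borel_measurable borel"
      "(\<lambda>x. indicator S x * (\<bar>det (matrix (g' x))\<bar> * f (g x))) \<in> borel_measurable borel"
  shows "(\<integral>\<^sup>+y. ennreal (indicator (g ` S) y * f y) \<partial>lborel) =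
    (\<integral>\<^sup>+x. ennreal (indicator S x * (\<bar>det (matrix (g' x))\<bar> * f (g x))) \<partial>lborel)"
proof -
  let ?S = "of_wo -` S" and ?g = "\<lambda>x. to_wo (g (of_wo x))" and ?f = "\<lambda>x. f (of_wo x)"
  let ?g' = "\<lambda>x h. to_wo (g' (of_wo x) (of_wo h))"
  have nn: "(\<integral>\<^sup>+y. h y \<partial>lborel) = (\<integral>\<^sup>+x. h (of_wo x) \<partial>lborel)"
    if [measurable]: "h \<in> borel_measurable borel" for h :: "real ^ 'n \<Rightarrow> ennreal"
    by (subst lborel_of_wo) (simp add: nn_integral_distr)
  have img: "indicator (?g ` ?S) x = (indicator (g ` S) (of_wo x) :: real)" for x
  proof -
    have "x \<in> ?g ` ?S \<longleftrightarrow> of_wo x \<in> g ` S"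
    proof
      assume "of_wo x \<in> g ` S"
      then obtain s where "s \<in> S" "of_wo x = g s" by auto
      then have "x = to_wo (g s)" by (metis to_of_wo)
      then show "x \<in> ?g ` ?S" using \<open>s \<in> S\<close> by (intro image_eqI[of _ _ "to_wo s"]) auto
    qed auto
    then show ?thesis by (simp add: indicator_def)
  qed
  have det: "det (matrix (?g' x)) = det (matrix (g' (of_wo x)))" for x
  proof -
    have "of_wo (axis j 1) = axis (Rep_wo j) 1" for j :: "'n wo"
      by (auto simp: of_wo_def vec_eq_iff axis_def Abs_wo_inverse Rep_wo_inverse)
    then have "matrix (?g' x) = (\<chi> i j. matrix (g' (of_wo x)) $ Rep_wo i $ Rep_wo j)"
      by (simp add: matrix_def to_wo_def)
    then show ?thesis by (simp add: det_reindex_wo)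
  qed
  have "(\<integral>\<^sup>+y. ennreal (indicator (g ` S) y * f y) \<partial>lborel) =
      (\<integral>\<^sup>+y. ennreal (indicator (?g ` ?S) y * ?f y) \<partial>lborel)"
    by (subst nn) (simp_all add: img)
  also have "\<dots> = (\<integral>\<^sup>+x. ennreal (indicator ?S x * (\<bar>det (matrix (?g' x))\<bar> * ?f (?g x))) \<partial>lborel)"
  proof (rule nn_integral_change_of_variables_wellorder)
    show "?S \<in> sets borel" using measurable_sets[OF measurable_of_wo S] by simp
    show "(?g has_derivative ?g' x) (at x)" if "x \<in> ?S" for x
      using that
      by (intro bounded_linear.has_derivative[OF bounded_linear_to_wo]
          has_derivative_compose[OF bounded_linear_imp_has_derivative[OF bounded_linear_of_wo] der]) simp
    show "inj_on ?g ?S"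
      using inj by (auto simp: inj_on_def) (metis of_to_wo to_of_wo)
    have "(\<lambda>y. (\<lambda>y. indicator (g ` S) y * f y) (of_wo y)) \<in> borel_measurable borel" by measurable
    then show "(\<lambda>y. indicator (?g ` ?S) y * ?f y) \<in> borel_measurable borel" by (simp add: img)
    have "(\<lambda>y. (\<lambda>x. indicator S x * (\<bar>det (matrix (g' x))\<bar> * f (g x))) (of_wo y)) \<in> borel_measurable borel"
      by measurable
    moreover have "indicator ?S x = (indicator S (of_wo x) :: real)" for x by (simp add: indicator_def)
    ultimately show "(\<lambda>x. indicator ?S x * (\<bar>det (matrix (?g' x))\<bar> * ?f (?g x))) \<in> borel_measurable borel"
      by (simp add: det)
  qed (use nonneg in auto)
  also have "\<dots> = (\<integral>\<^sup>+x. ennreal (indicator S x * (\<bar>det (matrix (g' x))\<bar> * f (g x))) \<partial>lborel)"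
  proof -
    have "indicator ?S x = (indicator S (of_wo x) :: real)" for x by (simp add: indicator_def)
    then show ?thesis by (subst nn) (simp_all add: det)
  qed
  finally show ?thesis .
qed

section \<open>Integrals of derivatives of compactly supported functions\<close>

lemma integrable_compact_support:
  fixes f :: "'a::euclidean_space \<Rightarrow> real"
  assumes "continuous_on UNIV f" "compact K" "\<And>x. x \<notin> K \<Longrightarrow> f x = 0"
  shows "integrable lborel f"
proof -
  have "integrable lborel (\<lambda>x. indicator K x *\<^sub>R f x)"
    using assms by (intro borel_integrable_compact) (auto intro: continuous_on_subset)
  moreover have "(\<lambda>x. indicator K x *\<^sub>R f x) = f"
  proof
    show "indicator K x *\<^sub>R f x = f x" for x using assms(3) by (cases "x \<in> K") auto
  qed
  ultimately show ?thesis by simp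
qed

lemma derivative_eq_0_outside:
  assumes "closed K" "\<And>y. y \<notin> K \<Longrightarrow> G y = 0" "x \<notin> K"
  shows "frechet_derivative G (at x) v = 0"
proof -
  have "((\<lambda>_. 0) has_derivative (\<lambda>_. 0)) (at x)" by simp
  then have "(G has_derivative (\<lambda>_. 0)) (at x)"
    by (rule has_derivative_transform_within_open[of _ _ _ _ "- K"]) (use assms in auto)
  from frechet_derivative_at[OF this] show ?thesis by metis
qed

text \<open>
  The integral of the difference quotients vanishes by translation invariance; the mean value theorem
  supplies the dominating function for the passage to the limit.
\<close>

lemma integral_derivative_compact_support:
  fixes G :: "'a::euclidean_space \<Rightarrow> real"
  assumes smooth: "smooth_on UNIV G" and K: "compact K" "\<And>y. y \<notin> K \<Longrightarrow> G y = 0"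
  shows "integrable lborel (\<lambda>y. frechet_derivative G (at y) v)"
    and "(\<integral>y. frechet_derivative G (at y) v \<partial>lborel) = 0"
proof -
  let ?f = "\<lambda>y. frechet_derivative G (at y) v"
  have cont: "continuous_on UNIV ?f" and contG: "continuous_on UNIV G"
    using smooth by (auto intro: smooth_on_continuous smooth_on_derivative)
  have f0: "?f y = 0" if "y \<notin> K" for y
    using derivative_eq_0_outside[of K G y v] K that compact_imp_closed by blast
  show int: "integrable lborel ?f" using integrable_compact_support[OF cont K(1) f0] .
  have "compact (?f ` K)" using cont K(1) compact_continuous_image continuous_on_subset by blast
  from compact_imp_bounded[OF this] obtain B0 where "\<forall>z\<in>?f ` K. norm z \<le> B0"
    unfolding bounded_iff by blast
  then have B0: "\<bar>?f y\<bar> \<le> B0" if "y \<in> K" for y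
    using that by simp
  \<comment> \<open>\<open>B0\<close> may be negative when \<open>K\<close> is empty, while off the
    support the bound has to be at least 0.\<close>
  define B where "B = max B0 0"
  have B: "\<bar>?f y\<bar> \<le> B" for y using B0 f0 by (cases "y \<in> K") (force simp: B_def)+
  \<comment> \<open>\<open>K\<close> swept backwards along \<open>v\<close> for times in [0, 1]: it
    contains every \<open>y\<close> from which a step of length parameter at most 1 along
    \<open>v\<close> can reach the support.\<close>
  define K' where "K' = (\<lambda>(y, s). y - s *\<^sub>R v) ` (K \<times> {0..1::real})"
  have K': "compact K'" unfolding K'_def
    by (intro compact_continuous_image compact_Times K compact_Icc)
      (auto intro!: continuous_intros simp: case_prod_unfold)
  \<comment> \<open>With \<open>Suc n\<close> the step is never a division by zero and is at most 1,
    as required for \<open>K'\<close>.\<close>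
  define Q where "Q n y = (G (y + (1 / real (Suc n)) *\<^sub>R v) - G y) / (1 / real (Suc n))" for n y
  have Q_mvt: "\<exists>s. 0 < s \<and> s < 1 / real (Suc n) \<and> Q n y = ?f (y + s *\<^sub>R v)" for n y
  proof -
    have "((\<lambda>s. G (y + s *\<^sub>R v)) has_real_derivative ?f (y + s *\<^sub>R v)) (at s)" for s
      by (intro line_derivative smooth_on_has_derivative[OF smooth]) simp
    from MVT2[of 0 "1 / real (Suc n)", OF _ this] obtain s where
      "0 < s" "s < 1 / real (Suc n)"
      "G (y + (1 / real (Suc n)) *\<^sub>R v) - G (y + 0 *\<^sub>R v) = (1 / real (Suc n) - 0) * ?f (y + s *\<^sub>R v)" by auto
    then show ?thesis by (intro exI[of _ s]) (simp add: Q_def del: of_nat_Suc)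
  qed
  have Q_bound: "norm (Q n y) \<le> B * indicator K' y" for n y
  proof -
    obtain s where s: "0 < s" "s < 1 / real (Suc n)" "Q n y = ?f (y + s *\<^sub>R v)" using Q_mvt by blast
    have "1 / real (Suc n) \<le> 1" by simp
    then have "s \<le> 1" using s by linarith
    show ?thesis
    proof (cases "y + s *\<^sub>R v \<in> K")
      case True
      then have "y \<in> K'" using s \<open>s \<le> 1\<close> by (auto simp: K'_def image_iff intro!: bexI[of _ "y + s *\<^sub>R v"] bexI[of _ s])
      then show ?thesis using B s by simp
    next
      case False
      then show ?thesis using s f0 by (simp add: B_def)
    qed
  qed
  have Q_int: "integral\<^sup>L lborel (Q n) = 0" for n
  proof -
    let ?h = "(1 / real (Suc n)) *\<^sub>R v"
    have iG: "integrable lborel G" using integrable_compact_support[OF contG K] .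
    have mG: "G \<in> borel_measurable borel" using contG by (simp add: borel_measurable_continuous_onI)
    have "integrable (distr lborel borel ((+) ?h)) G" using iG lborel_distr_plus[of ?h] by simp
    then have iG': "integrable lborel (\<lambda>y. G (?h + y))" using mG by (simp add: integrable_distr_eq)
    have "(\<integral>y. G (?h + y) \<partial>lborel) = integral\<^sup>L (distr lborel borel ((+) ?h)) G"
      using mG by (simp add: integral_distr)
    then have "(\<integral>y. G (?h + y) \<partial>lborel) = integral\<^sup>L lborel G" using lborel_distr_plus[of ?h] by simp
    then have "(\<integral>y. G (?h + y) - G y \<partial>lborel) = 0" using iG iG' by simp
    then show ?thesis unfolding Q_def by (simp add: add.commute del: of_nat_Suc)
  qed
  have "(\<lambda>n. Q n y) \<longlonglongrightarrow> ?f y" for y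
  proof -
    have "((\<lambda>s. G (y + s *\<^sub>R v)) has_real_derivative ?f (y + 0 *\<^sub>R v)) (at 0)"
      by (intro line_derivative smooth_on_has_derivative[OF smooth]) simp
    then have "((\<lambda>h. (G (y + h *\<^sub>R v) - G y) / h) \<longlongrightarrow> ?f y) (at 0)"
      by (simp add: DERIV_def)
    moreover have "filterlim (\<lambda>n. 1 / real (Suc n)) (at 0) sequentially"
      unfolding filterlim_at using LIMSEQ_inverse_real_of_nat by (auto simp: inverse_eq_divide)
    ultimately show ?thesis unfolding Q_def by (rule filterlim_compose)
  qed
  then have lim: "AE y in lborel. (\<lambda>n. Q n y) \<longlonglongrightarrow> ?f y" by simp
  have [measurable]: "G \<in> borel_measurable borel" using contG by (simp add: borel_measurable_continuous_onI)
  have Qm: "Q n \<in> borel_measurable lborel" for n unfolding Q_def by measurable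
  have w: "integrable lborel (\<lambda>y. B * indicator K' y)"
    using borel_integrable_compact[OF K', of "\<lambda>_. B"] by (simp add: mult.commute)
  have "(\<lambda>n. integral\<^sup>L lborel (Q n)) \<longlonglongrightarrow> integral\<^sup>L lborel ?f"
    by (rule integral_dominated_convergence[OF borel_measurable_integrable[OF int] Qm w lim]) (rule AE_I2, rule Q_bound)
  then have "(\<lambda>n. 0) \<longlonglongrightarrow> integral\<^sup>L lborel ?f" by (simp only: Q_int)
  then show "integral\<^sup>L lborel ?f = 0" by (simp only: LIMSEQ_const_iff)
qed

section \<open>Functions and vector fields on an oriented manifold\<close>

abbreviation cinv :: "('a, 'n) chart \<Rightarrow> real ^ 'n::finite \<Rightarrow> 'a" where
  "cinv c \<equiv> inv_into (fst c) (snd c)"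

abbreviation cran :: "('a, 'n) chart \<Rightarrow> (real ^ 'n::finite) set" where
  "cran c \<equiv> snd c ` fst c"

definition cvec :: "('a, 'n::finite) chart \<Rightarrow> 'a tvec \<Rightarrow> real ^ 'n" where
  "cvec c v = (\<chi> i. component c i v)"

lemma cvec_nth [simp]: "cvec c v $ i = component c i v"
  by (simp add: cvec_def)

text \<open>\<open>smooth_near\<close> hides its neighbourhood behind an existential quantifier.
  Naming the set allows one to say that a smooth field maps functions smooth on \<open>W\<close> to
  functions smooth on the same \<open>W\<close>.\<close>

definition smooth_in :: "('a::t2_space, 'n::finite) chart set \<Rightarrow> 'a set \<Rightarrow> ('a \<Rightarrow> real) \<Rightarrow> bool" where
  "smooth_in A W f \<longleftrightarrow> (\<forall>c\<in>A. smooth_on (snd c ` (fst c \<inter> W)) (\<lambda>y. f (cinv c y)))"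

lemma smooth_near_iff: "smooth_near A p f \<longleftrightarrow> (\<exists>W. open W \<and> p \<in> W \<and> smooth_in A W f)"
  by (fastforce simp: smooth_near_def smooth_in_def o_def)

lemma smooth_in_near: "smooth_in A W f \<Longrightarrow> open W \<Longrightarrow> p \<in> W \<Longrightarrow> smooth_near A p f"
  by (auto simp: smooth_near_iff)

lemma linear_expand_axis:
  assumes "linear (L :: real ^ 'n::finite \<Rightarrow> real)"
  shows "L \<xi> = (\<Sum>i\<in>UNIV. \<xi> $ i * L (axis i 1))"
proof -
  have "L \<xi> = L (\<Sum>i\<in>UNIV. \<xi> $ i *\<^sub>R axis i 1)"
    using basis_expansion[of \<xi>] by (simp add: scalar_mult_eq_scaleR)
  then show ?thesis by (simp add: linear_sum[OF assms] linear_scale[OF assms])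
qed

lemma has_derivative_frechet: "(f has_derivative f') (at x) \<Longrightarrow> frechet_derivative f (at x) = f'"
  by (metis frechet_derivative_at)

locale manifold =
  fixes A :: "('a::t2_space, 'n::finite) chart set"
  assumes atlas: "oriented_atlas A"
begin

section \<open>Charts and transition maps\<close>

lemma chart_cover: obtains c where "c \<in> A" "p \<in> fst c"
proof -
  have "(\<Union>(U, \<phi>)\<in>A. U) = UNIV" using atlas unfolding oriented_atlas_def by blast
  then show ?thesis using that by fastforce
qed

lemma chart_homeomorphism:
  assumes "c \<in> A"
  shows "open (fst c)" "open (cran c)" "homeomorphism (fst c) (cran c) (snd c) (cinv c)"
proof -
  have "\<forall>(U, \<phi>)\<in>A. open U \<and> open (\<phi> ` U) \<and> homeomorphism U (\<phi> ` U) \<phi> (inv_into U \<phi>)"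
    using atlas unfolding oriented_atlas_def by blast
  with assms show "open (fst c)" "open (cran c)" "homeomorphism (fst c) (cran c) (snd c) (cinv c)"
    by fastforce+
qed

lemma transition:
  assumes "c \<in> A" "d \<in> A"
  shows "smooth_on (snd c ` (fst c \<inter> fst d)) (\<lambda>y. snd d (cinv c y))"
    and "y \<in> snd c ` (fst c \<inter> fst d) \<Longrightarrow>
      det (matrix (frechet_derivative (\<lambda>y. snd d (cinv c y)) (at y))) > 0"
proof -
  obtain U \<phi> V \<psi> where c: "c = (U, \<phi>)" "d = (V, \<psi>)" by fastforce
  have "\<forall>(U, \<phi>)\<in>A. \<forall>(V, \<psi>)\<in>A.
        smooth_on (\<phi> ` (U \<inter> V)) (\<psi> \<circ> inv_into U \<phi>) \<and>
        (\<forall>y\<in>\<phi> ` (U \<inter> V). det (matrix (frechet_derivative (\<psi> \<circ> inv_into U \<phi>) (at y))) > 0)"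
    using atlas unfolding oriented_atlas_def by blast
  then have "smooth_on (\<phi> ` (U \<inter> V)) (\<psi> \<circ> inv_into U \<phi>) \<and>
        (\<forall>y\<in>\<phi> ` (U \<inter> V). det (matrix (frechet_derivative (\<psi> \<circ> inv_into U \<phi>) (at y))) > 0)"
    using assms unfolding c by fast
  then show "smooth_on (snd c ` (fst c \<inter> fst d)) (\<lambda>y. snd d (cinv c y))"
    "y \<in> snd c ` (fst c \<inter> fst d) \<Longrightarrow>
      det (matrix (frechet_derivative (\<lambda>y. snd d (cinv c y)) (at y))) > 0"
    by (auto simp: c o_def)
qed

lemma cinv_chart [simp]: "c \<in> A \<Longrightarrow> p \<in> fst c \<Longrightarrow> cinv c (snd c p) = p"
  using homeomorphism_apply1[OF chart_homeomorphism(3)] .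

lemma chart_cinv: "y \<in> cran c \<Longrightarrow> snd c (cinv c y) = y"
  by (rule f_inv_into_f)

lemma cinv_in: "y \<in> cran c \<Longrightarrow> cinv c y \<in> fst c"
  by (rule inv_into_into)

lemma open_chart_image:
  assumes "c \<in> A" "open W"
  shows "open (snd c ` (fst c \<inter> W))"
proof -
  have "openin (top_of_set (cran c)) (snd c ` (fst c \<inter> W))"
    by (rule homeomorphism_imp_open_map[OF chart_homeomorphism(3)[OF assms(1)]]) (use assms in auto)
  then show ?thesis using chart_homeomorphism(2)[OF assms(1)] openin_open_trans by blast
qed

lemma mem_chart_image:
  "c \<in> A \<Longrightarrow> y \<in> snd c ` (fst c \<inter> W) \<longleftrightarrow> y \<in> cran c \<and> cinv c y \<in> W"
  by (auto simp: image_iff)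

section \<open>Smooth functions on open subsets\<close>

lemma smooth_in_subset: "smooth_in A W f \<Longrightarrow> V \<subseteq> W \<Longrightarrow> smooth_in A V f"
  unfolding smooth_in_def by (meson Int_mono image_mono order_refl smooth_on_subset)

lemma smooth_in_local:
  assumes "\<And>p. p \<in> W \<Longrightarrow> \<exists>V. open V \<and> p \<in> V \<and> smooth_in A V f"
  shows "smooth_in A W f"
  unfolding smooth_in_def
proof (intro ballI smooth_on_local)
  fix c y assume c: "c \<in> A" and "y \<in> snd c ` (fst c \<inter> W)"
  then obtain p where p: "p \<in> fst c" "p \<in> W" "y = snd c p" by auto
  from assms[OF p(2)] obtain V where V: "open V" "p \<in> V" "smooth_in A V f" by blast
  show "\<exists>T. open T \<and> y \<in> T \<and> smooth_on T (\<lambda>y. f (cinv c y))"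
    using V c p open_chart_image[OF c V(1)] unfolding smooth_in_def by blast
qed

text \<open>Any other chart expression is the given one composed with a smooth transition
  map.\<close>

lemma smooth_in_chart:
  assumes c: "c \<in> A" and W: "open W" "W \<subseteq> fst c" and f: "smooth_on (snd c ` W) (\<lambda>y. f (cinv c y))"
  shows "smooth_in A W f"
  unfolding smooth_in_def
proof
  fix d assume d: "d \<in> A"
  have S: "open (snd d ` (fst d \<inter> W))" using open_chart_image[OF d W(1)] .
  have "smooth_on (snd d ` (fst d \<inter> W)) (\<lambda>y. f (cinv c (snd c (cinv d y))))"
  proof (rule smooth_on_compose[OF S f])
    show "smooth_on (snd d ` (fst d \<inter> W)) (\<lambda>y. snd c (cinv d y))"
      using transition(1)[OF d c] by (rule smooth_on_subset) (use W in auto)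
    show "(\<lambda>y. snd c (cinv d y)) ` (snd d ` (fst d \<inter> W)) \<subseteq> snd c ` W"
      using d by auto
  qed
  then show "smooth_on (snd d ` (fst d \<inter> W)) (\<lambda>y. f (cinv d y))"
    by (rule smooth_on_cong[OF S]) (use c d W in auto)
qed

lemma smooth_in_cong:
  assumes "open W" "smooth_in A W f" "\<And>p. p \<in> W \<Longrightarrow> f p = g p"
  shows "smooth_in A W g"
  unfolding smooth_in_def
proof
  fix c assume c: "c \<in> A"
  then have "smooth_on (snd c ` (fst c \<inter> W)) (\<lambda>y. f (cinv c y))"
    using assms(2) unfolding smooth_in_def by blast
  then show "smooth_on (snd c ` (fst c \<inter> W)) (\<lambda>y. g (cinv c y))"
    by (rule smooth_on_cong[OF open_chart_image[OF c assms(1)]]) (use c assms(3) in auto)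
qed

lemma smooth_in_const: "smooth_in A W (\<lambda>p. k)"
  by (simp add: smooth_in_def smooth_on_const)

lemma smooth_in_add:
  "open W \<Longrightarrow> smooth_in A W f \<Longrightarrow> smooth_in A W g \<Longrightarrow> smooth_in A W (\<lambda>p. f p + g p)"
  unfolding smooth_in_def by (intro ballI smooth_on_add open_chart_image) auto

lemma smooth_in_diff:
  "open W \<Longrightarrow> smooth_in A W f \<Longrightarrow> smooth_in A W g \<Longrightarrow> smooth_in A W (\<lambda>p. f p - g p)"
  unfolding smooth_in_def by (intro ballI smooth_on_diff open_chart_image) auto

lemma smooth_in_mult:
  "open W \<Longrightarrow> smooth_in A W f \<Longrightarrow> smooth_in A W g \<Longrightarrow> smooth_in A W (\<lambda>p. f p * g p)"
  unfolding smooth_in_def by (intro ballI smooth_on_mult open_chart_image) auto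

lemma smooth_in_divide:
  "open W \<Longrightarrow> smooth_in A W f \<Longrightarrow> smooth_in A W g \<Longrightarrow> (\<And>p. p \<in> W \<Longrightarrow> g p \<noteq> 0)
    \<Longrightarrow> smooth_in A W (\<lambda>p. f p / g p)"
  unfolding smooth_in_def by (intro ballI smooth_on_divide open_chart_image) (auto simp: mem_chart_image)

lemma smooth_in_sum:
  "open W \<Longrightarrow> finite I \<Longrightarrow> (\<And>i. i \<in> I \<Longrightarrow> smooth_in A W (f i)) \<Longrightarrow> smooth_in A W (\<lambda>p. \<Sum>i\<in>I. f i p)"
  unfolding smooth_in_def by (intro ballI smooth_on_sum open_chart_image) auto

lemma smooth_in_pullback:
  assumes "c \<in> A" "open W" "W \<subseteq> fst c" "smooth_on (snd c ` W) F"
  shows "smooth_in A W (\<lambda>p. F (snd c p))"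
proof (rule smooth_in_chart[OF assms(1-3)])
  have "open (snd c ` W)" using open_chart_image[OF assms(1,2)] assms(3) by (simp add: Int_absorb1)
  then show "smooth_on (snd c ` W) (\<lambda>y. F (snd c (cinv c y)))"
    using assms(4) by (rule smooth_on_cong) (use assms in auto)
qed

lemma smooth_in_coordinate: "c \<in> A \<Longrightarrow> smooth_in A (fst c) (\<lambda>p. snd c p $ i)"
  using chart_homeomorphism[of c]
  by (intro smooth_in_pullback smooth_on_linear_image[OF bounded_linear_vec_nth] smooth_on_ident) auto

lemma smooth_in_chartD:
  "smooth_in A W f \<Longrightarrow> c \<in> A \<Longrightarrow> smooth_on (snd c ` (fst c \<inter> W)) (\<lambda>y. f (cinv c y))"
  by (simp add: smooth_in_def)

lemma smooth_in_fst_chartD: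
  "smooth_in A (fst c) f \<Longrightarrow> c \<in> A \<Longrightarrow> smooth_on (cran c) (\<lambda>y. f (cinv c y))"
  using smooth_in_chartD[of "fst c" f c] by simp

lemma smooth_in_continuous:
  assumes "smooth_in A W f" "open W"
  shows "continuous_on W f"
proof (rule continuous_at_imp_continuous_on, intro ballI)
  fix p assume "p \<in> W"
  obtain c where c: "c \<in> A" "p \<in> fst c" by (rule chart_cover)
  let ?V = "fst c \<inter> W"
  have V: "open ?V" using chart_homeomorphism(1)[OF c(1)] assms(2) by auto
  have "continuous_on ?V (\<lambda>q. f (cinv c (snd c q)))"
  proof (rule continuous_on_compose2[OF smooth_on_continuous[OF smooth_in_chartD[OF assms(1) c(1)]]])
    show "continuous_on ?V (snd c)"
      using homeomorphism_cont1[OF chart_homeomorphism(3)[OF c(1)]] continuous_on_subset by blast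
  qed auto
  then have "continuous_on ?V f"
    by (rule continuous_on_eq) (use c in auto)
  then show "isCont f p" using V \<open>p \<in> W\<close> c(2) by (simp add: continuous_on_eq_continuous_at)
qed

text \<open>\<open>W\<close> and the complement of \<open>K\<close> are open and cover the manifold;
  on the latter the function vanishes.\<close>

lemma smooth_in_extend_zero:
  assumes "open W" "smooth_in A W f" "closed K" "K \<subseteq> W" "\<And>p. p \<notin> K \<Longrightarrow> f p = 0"
  shows "smooth_in A UNIV f"
proof (rule smooth_in_local)
  fix p
  have "smooth_in A (- K) f"
    by (rule smooth_in_cong[OF _ smooth_in_const[of _ 0]]) (use assms in auto)
  then show "\<exists>V. open V \<and> p \<in> V \<and> smooth_in A V f"
    using assms by (cases "p \<in> K") (auto intro: exI[of _ "- K"] exI[of _ W])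
qed

lemma near_chartD:
  assumes "smooth_near A p f" "c \<in> A" "p \<in> fst c"
  obtains S where "open S" "snd c p \<in> S" "S \<subseteq> cran c" "smooth_on S (\<lambda>y. f (cinv c y))"
proof -
  obtain W where W: "open W" "p \<in> W" "smooth_in A W f" using assms(1) unfolding smooth_near_iff by blast
  show ?thesis
    by (rule that[OF open_chart_image[OF assms(2) W(1)] _ _ smooth_in_chartD[OF W(3) assms(2)]])
      (use W assms in auto)
qed

lemma near_has_derivative:
  assumes "smooth_near A p f" "c \<in> A" "p \<in> fst c"
  shows "((\<lambda>y. f (cinv c y)) has_derivative frechet_derivative (\<lambda>y. f (cinv c y)) (at (snd c p))) (at (snd c p))"
  using near_chartD[OF assms] smooth_on_has_derivative by metis

lemma near_coordinate: "c \<in> A \<Longrightarrow> p \<in> fst c \<Longrightarrow> smooth_near A p (\<lambda>q. snd c q $ i)"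
  by (rule smooth_in_near[OF smooth_in_coordinate chart_homeomorphism(1)])

section \<open>Tangent vectors in coordinates\<close>

lemma chart_tvec_eq:
  "smooth_near A p f \<Longrightarrow> chart_tvec A c p \<xi> f = frechet_derivative (\<lambda>y. f (cinv c y)) (at (snd c p)) \<xi>"
  by (simp add: chart_tvec_def o_def)

lemma component_chart_tvec:
  assumes "c \<in> A" "p \<in> fst c"
  shows "component c i (chart_tvec A c p \<xi>) = \<xi> $ i"
proof -
  have "((\<lambda>y. y $ i) has_derivative (\<lambda>y. y $ i)) (at (snd c p))"
    by (simp add: bounded_linear_imp_has_derivative bounded_linear_vec_nth)
  then have "((\<lambda>y. snd c (cinv c y) $ i) has_derivative (\<lambda>y. y $ i)) (at (snd c p))"
    by (rule has_derivative_transform_within_open[OF _ chart_homeomorphism(2)[OF assms(1)]])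
      (use assms in \<open>auto simp: chart_cinv\<close>)
  then show ?thesis
    unfolding component_def chart_tvec_eq[OF near_coordinate[OF assms]] by (simp add: has_derivative_frechet)
qed

lemma cvec_chart_tvec: "c \<in> A \<Longrightarrow> p \<in> fst c \<Longrightarrow> cvec c (chart_tvec A c p \<xi>) = \<xi>"
  by (simp add: vec_eq_iff component_chart_tvec)

text \<open>The vector is given through some chart \<open>d\<close>, and the chain rule for the
  transition map rewrites it in \<open>c\<close>. Equality as total functions holds because both
  sides are 0 on functions that are not smooth near \<open>p\<close>.\<close>

lemma tangent_in_chart:
  assumes v: "v \<in> tangent_space A p" and c: "c \<in> A" "p \<in> fst c"
  shows "v = chart_tvec A c p (cvec c v)"
proof
  fix f
  obtain d \<xi> where d: "d \<in> A" "p \<in> fst d" and v: "v = chart_tvec A d p \<xi>"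
    using v unfolding tangent_space_def by blast
  show "v f = chart_tvec A c p (cvec c v) f"
  proof (cases "smooth_near A p f")
    case True
    let ?T = "\<lambda>y. snd c (cinv d y)" and ?y = "snd d p"
    let ?T' = "frechet_derivative ?T (at ?y)"
    have y: "?y \<in> snd d ` (fst d \<inter> fst c)" using c d by auto
    have T: "(?T has_derivative ?T') (at ?y)"
      by (rule smooth_on_has_derivative[OF transition(1)[OF d(1) c(1)] y])
    have Ty: "?T ?y = snd c p" using d by simp
    have "((\<lambda>y. f (cinv c (?T y))) has_derivative
        (\<lambda>h. frechet_derivative (\<lambda>y. f (cinv c y)) (at (snd c p)) (?T' h))) (at ?y)"
      by (rule has_derivative_compose[OF T]) (use near_has_derivative[OF True c] Ty in simp)
    then have "((\<lambda>y. f (cinv d y)) has_derivative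
        (\<lambda>h. frechet_derivative (\<lambda>y. f (cinv c y)) (at (snd c p)) (?T' h))) (at ?y)"
      by (rule has_derivative_transform_within_open[OF _ open_chart_image[OF d(1) chart_homeomorphism(1)[OF c(1)]] y])
        (use c d in auto)
    then have "v f = frechet_derivative (\<lambda>y. f (cinv c y)) (at (snd c p)) (?T' \<xi>)"
      by (simp add: v chart_tvec_eq[OF True] has_derivative_frechet)
    moreover have "cvec c v = ?T' \<xi>"
    proof (subst vec_eq_iff, intro allI)
      fix i
      have "((\<lambda>y. ?T y $ i) has_derivative (\<lambda>h. ?T' h $ i)) (at ?y)"
        by (rule bounded_linear.has_derivative[OF bounded_linear_vec_nth T])
      then show "cvec c v $ i = ?T' \<xi> $ i"
        unfolding v cvec_nth component_def chart_tvec_eq[OF near_coordinate[OF c]]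
        by (simp add: has_derivative_frechet)
    qed
    ultimately show ?thesis by (simp add: chart_tvec_eq[OF True])
  next
    case False
    then show ?thesis by (simp add: v chart_tvec_def)
  qed
qed

lemma tangent_apply:
  assumes "v \<in> tangent_space A p" "c \<in> A" "p \<in> fst c" "smooth_near A p f"
  shows "v f = frechet_derivative (\<lambda>y. f (cinv c y)) (at (snd c p)) (cvec c v)"
  using tangent_in_chart[OF assms(1-3)] chart_tvec_eq[OF assms(4)] by metis

lemma tangent_apply_sum:
  assumes "v \<in> tangent_space A p" "c \<in> A" "p \<in> fst c" "smooth_near A p f"
  shows "v f = (\<Sum>i\<in>UNIV. component c i v * frechet_derivative (\<lambda>y. f (cinv c y)) (at (snd c p)) (axis i 1))"
  unfolding tangent_apply[OF assms]
  using linear_expand_axis[OF has_derivative_linear[OF near_has_derivative[OF assms(4,2,3)]], of "cvec c v"]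
  by simp

lemma tangent_not_smooth: "v \<in> tangent_space A p \<Longrightarrow> \<not> smooth_near A p f \<Longrightarrow> v f = 0"
  by (auto simp: tangent_space_def chart_tvec_def)

lemma chart_tvec_in: "c \<in> A \<Longrightarrow> p \<in> fst c \<Longrightarrow> chart_tvec A c p \<xi> \<in> tangent_space A p"
  unfolding tangent_space_def by blast

lemma chart_tvec_combination:
  assumes "c \<in> A" "p \<in> fst c"
  shows "chart_tvec A c p (a *\<^sub>R \<xi> + b *\<^sub>R \<eta>) = (\<lambda>f. a * chart_tvec A c p \<xi> f + b * chart_tvec A c p \<eta> f)"
proof
  fix f
  show "chart_tvec A c p (a *\<^sub>R \<xi> + b *\<^sub>R \<eta>) f = a * chart_tvec A c p \<xi> f + b * chart_tvec A c p \<eta> f"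
  proof (cases "smooth_near A p f")
    case True
    from near_has_derivative[OF True assms] have "linear (frechet_derivative (\<lambda>y. f (cinv c y)) (at (snd c p)))"
      by (rule has_derivative_linear)
    then show ?thesis by (simp add: chart_tvec_eq[OF True] linear_add linear_scale)
  qed (simp add: chart_tvec_def)
qed

lemma tangent_combination:
  assumes "v \<in> tangent_space A p" "w \<in> tangent_space A p"
  shows "(\<lambda>f. a * v f + b * w f) \<in> tangent_space A p"
proof -
  obtain c where c: "c \<in> A" "p \<in> fst c" by (rule chart_cover)
  have "(\<lambda>f. a * v f + b * w f) = chart_tvec A c p (a *\<^sub>R cvec c v + b *\<^sub>R cvec c w)"
    unfolding chart_tvec_combination[OF c] tangent_in_chart[OF assms(1) c, symmetric]
      tangent_in_chart[OF assms(2) c, symmetric] ..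
  then show ?thesis using chart_tvec_in[OF c] by simp
qed

lemma tangent_zero: "(\<lambda>f. 0) \<in> tangent_space A p"
proof -
  obtain c where c: "c \<in> A" "p \<in> fst c" by (rule chart_cover)
  show ?thesis
    using tangent_combination[OF chart_tvec_in[OF c] chart_tvec_in[OF c], of 0 _ 0] by simp
qed

lemma tangent_scale: "v \<in> tangent_space A p \<Longrightarrow> (\<lambda>f. a * v f) \<in> tangent_space A p"
  using tangent_combination[of v p v a 0] by simp

lemma near_mult:
  assumes "smooth_near A p f" "smooth_near A p g"
  shows "smooth_near A p (\<lambda>q. f q * g q)"
proof -
  obtain V W where V: "open V" "p \<in> V" "smooth_in A V f" and W: "open W" "p \<in> W" "smooth_in A W g"
    using assms unfolding smooth_near_iff by blast
  have "smooth_in A (V \<inter> W) (\<lambda>q. f q * g q)"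
    using V W by (intro smooth_in_mult) (auto intro: smooth_in_subset)
  then show ?thesis using V W smooth_in_near by blast
qed

lemma near_add:
  assumes "smooth_near A p f" "smooth_near A p g"
  shows "smooth_near A p (\<lambda>q. f q + g q)"
proof -
  obtain V W where V: "open V" "p \<in> V" "smooth_in A V f" and W: "open W" "p \<in> W" "smooth_in A W g"
    using assms unfolding smooth_near_iff by blast
  have "smooth_in A (V \<inter> W) (\<lambda>q. f q + g q)"
    using V W by (intro smooth_in_add) (auto intro: smooth_in_subset)
  then show ?thesis using V W smooth_in_near by blast
qed

lemma near_sum:
  assumes "finite I" "\<And>i. i \<in> I \<Longrightarrow> smooth_near A p (f i)"
  shows "smooth_near A p (\<lambda>q. \<Sum>i\<in>I. f i q)"
  using assms
proof (induction I rule: finite_induct)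
  case empty
  then show ?case using smooth_in_near[OF smooth_in_const open_UNIV UNIV_I, of p 0] by simp
next
  case (insert i I)
  then show ?case using near_add[of p "f i" "\<lambda>q. \<Sum>i\<in>I. f i q"] by simp
qed

lemma tangent_mult:
  assumes v: "v \<in> tangent_space A p" and fg: "smooth_near A p f" "smooth_near A p g"
  shows "v (\<lambda>q. f q * g q) = f p * v g + v f * g p"
proof -
  obtain c where c: "c \<in> A" "p \<in> fst c" by (rule chart_cover)
  show ?thesis
    using has_derivative_mult[OF near_has_derivative[OF fg(1) c] near_has_derivative[OF fg(2) c]] c
    by (simp add: tangent_apply[OF v c fg(1)] tangent_apply[OF v c fg(2)] tangent_apply[OF v c near_mult[OF fg]]
        has_derivative_frechet)
qed

lemma tangent_sum:
  assumes v: "v \<in> tangent_space A p" and "finite I" "\<And>i. i \<in> I \<Longrightarrow> smooth_near A p (f i)"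
  shows "v (\<lambda>q. \<Sum>i\<in>I. f i q) = (\<Sum>i\<in>I. v (f i))"
proof -
  obtain c where c: "c \<in> A" "p \<in> fst c" by (rule chart_cover)
  have "((\<lambda>y. \<Sum>i\<in>I. f i (cinv c y)) has_derivative
     (\<lambda>h. \<Sum>i\<in>I. frechet_derivative (\<lambda>y. f i (cinv c y)) (at (snd c p)) h)) (at (snd c p))"
    by (intro has_derivative_sum near_has_derivative assms c)
  then show ?thesis
    by (simp add: tangent_apply[OF v c near_sum[OF assms(2,3)]] tangent_apply[OF v c assms(3)] has_derivative_frechet)
qed

lemma tangent_const: "v \<in> tangent_space A p \<Longrightarrow> v (\<lambda>q. k) = 0"
proof -
  assume v: "v \<in> tangent_space A p"
  obtain c where c: "c \<in> A" "p \<in> fst c" by (rule chart_cover)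
  show ?thesis
    by (simp add: tangent_apply[OF v c smooth_in_near[OF smooth_in_const open_UNIV]])
qed

section \<open>Smooth vector fields and Lie brackets\<close>

lemma smooth_vfield_tangent: "smooth_vfield A X \<Longrightarrow> X p \<in> tangent_space A p"
  by (simp add: smooth_vfield_def)

lemma smooth_vfield_component:
  assumes "smooth_vfield A X" "c \<in> A"
  shows "smooth_on (cran c) (\<lambda>y. component c i (X (cinv c y)))"
    and "smooth_in A (fst c) (\<lambda>q. component c i (X q))"
proof -
  show *: "smooth_on (cran c) (\<lambda>y. component c i (X (cinv c y)))"
    using assms unfolding smooth_vfield_def by fastforce
  then show "smooth_in A (fst c) (\<lambda>q. component c i (X q))"
    by (intro smooth_in_chart[OF assms(2)] chart_homeomorphism assms) auto
qed

lemma smooth_in_derivative: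
  assumes c: "c \<in> A" and W: "open W" "W \<subseteq> fst c" and f: "smooth_in A W f"
  shows "smooth_in A W (\<lambda>q. frechet_derivative (\<lambda>y. f (cinv c y)) (at (snd c q)) \<xi>)"
  using smooth_in_chartD[OF f c] W
  by (intro smooth_in_pullback[OF c W] smooth_on_derivative) (simp add: Int_absorb1)

lemma smooth_vfield_apply:
  assumes X: "smooth_vfield A X" and W: "open W" and f: "smooth_in A W f"
  shows "smooth_in A W (\<lambda>q. X q f)"
proof (rule smooth_in_local)
  fix p assume p: "p \<in> W"
  obtain c where c: "c \<in> A" "p \<in> fst c" by (rule chart_cover)
  let ?V = "fst c \<inter> W"
  have V: "open ?V" using chart_homeomorphism(1)[OF c(1)] W by auto
  have "smooth_in A ?V (\<lambda>q. \<Sum>i\<in>UNIV. component c i (X q) *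
      frechet_derivative (\<lambda>y. f (cinv c y)) (at (snd c q)) (axis i 1))"
    using V c f
    by (intro smooth_in_sum smooth_in_mult smooth_in_derivative
        smooth_in_subset[OF smooth_vfield_component(2)[OF X c(1)]]) (auto intro: smooth_in_subset)
  then have "smooth_in A ?V (\<lambda>q. X q f)"
    by (rule smooth_in_cong[OF V])
      (use tangent_apply_sum[OF smooth_vfield_tangent[OF X] c(1)] smooth_in_near[OF f W] in auto)
  then show "\<exists>V. open V \<and> p \<in> V \<and> smooth_in A V (\<lambda>q. X q f)"
    using V p c by blast
qed

text \<open>Components are values on coordinate functions, which are smooth on the chart domain.
  Multiples, brackets and cut-off fields can therefore be checked through their action on
  functions.\<close>

lemma smooth_vfieldI:
  assumes "\<And>p. X p \<in> tangent_space A p"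
    and "\<And>W f. open W \<Longrightarrow> smooth_in A W f \<Longrightarrow> smooth_in A W (\<lambda>q. X q f)"
  shows "smooth_vfield A X"
  unfolding smooth_vfield_def
proof (intro conjI allI ballI, rule assms(1), clarify)
  fix U and \<phi> :: "'a \<Rightarrow> real ^ 'n" and i
  assume c: "(U, \<phi>) \<in> A"
  have "smooth_in A U (\<lambda>q. X q (\<lambda>q. \<phi> q $ i))"
    using assms(2)[OF chart_homeomorphism(1)[OF c] smooth_in_coordinate[OF c, of i]] by simp
  then show "smooth_on (\<phi> ` U) (\<lambda>y. component (U, \<phi>) i (X (inv_into U \<phi> y)))"
    using smooth_in_fst_chartD[of "(U, \<phi>)"] c by (simp add: component_def)
qed

lemma smooth_vfield_mult:
  assumes f: "smooth_in A UNIV f" and X: "smooth_vfield A X"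
  shows "smooth_vfield A (\<lambda>p g. f p * X p g)"
  using f by (intro smooth_vfieldI tangent_scale smooth_vfield_tangent[OF X] smooth_in_mult
      smooth_vfield_apply[OF X]) (auto intro: smooth_in_subset)

text \<open>Product rule for the sum of X^i times the i-th partial of f. The second-order part is
  collected with the direction frozen at \<open>X p\<close>, the form in which it is symmetric in
  \<open>h\<close> and \<open>X p\<close>.\<close>

lemma derivative_of_vfield_apply:
  assumes X: "smooth_vfield A X" and c: "c \<in> A" "p \<in> fst c" and f: "smooth_near A p f"
  shows "frechet_derivative (\<lambda>y. X (cinv c y) f) (at (snd c p)) h =
    (\<Sum>i\<in>UNIV. frechet_derivative (\<lambda>y. component c i (X (cinv c y))) (at (snd c p)) h *
        frechet_derivative (\<lambda>y. f (cinv c y)) (at (snd c p)) (axis i 1)) +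
    frechet_derivative (\<lambda>y. frechet_derivative (\<lambda>y. f (cinv c y)) (at y) (cvec c (X p))) (at (snd c p)) h"
proof -
  let ?F = "\<lambda>y. f (cinv c y)"
  let ?D = "\<lambda>\<xi> y. frechet_derivative ?F (at y) \<xi>"
  let ?X = "\<lambda>i y. component c i (X (cinv c y))"
  obtain W where W: "open W" "p \<in> W" "smooth_in A W f" using f unfolding smooth_near_iff by blast
  let ?S = "snd c ` (fst c \<inter> W)"
  have S: "open ?S" "snd c p \<in> ?S" using open_chart_image[OF c(1) W(1)] W c by auto
  have F: "smooth_on ?S ?F" by (rule smooth_in_chartD[OF W(3) c(1)])
  have dX: "(?X i has_derivative frechet_derivative (?X i) (at (snd c p))) (at (snd c p))" for i
    by (rule smooth_on_has_derivative[OF smooth_vfield_component(1)[OF X c(1)]]) (use c in auto)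
  have dD: "(?D \<xi> has_derivative frechet_derivative (?D \<xi>) (at (snd c p))) (at (snd c p))" for \<xi>
    by (rule smooth_on_has_derivative[OF smooth_on_derivative[OF F]]) (rule S)
  have expand: "?D \<xi> y = (\<Sum>i\<in>UNIV. \<xi> $ i * ?D (axis i 1) y)" if "y \<in> ?S" for y \<xi>
    by (rule linear_expand_axis[OF has_derivative_linear[OF smooth_on_has_derivative[OF F that]]])
  have "((\<lambda>y. \<Sum>i\<in>UNIV. ?X i y * ?D (axis i 1) y) has_derivative
     (\<lambda>h. \<Sum>i\<in>UNIV. ?X i (snd c p) * frechet_derivative (?D (axis i 1)) (at (snd c p)) h +
        frechet_derivative (?X i) (at (snd c p)) h * ?D (axis i 1) (snd c p))) (at (snd c p))"
    by (intro has_derivative_sum has_derivative_mult dX dD)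
  then have "((\<lambda>y. X (cinv c y) f) has_derivative
     (\<lambda>h. \<Sum>i\<in>UNIV. ?X i (snd c p) * frechet_derivative (?D (axis i 1)) (at (snd c p)) h +
        frechet_derivative (?X i) (at (snd c p)) h * ?D (axis i 1) (snd c p))) (at (snd c p))"
  proof (rule has_derivative_transform_within_open[OF _ S])
    fix y assume "y \<in> ?S"
    then obtain q where q: "q \<in> fst c" "q \<in> W" "y = snd c q" by auto
    show "(\<Sum>i\<in>UNIV. ?X i y * ?D (axis i 1) y) = X (cinv c y) f"
      using tangent_apply_sum[OF smooth_vfield_tangent[OF X] c(1) q(1) smooth_in_near[OF W(3,1) q(2)]]
      by (simp add: q c(1))
  qed
  moreover have "((\<lambda>y. \<Sum>i\<in>UNIV. cvec c (X p) $ i * ?D (axis i 1) y) has_derivative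
      (\<lambda>h. \<Sum>i\<in>UNIV. cvec c (X p) $ i * frechet_derivative (?D (axis i 1)) (at (snd c p)) h)) (at (snd c p))"
    by (intro has_derivative_sum has_derivative_mult_right dD)
  then have "(?D (cvec c (X p)) has_derivative
      (\<lambda>h. \<Sum>i\<in>UNIV. cvec c (X p) $ i * frechet_derivative (?D (axis i 1)) (at (snd c p)) h)) (at (snd c p))"
    by (rule has_derivative_transform_within_open[OF _ S]) (rule expand[symmetric])
  ultimately show ?thesis
    using c by (simp add: has_derivative_frechet sum.distrib)
qed

text \<open>The second derivatives of the test function cancel by symmetry, which leaves a
  first-order operator, that is, a tangent vector.\<close>

lemma smooth_vfield_lie_bracket:
  assumes X: "smooth_vfield A X" and Y: "smooth_vfield A Y"
  shows "smooth_vfield A (lie_bracket A X Y)"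
proof (rule smooth_vfieldI)
  fix p
  obtain c where c: "c \<in> A" "p \<in> fst c" by (rule chart_cover)
  let ?D = "\<lambda>F. frechet_derivative F (at (snd c p))"
  \<comment> \<open>The classical components X(Y^i) - Y(X^i) of the bracket.\<close>
  let ?\<xi> = "\<chi> i. ?D (\<lambda>y. component c i (Y (cinv c y))) (cvec c (X p)) - ?D (\<lambda>y. component c i (X (cinv c y))) (cvec c (Y p))"
  have "lie_bracket A X Y p f = chart_tvec A c p ?\<xi> f" for f
  proof (cases "smooth_near A p f")
    case True
    obtain W where W: "open W" "p \<in> W" "smooth_in A W f" using True unfolding smooth_near_iff by blast
    have 1: "X p (\<lambda>q. Y q f) = ?D (\<lambda>y. Y (cinv c y) f) (cvec c (X p))"
      by (rule tangent_apply[OF smooth_vfield_tangent[OF X] c smooth_in_near[OF smooth_vfield_apply[OF Y W(1,3)] W(1,2)]])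
    have 2: "Y p (\<lambda>q. X q f) = ?D (\<lambda>y. X (cinv c y) f) (cvec c (Y p))"
      by (rule tangent_apply[OF smooth_vfield_tangent[OF Y] c smooth_in_near[OF smooth_vfield_apply[OF X W(1,3)] W(1,2)]])
    have "Ck_on 2 (snd c ` (fst c \<inter> W)) (\<lambda>y. f (cinv c y))"
      using smooth_in_chartD[OF W(3) c(1)] by (simp add: smooth_on_def)
    then have 3: "?D (\<lambda>y. frechet_derivative (\<lambda>y. f (cinv c y)) (at y) (cvec c (Y p))) (cvec c (X p)) =
        ?D (\<lambda>y. frechet_derivative (\<lambda>y. f (cinv c y)) (at y) (cvec c (X p))) (cvec c (Y p))"
      by (rule mixed_derivatives_commute[rotated 2]) (use open_chart_image[OF c(1) W(1)] W c in auto)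
    have "lie_bracket A X Y p f = (\<Sum>i\<in>UNIV. ?\<xi> $ i * ?D (\<lambda>y. f (cinv c y)) (axis i 1))"
      using True 3 unfolding lie_bracket_def 1 2 derivative_of_vfield_apply[OF X c True] derivative_of_vfield_apply[OF Y c True]
      by (simp add: left_diff_distrib sum_subtractf)
    also have "\<dots> = ?D (\<lambda>y. f (cinv c y)) ?\<xi>"
      by (rule linear_expand_axis[OF has_derivative_linear[OF near_has_derivative[OF True c]], symmetric])
    finally show ?thesis by (simp add: chart_tvec_eq[OF True])
  qed (simp add: lie_bracket_def chart_tvec_def)
  then have "lie_bracket A X Y p = chart_tvec A c p ?\<xi>" by blast
  then show "lie_bracket A X Y p \<in> tangent_space A p" using chart_tvec_in[OF c] by simp
next
  fix W f assume W: "open W" "smooth_in A W f"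
  have "smooth_in A W (\<lambda>q. X q (\<lambda>r. Y r f) - Y q (\<lambda>r. X r f))"
    using W by (intro smooth_in_diff smooth_vfield_apply[OF X] smooth_vfield_apply[OF Y])
  then show "smooth_in A W (\<lambda>q. lie_bracket A X Y q f)"
    by (rule smooth_in_cong[OF W(1)]) (simp add: lie_bracket_def smooth_in_near[OF W(2,1)])
qed

end

section \<open>The measure of a volume form\<close>

locale compact_manifold_volume = manifold A
  for A :: "('a::t2_space, 'n::finite) chart set" +
  fixes \<mu> :: "('a, 'n) top_form"
  assumes volume: "volume_form A \<mu>"
    and compact_UNIV: "compact (UNIV :: 'a set)"
begin

abbreviation dens :: "('a, 'n) chart \<Rightarrow> real ^ 'n \<Rightarrow> real" where
  "dens c \<equiv> form_density A \<mu> c"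

lemma dens_smooth: "c \<in> A \<Longrightarrow> smooth_on (cran c) (dens c)"
  and dens_pos: "c \<in> A \<Longrightarrow> y \<in> cran c \<Longrightarrow> dens c y > 0"
  using volume unfolding volume_form_def by blast+

lemma form_combination:
  assumes "\<And>j. v j \<in> tangent_space A p" "x \<in> tangent_space A p" "y \<in> tangent_space A p"
  shows "\<mu> p (v(i := (\<lambda>f. a * x f + b * y f))) = a * \<mu> p (v(i := x)) + b * \<mu> p (v(i := y))"
proof -
  have "\<forall>p v i. (\<forall>j. v j \<in> tangent_space A p) \<longrightarrow>
      (\<forall>x\<in>tangent_space A p. \<forall>y\<in>tangent_space A p. \<forall>a b.
         \<mu> p (v(i := (\<lambda>f. a * x f + b * y f))) = a * \<mu> p (v(i := x)) + b * \<mu> p (v(i := y)))"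
    using volume unfolding volume_form_def by (rule conjunct1)
  then show ?thesis using assms by simp
qed

lemma form_alternating:
  assumes "\<And>k. v k \<in> tangent_space A p" "i \<noteq> j" "v i = v j"
  shows "\<mu> p v = 0"
proof -
  have "\<forall>p v i j. (\<forall>k. v k \<in> tangent_space A p) \<longrightarrow> i \<noteq> j \<longrightarrow> v i = v j \<longrightarrow> \<mu> p v = 0"
    using volume unfolding volume_form_def by (elim conjE)
  then show ?thesis using assms by metis
qed

lemma alternating_form_chart:
  assumes d: "d \<in> A" "p \<in> fst d"
  shows "alternating_form (\<lambda>v. \<mu> p (\<lambda>i. chart_tvec A d p (v i)))"
proof
  fix v :: "'n \<Rightarrow> real ^ 'n" and i a b and x y :: "real ^ 'n"
  have upd: "(\<lambda>k. chart_tvec A d p ((v(i := z)) k)) = (\<lambda>k. chart_tvec A d p (v k))(i := chart_tvec A d p z)" for z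
    by auto
  show "\<mu> p (\<lambda>k. chart_tvec A d p ((v(i := a *\<^sub>R x + b *\<^sub>R y)) k)) =
    a * \<mu> p (\<lambda>k. chart_tvec A d p ((v(i := x)) k)) + b * \<mu> p (\<lambda>k. chart_tvec A d p ((v(i := y)) k))"
    unfolding upd chart_tvec_combination[OF d]
    by (rule form_combination) (rule chart_tvec_in[OF d])+
next
  fix i j and v :: "'n \<Rightarrow> real ^ 'n"
  assume "i \<noteq> j" "v i = v j"
  then show "\<mu> p (\<lambda>k. chart_tvec A d p (v k)) = 0"
    by (intro form_alternating[of _ p i j] chart_tvec_in[OF d]) auto
qed

text \<open>The coordinate vectors of \<open>c\<close>, written in \<open>d\<close>, are the columns
  of the Jacobian matrix. As \<open>alternating_form_eq_det\<close> reads a matrix by rows, the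
  transpose is inserted.\<close>

lemma density_transform:
  assumes c: "c \<in> A" "p \<in> fst c" and d: "d \<in> A" "p \<in> fst d"
  shows "dens c (snd c p) =
    det (matrix (frechet_derivative (\<lambda>y. snd d (cinv c y)) (at (snd c p)))) * dens d (snd d p)"
proof -
  let ?T = "\<lambda>y. snd d (cinv c y)"
  let ?T' = "frechet_derivative ?T (at (snd c p))"
  have T: "(?T has_derivative ?T') (at (snd c p))"
    by (rule smooth_on_has_derivative[OF transition(1)[OF c(1) d(1)]]) (use c d in auto)
  have "coord_tvec A c p i = chart_tvec A d p (?T' (axis i 1))" for i
  proof -
    have "component d j (coord_tvec A c p i) = ?T' (axis i 1) $ j" for j
    proof -
      have "((\<lambda>y. ?T y $ j) has_derivative (\<lambda>h. ?T' h $ j)) (at (snd c p))"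
        by (rule bounded_linear.has_derivative[OF bounded_linear_vec_nth T])
      then show ?thesis
        unfolding component_def coord_tvec_def chart_tvec_eq[OF near_coordinate[OF d]]
        by (simp add: has_derivative_frechet)
    qed
    then have "cvec d (coord_tvec A c p i) = ?T' (axis i 1)" by (simp add: vec_eq_iff)
    then show ?thesis
      using tangent_in_chart[OF _ d, of "coord_tvec A c p i"] chart_tvec_in[OF c] by (simp add: coord_tvec_def)
  qed
  moreover have "transpose (matrix ?T') $ i = ?T' (axis i 1)" for i
    by (simp add: transpose_def matrix_def vec_eq_iff)
  ultimately have "coord_tvec A c p = (\<lambda>i. chart_tvec A d p (transpose (matrix ?T') $ i))" by auto
  then have "\<mu> p (coord_tvec A c p) = det (matrix ?T') * \<mu> p (\<lambda>i. chart_tvec A d p (axis i 1))"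
    using alternating_form_eq_det[OF alternating_form_chart[OF d], of "transpose (matrix ?T')"] by simp
  then show ?thesis
    using c d by (simp add: form_density_def coord_tvec_def[abs_def] Let_def)
qed

text \<open>Constant off the chart range, so that it is Borel measurable as a total
  function.\<close>

definition cinv_total :: "('a, 'n) chart \<Rightarrow> real ^ 'n \<Rightarrow> 'a" where
  "cinv_total c y = (if y \<in> cran c then cinv c y else undefined)"

text \<open>The pushforward of the coordinate measure with density \<open>dens c\<close>. The
  indicator removes the points off the chart range, where the density has no meaning.\<close>

definition chart_measure :: "('a, 'n) chart \<Rightarrow> 'a measure" where
  "chart_measure c = distr (density lborel (\<lambda>y. ennreal (indicator (cran c) y * dens c y))) borel (cinv_total c)"

lemma cran_borel: "c \<in> A \<Longrightarrow> cran c \<in> sets borel"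
  by (simp add: borel_open chart_homeomorphism(2))

lemma measurable_cinv_total: "c \<in> A \<Longrightarrow> cinv_total c \<in> borel_measurable borel"
  unfolding cinv_total_def
  by (intro borel_measurable_continuous_on_if cran_borel)
    (auto intro: homeomorphism_cont2[OF chart_homeomorphism(3)])

lemma measurable_dens: "c \<in> A \<Longrightarrow> (\<lambda>y. indicator (cran c) y * dens c y) \<in> borel_measurable borel"
  using borel_measurable_continuous_on_indicator[OF cran_borel smooth_on_continuous[OF dens_smooth]]
  by simp

lemma dens_nonneg: "c \<in> A \<Longrightarrow> 0 \<le> indicator (cran c) y * dens c y"
  using dens_pos[of c y] by (auto simp: indicator_def)

lemma chart_image_eq: "c \<in> A \<Longrightarrow> snd c ` (fst c \<inter> B) = cran c \<inter> cinv_total c -` B"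
  using mem_chart_image[of c _ B] by (auto simp: cinv_total_def)

lemma chart_image_borel: "c \<in> A \<Longrightarrow> B \<in> sets borel \<Longrightarrow> snd c ` (fst c \<inter> B) \<in> sets borel"
  using measurable_sets[OF measurable_cinv_total, of c B] cran_borel by (simp add: chart_image_eq)

lemma sets_chart_measure [simp]: "sets (chart_measure c) = sets borel"
  by (simp add: chart_measure_def)

lemma indicator_chart_image:
  "c \<in> A \<Longrightarrow> indicator (snd c ` (fst c \<inter> B)) y * dens c y =
    indicator (cran c) y * dens c y * indicator (cinv_total c -` B) y"
  by (simp add: chart_image_eq indicator_inter_arith)

lemma emeasure_chart_measure:
  assumes c: "c \<in> A" and B: "B \<in> sets borel"
  shows "emeasure (chart_measure c) B = (\<integral>\<^sup>+y. ennreal (indicator (snd c ` (fst c \<inter> B)) y * dens c y) \<partial>lborel)"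
proof -
  have [measurable]: "cinv_total c \<in> borel_measurable borel" "(\<lambda>y. indicator (cran c) y * dens c y) \<in> borel_measurable borel"
    using measurable_cinv_total measurable_dens c by auto
  have "cinv_total c -` B \<in> sets borel" using measurable_sets[OF measurable_cinv_total[OF c] B] by simp
  then have "emeasure (chart_measure c) B =
      (\<integral>\<^sup>+y. ennreal (indicator (cran c) y * dens c y) * indicator (cinv_total c -` B) y \<partial>lborel)"
    using B by (simp add: chart_measure_def emeasure_distr emeasure_density)
  also have "\<dots> = (\<integral>\<^sup>+y. ennreal (indicator (snd c ` (fst c \<inter> B)) y * dens c y) \<partial>lborel)"
    unfolding indicator_chart_image[OF c] by (intro nn_integral_cong) (simp split: split_indicator)
  finally show ?thesis .
qed

text \<open>Change of variables along the transition map. The orientation makes its Jacobian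
  determinant positive, so the absolute value in the formula disappears and
  \<open>density_transform\<close> applies.\<close>

lemma chart_measure_agree:
  assumes c: "c \<in> A" and d: "d \<in> A" and B: "B \<in> sets borel" "B \<subseteq> fst c" "B \<subseteq> fst d"
  shows "emeasure (chart_measure c) B = emeasure (chart_measure d) B"
proof -
  let ?T = "\<lambda>y. snd d (cinv c y)"
  let ?T' = "\<lambda>y. frechet_derivative ?T (at y)"
  let ?S = "snd c ` (fst c \<inter> B)"
  have dT: "(?T has_derivative ?T' y) (at y)" if "y \<in> ?S" for y
    using that B c by (intro smooth_on_has_derivative[OF transition(1)[OF c d]]) auto
  have img: "?T ` ?S = snd d ` (fst d \<inter> B)"
    using B c by (force simp: image_iff)
  have eq: "indicator ?S y * dens c y = indicator ?S y * (\<bar>det (matrix (?T' y))\<bar> * dens d (?T y))" for y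
  proof (cases "y \<in> ?S")
    case True
    then obtain p where p: "p \<in> fst c" "p \<in> B" "y = snd c p" by auto
    have "det (matrix (?T' y)) > 0" using p B by (intro transition(2)[OF c d]) auto
    then show ?thesis using density_transform[OF c p(1) d] p B c True by auto
  qed simp
  have meas: "(\<lambda>y. indicator (snd e ` (fst e \<inter> B)) y * dens e y) \<in> borel_measurable borel" if e: "e \<in> A" for e
  proof -
    have [measurable]: "(\<lambda>y. indicator (cran e) y * dens e y) \<in> borel_measurable borel" by (rule measurable_dens[OF e])
    have [measurable]: "cinv_total e -` B \<in> sets borel"
      using measurable_sets[OF measurable_cinv_total[OF e] B(1)] by simp
    show ?thesis unfolding indicator_chart_image[OF e] by measurable
  qed
  have "(\<integral>\<^sup>+y. ennreal (indicator (?T ` ?S) y * dens d y) \<partial>lborel) =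
     (\<integral>\<^sup>+y. ennreal (indicator ?S y * (\<bar>det (matrix (?T' y))\<bar> * dens d (?T y))) \<partial>lborel)"
  proof (rule nn_integral_change_of_variables[OF chart_image_borel[OF c B(1)] dT])
    show "inj_on ?T ?S"
    proof (rule inj_on_inverseI[of _ "\<lambda>z. snd c (cinv d z)"])
      fix y assume "y \<in> ?S"
      then show "snd c (cinv d (?T y)) = y" using B c d by auto
    qed
    show "0 \<le> dens d (?T y)" if "y \<in> ?S" for y
      using that B c d by (auto intro!: less_imp_le dens_pos)
    show "(\<lambda>y. indicator (?T ` ?S) y * dens d y) \<in> borel_measurable borel"
      unfolding img by (rule meas[OF d])
    show "(\<lambda>y. indicator ?S y * (\<bar>det (matrix (?T' y))\<bar> * dens d (?T y))) \<in> borel_measurable borel"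
      using meas[OF c] unfolding eq .
  qed
  then show ?thesis
    unfolding emeasure_chart_measure[OF c B(1)] emeasure_chart_measure[OF d B(1)] img[symmetric] eq by (rule sym)
qed

section \<open>Finite covers by chart balls\<close>

definition region :: "('a, 'n) chart \<times> (real ^ 'n) \<times> real \<Rightarrow> 'a set" where
  "region = (\<lambda>(c, a, r). {p \<in> fst c. snd c p \<in> ball a r})"

text \<open>The closed ball has to lie in the chart range: this makes the chart measure of the
  region finite and lets bump functions have compact support within the chart domain.\<close>

definition chart_balls :: "(('a, 'n) chart \<times> (real ^ 'n) \<times> real) set" where
  "chart_balls = {(c, a, r). c \<in> A \<and> r > 0 \<and> cball a r \<subseteq> cran c}"

lemma chart_ball_at:
  assumes "c \<in> A" "p \<in> fst c" "open W" "p \<in> W"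
  obtains r where "r > 0" "cball (snd c p) r \<subseteq> snd c ` (fst c \<inter> W)" "(c, snd c p, r) \<in> chart_balls"
proof -
  have "snd c p \<in> snd c ` (fst c \<inter> W)" using assms by auto
  then obtain r where r: "r > 0" "cball (snd c p) r \<subseteq> snd c ` (fst c \<inter> W)"
    using open_chart_image[OF assms(1,3)] open_contains_cball by blast
  then have "(c, snd c p, r) \<in> chart_balls" using assms unfolding chart_balls_def by blast
  then show ?thesis using r that by blast
qed

lemma open_region:
  assumes "t \<in> chart_balls"
  shows "open (region t)"
proof -
  obtain c a r where t: "t = (c, a, r)" "c \<in> A" using assms unfolding chart_balls_def by blast
  have "open (fst c \<inter> snd c -` ball a r)"
    using homeomorphism_cont1[OF chart_homeomorphism(3)[OF t(2)]] chart_homeomorphism(1)[OF t(2)]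
    by (intro continuous_open_preimage) auto
  moreover have "region t = fst c \<inter> snd c -` ball a r" by (auto simp: t region_def)
  ultimately show ?thesis by simp
qed

lemma finite_chart_balls_cover:
  obtains I where "finite I" "I \<subseteq> chart_balls" "(\<Union>t\<in>I. region t) = UNIV"
proof -
  have "\<exists>t\<in>chart_balls. p \<in> region t" for p
  proof -
    obtain c where c: "c \<in> A" "p \<in> fst c" by (rule chart_cover)
    obtain r where "r > 0" "(c, snd c p, r) \<in> chart_balls" using chart_ball_at[OF c open_UNIV] by blast
    then show ?thesis using c by (intro bexI[of _ "(c, snd c p, r)"]) (auto simp: region_def)
  qed
  then have "UNIV \<subseteq> (\<Union>t\<in>chart_balls. region t)" by blast
  then obtain I where "I \<subseteq> chart_balls" "finite I" "UNIV \<subseteq> (\<Union>t\<in>I. region t)"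
    using compactE_image[OF compact_UNIV, of chart_balls region] open_region by metis
  then show ?thesis using that by blast
qed

lemma chart_measure_region_finite:
  assumes "(c, a, r) \<in> chart_balls"
  shows "emeasure (chart_measure c) (region (c, a, r)) < \<infinity>"
proof -
  have c: "c \<in> A" "cball a r \<subseteq> cran c" using assms by (auto simp: chart_balls_def)
  have "continuous_on (cball a r) (dens c)"
    using smooth_on_continuous[OF dens_smooth[OF c(1)]] c(2) continuous_on_subset by blast
  from borel_integrable_compact[OF compact_cball this]
  have "integrable lborel (\<lambda>y. indicator (cball a r) y *\<^sub>R dens c y)" .
  then have "(\<integral>\<^sup>+y. ennreal (norm (indicator (cball a r) y *\<^sub>R dens c y)) \<partial>lborel) < \<infinity>"
    by (simp add: integrable_iff_bounded)
  moreover have "emeasure (chart_measure c) (region (c, a, r)) \<le>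
      (\<integral>\<^sup>+y. ennreal (norm (indicator (cball a r) y *\<^sub>R dens c y)) \<partial>lborel)"
    unfolding emeasure_chart_measure[OF c(1) borel_open[OF open_region[OF assms]]]
    by (intro nn_integral_mono ennreal_leI) (auto simp: indicator_def region_def)
  ultimately show ?thesis by (rule le_less_trans[rotated])
qed

text \<open>Used both to glue the chart measures and to show that they determine the result: on each
  piece a single chart decides, and additivity does the rest.\<close>

lemma disjoint_chart_pieces:
  obtains N :: nat and c E where "\<forall>k<N. c k \<in> A \<and> E k \<in> sets borel \<and> E k \<subseteq> fst (c k) \<and>
      emeasure (chart_measure (c k)) (E k) < \<infinity>"
    "disjoint_family_on E {0..<N}" "(\<Union>k\<in>{0..<N}. E k) = UNIV"
proof -
  obtain I where I: "finite I" "I \<subseteq> chart_balls" "(\<Union>t\<in>I. region t) = UNIV"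
    by (rule finite_chart_balls_cover)
  obtain N h where h: "I = h ` {i. i < (N::nat)}" using finite_imp_nat_seg_image_inj_on[OF I(1)] by blast
  \<comment> \<open>\<open>disjointed\<close> acts on sequences indexed by all naturals, hence the
    empty sets beyond \<open>N\<close>.\<close>
  define R where "R k = (if k < N then region (h k) else {})" for k
  define E where "E = disjointed R"
  have hk: "h k \<in> chart_balls" if "k < N" for k using that h I(2) by auto
  then have "range R \<subseteq> sets borel" by (auto simp: R_def borel_open open_region)
  then have E: "E k \<in> sets borel" for k unfolding E_def using sets.range_disjointed_sets by blast
  have ER: "E k \<subseteq> R k" for k unfolding E_def by (rule disjointed_subset)
  show ?thesis
  proof (rule that[of N "\<lambda>k. fst (h k)" E], intro allI impI)
    fix k assume k: "k < N"
    obtain c a r where t: "h k = (c, a, r)" by (metis prod_cases3)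
    have cb: "(c, a, r) \<in> chart_balls" using hk[OF k] t by simp
    have "emeasure (chart_measure c) (E k) \<le> emeasure (chart_measure c) (region (c, a, r))"
      using ER[of k] k t borel_open[OF open_region[OF cb]] by (intro emeasure_mono) (auto simp: R_def)
    then have "emeasure (chart_measure c) (E k) < \<infinity>"
      using chart_measure_region_finite[OF cb] by (rule le_less_trans)
    moreover have "E k \<subseteq> fst c" using ER[of k] k t by (auto simp: R_def region_def)
    ultimately show "fst (h k) \<in> A \<and> E k \<in> sets borel \<and> E k \<subseteq> fst (fst (h k)) \<and>
        emeasure (chart_measure (fst (h k))) (E k) < \<infinity>"
      using E cb t by (auto simp: chart_balls_def)
  next
    show "disjoint_family_on E {0..<N}"
      using disjoint_family_disjointed[of R] unfolding E_def disjoint_family_on_def by blast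
    have "(\<Union>k\<in>{0..<N}. E k) = (\<Union>k\<in>{0..<N}. R k)" unfolding E_def by (rule finite_UN_disjointed_eq)
    also have "\<dots> = (\<Union>t\<in>I. region t)" using h by (auto simp: R_def)
    finally show "(\<Union>k\<in>{0..<N}. E k) = UNIV" using I(3) by simp
  qed
qed

section \<open>Existence and uniqueness of the measure\<close>

definition chart_compatible :: "'a measure \<Rightarrow> bool" where
  "chart_compatible m \<longleftrightarrow> sets m = sets borel \<and>
    (\<forall>c\<in>A. \<forall>B\<in>sets borel. B \<subseteq> fst c \<longrightarrow> emeasure m B = emeasure (chart_measure c) B)"

text \<open>Every piece is measured in its own chart. Compatibility with an arbitrary chart
  \<open>d\<close> follows because the two chart measures agree on the part of \<open>B\<close> in
  each piece.\<close>

lemma chart_compatible_exists: "\<exists>m. chart_compatible m \<and> emeasure m UNIV < \<infinity>"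
proof -
  obtain N :: nat and c E where N': "\<forall>k<N. c k \<in> A \<and> E k \<in> sets borel \<and> E k \<subseteq> fst (c k) \<and>
      emeasure (chart_measure (c k)) (E k) < \<infinity>"
    and disj: "disjoint_family_on E {0..<N}" and cover: "(\<Union>k\<in>{0..<N}. E k) = UNIV"
    by (rule disjoint_chart_pieces)
  have N: "c k \<in> A \<and> E k \<in> sets borel \<and> E k \<subseteq> fst (c k) \<and> emeasure (chart_measure (c k)) (E k) < \<infinity>"
    if "k < N" for k using N' that by blast
  define m0 where "m0 B = (\<Sum>k\<in>{0..<N}. emeasure (chart_measure (c k)) (B \<inter> E k))" for B
  define m where "m = measure_of UNIV (sets borel) m0"
  have "countably_additive (sets borel) m0"
  proof (rule countably_additiveI)
    fix F :: "nat \<Rightarrow> 'a set" assume F: "range F \<subseteq> sets borel" "disjoint_family F"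
    have "(\<Sum>i. emeasure (chart_measure (c k)) (F i \<inter> E k)) = emeasure (chart_measure (c k)) (\<Union>i. F i \<inter> E k)"
      if "k < N" for k
      using F N[OF that] by (intro suminf_emeasure) (auto simp: disjoint_family_on_def)
    then have "(\<Sum>k\<in>{0..<N}. \<Sum>i. emeasure (chart_measure (c k)) (F i \<inter> E k)) = m0 (\<Union>i. F i)"
      unfolding m0_def by (intro sum.cong) auto
    then show "(\<Sum>i. m0 (F i)) = m0 (\<Union>i. F i)"
      unfolding m0_def by (subst suminf_sum) auto
  qed
  then have m: "emeasure m B = m0 B" if "B \<in> sets borel" for B
    unfolding m_def using that sets.sigma_algebra_axioms[of "borel :: 'a measure"]
    by (intro emeasure_measure_of_sigma) (auto simp: positive_def m0_def)
  have sets_m: "sets m = sets borel" unfolding m_def using sets.sets_measure_of_eq[of "borel :: 'a measure"] by simp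
  have "emeasure m B = emeasure (chart_measure d) B" if d: "d \<in> A" "B \<in> sets borel" "B \<subseteq> fst d" for d B
  proof -
    have "emeasure m B = (\<Sum>k\<in>{0..<N}. emeasure (chart_measure d) (B \<inter> E k))"
      unfolding m[OF d(2)] m0_def using d N by (intro sum.cong chart_measure_agree) auto
    also have "\<dots> = emeasure (chart_measure d) B"
      using disj cover d N by (intro sum_emeasure_cover[symmetric]) auto
    finally show ?thesis .
  qed
  moreover have "emeasure m UNIV < \<infinity>"
    using N by (simp add: m m0_def ennreal_sum_less_top)
  ultimately show ?thesis using sets_m unfolding chart_compatible_def by blast
qed

lemma chart_compatible_unique:
  assumes "chart_compatible m" "chart_compatible m'"
  shows "m = m'"
proof -
  obtain N :: nat and c E where N': "\<forall>k<N. c k \<in> A \<and> E k \<in> sets borel \<and> E k \<subseteq> fst (c k) \<and>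
      emeasure (chart_measure (c k)) (E k) < \<infinity>"
    and disj: "disjoint_family_on E {0..<N}" and cover: "(\<Union>k\<in>{0..<N}. E k) = UNIV"
    by (rule disjoint_chart_pieces)
  have N: "c k \<in> A \<and> E k \<in> sets borel \<and> E k \<subseteq> fst (c k) \<and> emeasure (chart_measure (c k)) (E k) < \<infinity>"
    if "k < N" for k using N' that by blast
  have *: "emeasure l B = (\<Sum>k\<in>{0..<N}. emeasure (chart_measure (c k)) (B \<inter> E k))"
    if l: "chart_compatible l" and B: "B \<in> sets borel" for l B
  proof -
    have "emeasure l B = (\<Sum>k\<in>{0..<N}. emeasure l (B \<inter> E k))"
      using l disj cover B N by (intro sum_emeasure_cover) (auto simp: chart_compatible_def)
    also have "\<dots> = (\<Sum>k\<in>{0..<N}. emeasure (chart_measure (c k)) (B \<inter> E k))"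
    proof (rule sum.cong)
      fix k assume "k \<in> {0..<N}"
      with N[of k] have "c k \<in> A" "B \<inter> E k \<in> sets borel" "B \<inter> E k \<subseteq> fst (c k)" using B by auto
      then show "emeasure l (B \<inter> E k) = emeasure (chart_measure (c k)) (B \<inter> E k)"
        using l unfolding chart_compatible_def by blast
    qed simp
    finally show ?thesis .
  qed
  show ?thesis
    using assms *[OF assms(1)] *[OF assms(2)] by (intro measure_eqI) (auto simp: chart_compatible_def)
qed

section \<open>Integration against the volume measure\<close>

abbreviation vol :: "'a measure" where
  "vol \<equiv> form_measure A \<mu>"

text \<open>Existence and uniqueness resolve the definite description in
  \<open>form_measure\<close>.\<close>

lemma chart_compatible_vol: "chart_compatible vol" and emeasure_vol_UNIV: "emeasure vol UNIV < \<infinity>"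
proof -
  have *: "(\<integral>\<^sup>+y\<in>snd c ` B. ennreal (dens c y) \<partial>lborel) = emeasure (chart_measure c) B"
    if "c \<in> A" "B \<in> sets borel" "B \<subseteq> fst c" for c B
  proof -
    have "snd c ` B = snd c ` (fst c \<inter> B)" using that by (simp add: Int_absorb1)
    then show ?thesis
      unfolding emeasure_chart_measure[OF that(1,2)] by (intro nn_integral_cong) (simp add: indicator_def)
  qed
  have spec: "(sets m = sets borel \<and> (\<forall>(U, \<phi>)\<in>A. \<forall>B\<in>sets borel. B \<subseteq> U \<longrightarrow>
      emeasure m B = (\<integral>\<^sup>+y\<in>\<phi> ` B. ennreal (dens (U, \<phi>) y) \<partial>lborel))) \<longleftrightarrow> chart_compatible m" for m
  proof -
    have "(\<forall>(U, \<phi>)\<in>A. \<forall>B\<in>sets borel. B \<subseteq> U \<longrightarrow>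
        emeasure m B = (\<integral>\<^sup>+y\<in>\<phi> ` B. ennreal (dens (U, \<phi>) y) \<partial>lborel)) \<longleftrightarrow>
      (\<forall>c\<in>A. \<forall>B\<in>sets borel. B \<subseteq> fst c \<longrightarrow>
        emeasure m B = (\<integral>\<^sup>+y\<in>snd c ` B. ennreal (dens c y) \<partial>lborel))"
      by (auto simp: split_beta)
    also have "\<dots> \<longleftrightarrow> (\<forall>c\<in>A. \<forall>B\<in>sets borel. B \<subseteq> fst c \<longrightarrow> emeasure m B = emeasure (chart_measure c) B)"
      using * by (intro ball_cong refl imp_cong) auto
    finally show ?thesis unfolding chart_compatible_def by blast
  qed
  obtain m where m: "chart_compatible m" "emeasure m UNIV < \<infinity>" using chart_compatible_exists by blast
  have "vol = m"
    unfolding form_measure_def spec using m chart_compatible_unique by (intro the_equality)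
  then show "chart_compatible vol" "emeasure vol UNIV < \<infinity>" using m by auto
qed

lemma sets_vol [measurable_cong]: "sets vol = sets borel"
  using chart_compatible_vol by (simp add: chart_compatible_def)

lemma space_vol: "space vol = UNIV"
  using sets_eq_imp_space_eq[OF sets_vol] by simp

lemma emeasure_vol: "c \<in> A \<Longrightarrow> B \<in> sets borel \<Longrightarrow> B \<subseteq> fst c \<Longrightarrow> emeasure vol B = emeasure (chart_measure c) B"
  using chart_compatible_vol by (simp add: chart_compatible_def)

sublocale vol: finite_measure vol
  by standard (use emeasure_vol_UNIV in \<open>simp add: space_vol\<close>)

lemma measurable_vol: "borel_measurable vol = (borel_measurable borel :: ('a \<Rightarrow> real) set)"
  by (rule measurable_cong_sets) (simp_all add: sets_vol)

lemma integrable_vol: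
  fixes f :: "'a \<Rightarrow> real"
  assumes "continuous_on UNIV f"
  shows "integrable vol f"
proof -
  have "bounded (range f)" using compact_UNIV assms compact_continuous_image compact_imp_bounded by blast
  then obtain B where "\<And>p. norm (f p) \<le> B" unfolding bounded_iff by blast
  then show ?thesis
    using assms by (intro vol.integrable_const_bound[of _ B])
      (auto simp: measurable_vol borel_measurable_continuous_onI)
qed

lemma integrable_vol_smooth: "smooth_in A UNIV f \<Longrightarrow> integrable vol f"
  using integrable_vol smooth_in_continuous open_UNIV by blast

text \<open>In coordinates a nonempty open set is not Lebesgue negligible, and the density is
  positive on it.\<close>

lemma emeasure_vol_open_pos:
  assumes "open W" "p \<in> W"
  shows "emeasure vol W > 0"
proof -
  obtain c where c: "c \<in> A" "p \<in> fst c" by (rule chart_cover)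
  let ?V = "fst c \<inter> W" and ?S = "snd c ` (fst c \<inter> W)"
  have V: "?V \<in> sets borel" using assms chart_homeomorphism(1)[OF c(1)] by (intro borel_open open_Int)
  have S: "open ?S" "snd c p \<in> ?S" using open_chart_image[OF c(1) assms(1)] assms c by auto
  have m: "(\<lambda>y. indicator ?S y * dens c y) \<in> borel_measurable borel"
    using borel_measurable_continuous_on_indicator[OF borel_open[OF S(1)], of "dens c"]
      smooth_on_continuous[OF smooth_on_subset[OF dens_smooth[OF c(1)]], of ?S] by auto
  have "emeasure vol ?V \<noteq> 0"
  proof
    assume "emeasure vol ?V = 0"
    then have "(\<integral>\<^sup>+y. ennreal (indicator ?S y * dens c y) \<partial>lborel) = 0"
      using emeasure_vol[OF c(1) V] emeasure_chart_measure[OF c(1) V] by simp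
    then have "AE y in lborel. ennreal (indicator ?S y * dens c y) = 0"
      using m by (subst (asm) nn_integral_0_iff_AE) auto
    moreover have "y \<notin> ?S" if "ennreal (indicator ?S y * dens c y) = 0" for y
      using that dens_pos[OF c(1), of y] by (auto simp: indicator_def split: if_splits)
    ultimately have "AE y in lborel. y \<notin> ?S" by (rule eventually_mono)
    then have "?S \<in> null_sets lborel" using S(1) by (simp add: AE_iff_null_sets)
    then have "negligible ?S" by (simp add: negligible_iff_null_sets null_sets_completionI)
    then show False using open_not_negligible[OF S(1)] S(2) by blast
  qed
  moreover have "emeasure vol ?V \<le> emeasure vol W"
    using assms by (intro emeasure_mono) (auto simp: sets_vol)
  ultimately show ?thesis by (metis le_zero_eq not_gr_zero)
qed

lemma measure_vol_pos: "measure vol UNIV > 0"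
  \<comment> \<open>\<open>undefined\<close> merely serves as a point of the manifold, which is
    nonempty because it is a type.\<close>
  using emeasure_vol_open_pos[of UNIV undefined] vol.emeasure_eq_measure[of UNIV] by simp

lemma integral_zero_imp_zero:
  fixes f :: "'a \<Rightarrow> real"
  assumes f: "continuous_on UNIV f" "\<And>p. f p \<ge> 0" and int: "(\<integral>p. f p \<partial>vol) = 0"
  shows "f p = 0"
proof (rule ccontr)
  assume "f p \<noteq> 0"
  have W: "open {q. f q \<noteq> 0}" using f(1) by (intro open_Collect_neq) (auto intro: continuous_intros)
  have "AE q in vol. f q = 0"
    using integral_nonneg_eq_0_iff_AE[OF integrable_vol[OF f(1)]] f(2) int by simp
  then have "{q. f q \<noteq> 0} \<in> null_sets vol"
    using W by (subst AE_iff_null_sets) (auto simp: sets_vol)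
  then have "emeasure vol {q. f q \<noteq> 0} = 0" by auto
  then show False using emeasure_vol_open_pos[OF W, of p] \<open>f p \<noteq> 0\<close> by simp
qed

text \<open>Weighting \<open>vol\<close> by the indicator of the chart domain yields exactly
  \<open>chart_measure c\<close>, a pushforward of a density, so the integral can be unfolded in
  coordinates.\<close>

lemma integral_vol_chart:
  fixes h :: "'a \<Rightarrow> real"
  assumes c: "c \<in> A" and h: "h \<in> borel_measurable borel" "\<And>p. p \<notin> fst c \<Longrightarrow> h p = 0"
  shows "(\<integral>p. h p \<partial>vol) = (\<integral>y. indicator (cran c) y * (dens c y * h (cinv c y)) \<partial>lborel)"
proof -
  have U [measurable]: "fst c \<in> sets borel" using chart_homeomorphism(1)[OF c] by simp
  have hv [measurable]: "h \<in> borel_measurable vol" using h(1) by (simp add: measurable_vol)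
  have [measurable]: "cinv_total c \<in> borel_measurable borel" by (rule measurable_cinv_total[OF c])
  have [measurable]: "(\<lambda>y. indicator (cran c) y * dens c y) \<in> borel_measurable borel" by (rule measurable_dens[OF c])
  have restrict: "density vol (\<lambda>p. ennreal (indicator (fst c) p)) = chart_measure c"
  proof (rule measure_eqI)
    show "sets (density vol (\<lambda>p. ennreal (indicator (fst c) p))) = sets (chart_measure c)"
      by (simp add: sets_vol)
    fix B assume "B \<in> sets (density vol (\<lambda>p. ennreal (indicator (fst c) p)))"
    then have B [measurable]: "B \<in> sets borel" by (simp add: sets_vol)
    have "emeasure (density vol (\<lambda>p. ennreal (indicator (fst c) p))) B =
        (\<integral>\<^sup>+p. ennreal (indicator (fst c) p) * indicator B p \<partial>vol)"
      by (subst emeasure_density) (auto simp: sets_vol)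
    also have "\<dots> = (\<integral>\<^sup>+p. indicator (fst c \<inter> B) p \<partial>vol)"
      by (intro nn_integral_cong) (simp split: split_indicator)
    also have "\<dots> = emeasure (chart_measure c) (fst c \<inter> B)"
      using emeasure_vol[OF c, of "fst c \<inter> B"] by (simp add: sets_vol)
    also have "\<dots> = emeasure (chart_measure c) B"
      by (simp add: emeasure_chart_measure[OF c])
    finally show "emeasure (density vol (\<lambda>p. ennreal (indicator (fst c) p))) B = emeasure (chart_measure c) B" .
  qed
  have "(\<integral>p. h p \<partial>vol) = (\<integral>p. indicator (fst c) p *\<^sub>R h p \<partial>vol)"
    using h(2) by (intro Bochner_Integration.integral_cong) (auto simp: indicator_def)
  also have "\<dots> = (\<integral>p. h p \<partial>density vol (\<lambda>p. ennreal (indicator (fst c) p)))"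
    by (rule integral_density[symmetric]) (auto simp: measurable_vol)
  also have "\<dots> = (\<integral>y. h (cinv_total c y) \<partial>density lborel (\<lambda>y. ennreal (indicator (cran c) y * dens c y)))"
    unfolding restrict chart_measure_def using h(1) by (subst integral_distr) auto
  also have "\<dots> = (\<integral>y. (indicator (cran c) y * dens c y) *\<^sub>R h (cinv_total c y) \<partial>lborel)"
    using h(1) by (intro integral_density) (auto simp: dens_nonneg[OF c])
  also have "\<dots> = (\<integral>y. indicator (cran c) y * (dens c y * h (cinv c y)) \<partial>lborel)"
    by (intro Bochner_Integration.integral_cong) (auto simp: indicator_def cinv_total_def)
  finally show ?thesis .
qed

end

section \<open>Divergence and integration by parts\<close>

lemma smooth_on_extend_zero:
  fixes F :: "'a::real_normed_vector \<Rightarrow> real"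
  assumes S: "open S" "smooth_on S F" and K: "closed K" "K \<subseteq> S" "\<And>y. y \<in> S \<Longrightarrow> y \<notin> K \<Longrightarrow> F y = 0"
  shows "smooth_on UNIV (\<lambda>y. if y \<in> S then F y else 0)" (is "smooth_on _ ?F")
proof (rule smooth_on_local)
  fix x
  show "\<exists>T. open T \<and> x \<in> T \<and> smooth_on T ?F"
  proof (cases "x \<in> K")
    case True
    have "smooth_on S ?F" by (rule smooth_on_cong[OF S]) simp
    then show ?thesis using True K(2) S(1) by blast
  next
    case False
    have "smooth_on (- K) ?F"
      by (rule smooth_on_cong[OF _ smooth_on_const[of _ 0]]) (use K in auto)
    then show ?thesis using False K(1) by (intro exI[of _ "- K"]) auto
  qed
qed

lemma component_mult: "component c i (\<lambda>g. a * v g) = a * component c i v"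
  by (simp add: component_def)

lemma component_zero: "component c i (\<lambda>g. 0) = 0"
  by (simp add: component_def)

context compact_manifold_volume
begin

lemma flux_smooth:
  assumes "smooth_vfield A X" "c \<in> A"
  shows "smooth_on (cran c) (\<lambda>y. dens c y * component c i (X (cinv c y)))"
  using assms chart_homeomorphism(2) dens_smooth smooth_vfield_component(1) by (intro smooth_on_mult) auto

lemma chart_divergence_smooth:
  assumes X: "smooth_vfield A X" and c: "c \<in> A"
  shows "smooth_in A (fst c) (chart_divergence A \<mu> c X)"
proof -
  have "smooth_on (cran c) (\<lambda>y. (\<Sum>i\<in>UNIV. frechet_derivative
        (\<lambda>y. dens c y * component c i (X (cinv c y))) (at y) (axis i 1)) / dens c y)"
    using chart_homeomorphism(2)[OF c] dens_smooth[OF c] dens_pos[OF c]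
    by (intro smooth_on_divide smooth_on_sum smooth_on_derivative flux_smooth[OF X c]) (auto simp: less_imp_neq[symmetric])
  from smooth_in_pullback[OF c chart_homeomorphism(1)[OF c] order_refl this]
  show ?thesis unfolding chart_divergence_def[abs_def] .
qed

text \<open>This Leibniz rule is proved within one chart, so it is at hand before the divergence is
  known to be independent of the chart.\<close>

lemma chart_divergence_mult:
  assumes f: "smooth_in A UNIV f" and X: "smooth_vfield A X" and c: "c \<in> A" "p \<in> fst c"
  shows "chart_divergence A \<mu> c (\<lambda>q g. f q * X q g) p = f p * chart_divergence A \<mu> c X p + X p f"
proof -
  let ?y = "snd c p" and ?X = "\<lambda>i y. dens c y * component c i (X (cinv c y))" and ?f = "\<lambda>y. f (cinv c y)"
  have y: "?y \<in> cran c" using c by simp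
  have near: "smooth_near A p f" using smooth_in_near[OF f] by simp
  have "((\<lambda>y. ?f y * ?X i y) has_derivative
      (\<lambda>h. ?f ?y * frechet_derivative (?X i) (at ?y) h + frechet_derivative ?f (at ?y) h * ?X i ?y)) (at ?y)" for i
    using has_derivative_mult[OF near_has_derivative[OF near c] smooth_on_has_derivative[OF flux_smooth[OF X c(1)] y]] .
  then have "frechet_derivative (\<lambda>y. dens c y * (?f y * component c i (X (cinv c y)))) (at ?y) =
      (\<lambda>h. f p * frechet_derivative (?X i) (at ?y) h + frechet_derivative ?f (at ?y) h * ?X i ?y)" for i
    using c by (simp add: has_derivative_frechet mult.left_commute)
  then have "chart_divergence A \<mu> c (\<lambda>q g. f q * X q g) p =
      ((\<Sum>i\<in>UNIV. f p * frechet_derivative (?X i) (at ?y) (axis i 1)) +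
       (\<Sum>i\<in>UNIV. component c i (X p) * frechet_derivative ?f (at ?y) (axis i 1)) * dens c ?y) / dens c ?y"
    using c by (simp add: chart_divergence_def component_mult sum.distrib sum_distrib_left sum_distrib_right mult_ac)
  also have "\<dots> = f p * chart_divergence A \<mu> c X p + X p f"
    using dens_pos[OF c(1) y] tangent_apply_sum[OF smooth_vfield_tangent[OF X] c near]
    by (simp add: chart_divergence_def sum_distrib_left[symmetric] add_divide_distrib)
  finally show ?thesis .
qed

lemma chart_divergence_zero:
  assumes K: "closed K" "\<And>q. q \<notin> K \<Longrightarrow> X q = (\<lambda>g. 0)" and c: "c \<in> A" "p \<in> fst c" "p \<notin> K"
  shows "chart_divergence A \<mu> c X p = 0"
proof -
  have S: "open (snd c ` (fst c \<inter> - K))" "snd c p \<in> snd c ` (fst c \<inter> - K)"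
    using open_chart_image[OF c(1), of "- K"] K(1) c by auto
  have "((\<lambda>y. dens c y * component c i (X (cinv c y))) has_derivative (\<lambda>h. 0)) (at (snd c p))" for i
    by (rule has_derivative_transform_within_open[OF has_derivative_const[of 0] S])
      (use K(2) c in \<open>auto simp: component_zero\<close>)
  from has_derivative_frechet[OF this] show ?thesis by (simp add: chart_divergence_def)
qed

lemma chart_compact_closed:
  assumes "c \<in> A" "compact K" "K \<subseteq> fst c"
  shows "compact (snd c ` K)" "closed K"
  using assms homeomorphism_cont1[OF chart_homeomorphism(3)[OF assms(1)]]
  by (auto intro: compact_continuous_image continuous_on_subset compact_imp_closed)

text \<open>The extension by zero stands in for the global divergence as long as chart independence
  is open.\<close>

lemma chart_divergence_extended_smooth:
  assumes c: "c \<in> A" and X: "smooth_vfield A X" and K: "compact K" "K \<subseteq> fst c" "\<And>q. q \<notin> K \<Longrightarrow> X q = (\<lambda>g. 0)"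
  shows "smooth_in A UNIV (\<lambda>p. if p \<in> fst c then chart_divergence A \<mu> c X p else 0)" (is "smooth_in A UNIV ?h")
proof (rule smooth_in_extend_zero[OF chart_homeomorphism(1)[OF c] _ chart_compact_closed(2)[OF c K(1,2)] K(2)])
  show "smooth_in A (fst c) ?h"
    by (rule smooth_in_cong[OF chart_homeomorphism(1)[OF c] chart_divergence_smooth[OF X c]]) simp
  show "?h p = 0" if "p \<notin> K" for p
    using chart_divergence_zero[OF chart_compact_closed(2)[OF c K(1,2)] K(3) c _ that] by simp
qed

text \<open>The density of the measure cancels the division by the density in the divergence. What
  remains is a sum of partial derivatives of compactly supported functions, each with integral
  0.\<close>

lemma integral_chart_divergence:
  assumes c: "c \<in> A" and X: "smooth_vfield A X" and K: "compact K" "K \<subseteq> fst c" "\<And>q. q \<notin> K \<Longrightarrow> X q = (\<lambda>g. 0)"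
  shows "(\<integral>p. (if p \<in> fst c then chart_divergence A \<mu> c X p else 0) \<partial>vol) = 0" (is "integral\<^sup>L vol ?h = 0")
proof -
  let ?F = "\<lambda>i y. dens c y * component c i (X (cinv c y))"
  define G where "G i y = (if y \<in> cran c then ?F i y else 0)" for i y
  have K': "compact (snd c ` K)" "closed (snd c ` K)" "snd c ` K \<subseteq> cran c"
    using chart_compact_closed[OF c K(1,2)] K(2) by (auto simp: compact_imp_closed)
  have F0: "?F i y = 0" if "y \<in> cran c" "y \<notin> snd c ` K" for i y
  proof -
    have "cinv c y \<notin> K" using that chart_cinv[OF that(1)] by (metis image_eqI)
    then show ?thesis by (simp add: K(3) component_zero)
  qed
  have smoothG: "smooth_on UNIV (G i)" for i
    unfolding G_def using smooth_on_extend_zero[OF chart_homeomorphism(2)[OF c] flux_smooth[OF X c] K'(2,3) F0] .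
  have G0: "G i y = 0" if "y \<notin> snd c ` K" for i y
    using F0 that by (auto simp: G_def)
  have intG: "integrable lborel (\<lambda>y. frechet_derivative (G i) (at y) v)"
    "(\<integral>y. frechet_derivative (G i) (at y) v \<partial>lborel) = 0" for i v
    using integral_derivative_compact_support[OF smoothG K'(1) G0] by auto
  have "(\<integral>p. ?h p \<partial>vol) = (\<integral>y. indicator (cran c) y * (dens c y * ?h (cinv c y)) \<partial>lborel)"
  proof (rule integral_vol_chart[OF c])
    show "?h \<in> borel_measurable borel"
      using smooth_in_continuous[OF chart_divergence_extended_smooth[OF c X K] open_UNIV]
      by (rule borel_measurable_continuous_onI)
  qed simp
  also have "\<dots> = (\<integral>y. (\<Sum>i\<in>UNIV. frechet_derivative (G i) (at y) (axis i 1)) \<partial>lborel)"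
  proof (rule Bochner_Integration.integral_cong[OF refl])
    fix y
    show "indicator (cran c) y * (dens c y * ?h (cinv c y)) = (\<Sum>i\<in>UNIV. frechet_derivative (G i) (at y) (axis i 1))"
    proof (cases "y \<in> cran c")
      case True
      have "(G i has_derivative frechet_derivative (?F i) (at y)) (at y)" for i
        by (rule has_derivative_transform_within_open[OF smooth_on_has_derivative[OF flux_smooth[OF X c] True]
              chart_homeomorphism(2)[OF c] True]) (simp add: G_def)
      then have "frechet_derivative (G i) (at y) = frechet_derivative (?F i) (at y)" for i
        by (rule has_derivative_frechet)
      then show ?thesis
        using True dens_pos[OF c True] chart_cinv[OF True] cinv_in[OF True] by (simp add: chart_divergence_def)
    next
      case False
      then have "y \<notin> snd c ` K" using K'(3) by blast
      from derivative_eq_0_outside[OF K'(2) G0 this] show ?thesis using False by simp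
    qed
  qed
  also have "\<dots> = 0" using intG by (subst Bochner_Integration.integral_sum) auto
  finally show ?thesis .
qed

section \<open>Bump functions on the manifold and chart independence of the divergence\<close>

definition chart_bump :: "('a, 'n) chart \<times> (real ^ 'n) \<times> real \<Rightarrow> 'a \<Rightarrow> real" where
  "chart_bump = (\<lambda>(c, a, r) q. if q \<in> fst c then bump a r (snd c q) else 0)"

lemma chart_ball_support:
  assumes "(c, a, r) \<in> chart_balls"
  shows "compact (cinv c ` cball a r)" "closed (cinv c ` cball a r)" "cinv c ` cball a r \<subseteq> fst c"
    "q \<notin> cinv c ` cball a r \<Longrightarrow> chart_bump (c, a, r) q = 0"
proof -
  have c: "c \<in> A" "r > 0" "cball a r \<subseteq> cran c" using assms by (auto simp: chart_balls_def)
  show K: "compact (cinv c ` cball a r)"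
    using homeomorphism_cont2[OF chart_homeomorphism(3)[OF c(1)]] c(3)
    by (intro compact_continuous_image compact_cball) (rule continuous_on_subset)
  then show "closed (cinv c ` cball a r)" by (rule compact_imp_closed)
  show "cinv c ` cball a r \<subseteq> fst c" using subsetD[OF c(3)] by (intro image_subsetI cinv_in)
  show "chart_bump (c, a, r) q = 0" if q: "q \<notin> cinv c ` cball a r"
  proof (cases "q \<in> fst c")
    case True
    then have "snd c q \<notin> cball a r" using q c(1) by (metis cinv_chart image_eqI)
    then show ?thesis using bump_eq_0[OF c(2), of "snd c q" a] by (simp add: chart_bump_def)
  qed (simp add: chart_bump_def)
qed

lemma chart_bump_smooth:
  assumes "t \<in> chart_balls"
  shows "smooth_in A UNIV (chart_bump t)"
proof -
  obtain c a r where t: "t = (c, a, r)" by (metis prod_cases3)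
  have cb: "(c, a, r) \<in> chart_balls" using assms t by simp
  then have c: "c \<in> A" by (auto simp: chart_balls_def)
  have "smooth_in A (fst c) (\<lambda>q. bump a r (snd c q))"
    using chart_homeomorphism[OF c] by (intro smooth_in_pullback smooth_on_bump c) auto
  then have "smooth_in A (fst c) (chart_bump (c, a, r))"
    by (rule smooth_in_cong[OF chart_homeomorphism(1)[OF c]]) (simp add: chart_bump_def)
  from smooth_in_extend_zero[OF chart_homeomorphism(1)[OF c] this chart_ball_support(2,3,4)[OF cb]]
  show ?thesis by (simp add: t)
qed

lemma chart_bump_nonneg: "chart_bump t q \<ge> 0"
  by (auto simp: chart_bump_def bump_nonneg split: prod.split)

lemma chart_bump_pos: "t \<in> chart_balls \<Longrightarrow> q \<in> region t \<Longrightarrow> chart_bump t q > 0"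
  by (auto simp: chart_bump_def chart_balls_def region_def bump_pos_iff simp del: mem_ball)

text \<open>
  In place of the transformation rule for divergences, both chart expressions are tested against bump
  functions: multiplied by a bump function they have the same integral, by the divergence theorem in
  each of the two charts.
\<close>

lemma chart_divergence_agree:
  assumes X: "smooth_vfield A X" and c: "c \<in> A" "p \<in> fst c" and d: "d \<in> A" "p \<in> fst d"
  shows "chart_divergence A \<mu> c X p = chart_divergence A \<mu> d X p"
proof (rule ccontr)
  let ?O = "fst c \<inter> fst d"
  let ?D = "\<lambda>q. chart_divergence A \<mu> c X q - chart_divergence A \<mu> d X q"
  assume "chart_divergence A \<mu> c X p \<noteq> chart_divergence A \<mu> d X p"
  then have Dp: "?D p \<noteq> 0" by simp
  \<comment> \<open>The sign makes the difference positive near \<open>p\<close>, so that a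
    nonnegative weight with small support detects it.\<close>
  define s where "s = sgn (?D p)"
  have s: "s * ?D p > 0" "s \<noteq> 0" using Dp by (auto simp: s_def sgn_real_def)
  have O: "open ?O" using chart_homeomorphism(1) c d by blast
  have "smooth_in A ?O (\<lambda>q. s * ?D q)"
    using O by (intro smooth_in_mult smooth_in_const smooth_in_diff
        smooth_in_subset[OF chart_divergence_smooth[OF X c(1)]] smooth_in_subset[OF chart_divergence_smooth[OF X d(1)]]) auto
  then have "continuous_on ?O (\<lambda>q. s * ?D q)" using O by (rule smooth_in_continuous)
  then have "open (?O \<inter> (\<lambda>q. s * ?D q) -` {0<..})"
    using O by (intro continuous_open_preimage) auto
  moreover define W where "W = ?O \<inter> (\<lambda>q. s * ?D q) -` {0<..}"
  ultimately have W: "open W" "p \<in> W" using s c d by auto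
  obtain r where r: "r > 0" "cball (snd c p) r \<subseteq> snd c ` (fst c \<inter> W)" and cb: "(c, snd c p, r) \<in> chart_balls"
    by (rule chart_ball_at[OF c W])
  let ?K = "cinv c ` cball (snd c p) r"
  define \<beta> where "\<beta> = chart_bump (c, snd c p, r)"
  note K = chart_ball_support(1,2,3)[OF cb] and \<beta>0 = chart_ball_support(4)[OF cb, folded \<beta>_def]
  have KW: "?K \<subseteq> W" using r(2) c by auto
  have \<beta>: "smooth_in A UNIV \<beta>" "\<And>q. \<beta> q \<ge> 0" "\<beta> p > 0"
    using chart_bump_smooth[OF cb] chart_bump_nonneg chart_bump_pos[OF cb] r(1) c by (auto simp: \<beta>_def region_def)
  let ?Y = "\<lambda>q g. \<beta> q * X q g"
  have Y: "smooth_vfield A ?Y" by (rule smooth_vfield_mult[OF \<beta>(1) X])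
  have Y0: "?Y q = (\<lambda>g. 0)" if "q \<notin> ?K" for q using \<beta>0[OF that] by simp
  define h where "h e q = (if q \<in> fst e then chart_divergence A \<mu> e ?Y q else 0)" for e :: "('a, 'n) chart" and q
  have h: "smooth_in A UNIV (h e)" "(\<integral>q. h e q \<partial>vol) = 0" if "e \<in> A" "?K \<subseteq> fst e" for e
    using chart_divergence_extended_smooth[OF that(1) Y K(1) that(2) Y0]
      integral_chart_divergence[OF that(1) Y K(1) that(2) Y0] by (simp_all add: h_def[abs_def])
  have Kd: "?K \<subseteq> fst d" using KW by (auto simp: W_def)
  \<comment> \<open>The term \<open>X q \<beta>\<close> of the Leibniz rule does not depend on the
    chart and cancels.\<close>
  have diff: "h c q - h d q = (if q \<in> ?K then \<beta> q * ?D q else 0)" for q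
  proof (cases "q \<in> ?K")
    case True
    then have "q \<in> fst c" "q \<in> fst d" using K(3) Kd by auto
    then show ?thesis
      using True by (simp add: h_def chart_divergence_mult[OF \<beta>(1) X c(1)] chart_divergence_mult[OF \<beta>(1) X d(1)]
          right_diff_distrib)
  next
    case False
    then have "h e q = 0" if "e \<in> A" for e
      using chart_divergence_zero[OF K(2) Y0 that] by (simp add: h_def)
    then show ?thesis using False c d by simp
  qed
  have "s * (h c p - h d p) = 0"
  proof (rule integral_zero_imp_zero)
    have "smooth_in A UNIV (\<lambda>q. s * (h c q - h d q))"
      by (intro smooth_in_mult smooth_in_diff smooth_in_const h c d K Kd open_UNIV)
    then show "continuous_on UNIV (\<lambda>q. s * (h c q - h d q))" by (rule smooth_in_continuous) simp
    show "0 \<le> s * (h c q - h d q)" for q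
    proof (cases "q \<in> ?K")
      case True
      then have "s * ?D q > 0" using KW by (auto simp: W_def)
      then have "\<beta> q * (s * ?D q) \<ge> 0" using \<beta>(2) by (simp add: less_imp_le)
      then show ?thesis using True unfolding diff by (simp add: mult.left_commute)
    qed (simp add: diff)
    show "(\<integral>q. s * (h c q - h d q) \<partial>vol) = 0"
      using h[OF c(1) K(3)] h[OF d(1) Kd] integrable_vol_smooth by simp
  qed
  moreover have "p \<in> ?K" using r(1) c by (metis centre_in_cball cinv_chart image_eqI less_imp_le)
  ultimately show False using \<beta>(3) s Dp unfolding diff by simp
qed

section \<open>The divergence theorem\<close>

abbreviation dvg :: "'a vfield \<Rightarrow> 'a \<Rightarrow> real" where
  "dvg \<equiv> divergence A \<mu>"

lemma divergence_chart:
  assumes X: "smooth_vfield A X" and c: "c \<in> A" "p \<in> fst c"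
  shows "dvg X p = chart_divergence A \<mu> c X p"
proof -
  let ?d = "SOME c. c \<in> A \<and> p \<in> fst c"
  have "?d \<in> A \<and> p \<in> fst ?d" by (rule someI[of _ c]) (use c in simp)
  then show ?thesis
    unfolding divergence_def using chart_divergence_agree[OF X _ _ c] by blast
qed

lemma divergence_smooth:
  assumes X: "smooth_vfield A X"
  shows "smooth_in A UNIV (dvg X)"
proof (rule smooth_in_local)
  fix p
  obtain c where c: "c \<in> A" "p \<in> fst c" by (rule chart_cover)
  have "smooth_in A (fst c) (dvg X)"
    by (rule smooth_in_cong[OF chart_homeomorphism(1)[OF c(1)] chart_divergence_smooth[OF X c(1)]])
      (simp add: divergence_chart[OF X c(1)])
  then show "\<exists>V. open V \<and> p \<in> V \<and> smooth_in A V (dvg X)"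
    using chart_homeomorphism(1) c by blast
qed

lemma divergence_mult:
  assumes f: "smooth_in A UNIV f" and X: "smooth_vfield A X"
  shows "dvg (\<lambda>q g. f q * X q g) p = f p * dvg X p + X p f"
proof -
  obtain c where c: "c \<in> A" "p \<in> fst c" by (rule chart_cover)
  show ?thesis
    using chart_divergence_mult[OF f X c] divergence_chart[OF X c] divergence_chart[OF smooth_vfield_mult[OF f X] c]
    by simp
qed

text \<open>Since \<open>\<theta>\<close> vanishes with the bump, the field has compact support in
  one chart domain, where the divergence is the chart expression.\<close>

lemma integral_divergence_chart_ball:
  assumes cb: "t \<in> chart_balls" and \<theta>: "smooth_in A UNIV \<theta>" "\<And>q. chart_bump t q = 0 \<Longrightarrow> \<theta> q = 0"
    and X: "smooth_vfield A X"
  shows "(\<integral>p. dvg (\<lambda>q g. \<theta> q * X q g) p \<partial>vol) = 0"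
proof -
  obtain c a r where t: "t = (c, a, r)" by (metis prod_cases3)
  have cb: "(c, a, r) \<in> chart_balls" using cb t by simp
  then have c: "c \<in> A" by (auto simp: chart_balls_def)
  let ?Y = "\<lambda>q g. \<theta> q * X q g"
  note K = chart_ball_support[OF cb]
  have Y: "smooth_vfield A ?Y" by (rule smooth_vfield_mult[OF \<theta>(1) X])
  have Y0: "?Y q = (\<lambda>g. 0)" if "q \<notin> cinv c ` cball a r" for q using K(4)[OF that] \<theta>(2) t by simp
  have "dvg ?Y p = (if p \<in> fst c then chart_divergence A \<mu> c ?Y p else 0)" for p
  proof (cases "p \<in> fst c")
    case False
    obtain d where d: "d \<in> A" "p \<in> fst d" by (rule chart_cover)
    have "p \<notin> cinv c ` cball a r" using False K(3) by blast
    with False show ?thesis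
      using divergence_chart[OF Y d] chart_divergence_zero[OF K(2) Y0 d] by simp
  qed (simp add: divergence_chart[OF Y c])
  then show ?thesis using integral_chart_divergence[OF c Y K(1,3) Y0] by simp
qed

text \<open>Normalised bump functions form a partition of unity. By the Leibniz rule the divergences
  of the localised fields sum to div X plus the derivative along X of the constant 1, which is
  0.\<close>

theorem divergence_theorem:
  assumes X: "smooth_vfield A X"
  shows "(\<integral>p. dvg X p \<partial>vol) = 0"
proof -
  obtain I where I: "finite I" "I \<subseteq> chart_balls" "(\<Union>t\<in>I. region t) = UNIV"
    by (rule finite_chart_balls_cover)
  define S where "S q = (\<Sum>t\<in>I. chart_bump t q)" for q
  define \<theta> where "\<theta> t q = chart_bump t q / S q" for t q
  have S: "S q > 0" for q
  proof -
    obtain t where "t \<in> I" "q \<in> region t" using I(3) by blast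
    then show ?thesis
      unfolding S_def using I chart_bump_pos[of t q] by (intro sum_pos2[of _ t]) (auto intro: chart_bump_nonneg)
  qed
  have smooth: "smooth_in A UNIV (\<theta> t)" if "t \<in> I" for t
  proof -
    have "smooth_in A UNIV S" unfolding S_def using I chart_bump_smooth by (intro smooth_in_sum) auto
    then show ?thesis unfolding \<theta>_def
      using S chart_bump_smooth[OF subsetD[OF I(2) that]]
      by (intro smooth_in_divide) (auto simp: less_imp_neq[symmetric])
  qed
  have one: "(\<Sum>t\<in>I. \<theta> t q) = 1" for q
    using S[of q] by (simp add: \<theta>_def sum_divide_distrib[symmetric] S_def[symmetric])
  have near: "smooth_near A p (\<theta> t)" if "t \<in> I" for p t
    using smooth_in_near[OF smooth[OF that]] by simp
  have "dvg X p = (\<Sum>t\<in>I. dvg (\<lambda>q g. \<theta> t q * X q g) p)" for p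
  proof -
    have "(\<Sum>t\<in>I. dvg (\<lambda>q g. \<theta> t q * X q g) p) = (\<Sum>t\<in>I. \<theta> t p * dvg X p + X p (\<theta> t))"
      using divergence_mult[OF smooth X] by (intro sum.cong) auto
    also have "\<dots> = dvg X p + X p (\<lambda>q. \<Sum>t\<in>I. \<theta> t q)"
      using tangent_sum[OF smooth_vfield_tangent[OF X], of I p \<theta>] I(1) near
      by (simp add: sum.distrib sum_distrib_right[symmetric] one)
    finally show ?thesis using tangent_const[OF smooth_vfield_tangent[OF X]] by (simp add: one)
  qed
  then have "(\<integral>p. dvg X p \<partial>vol) = (\<integral>p. (\<Sum>t\<in>I. dvg (\<lambda>q g. \<theta> t q * X q g) p) \<partial>vol)" by simp
  also have "\<dots> = (\<Sum>t\<in>I. \<integral>p. dvg (\<lambda>q g. \<theta> t q * X q g) p \<partial>vol)"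
    by (intro Bochner_Integration.integral_sum integrable_vol_smooth divergence_smooth smooth_vfield_mult smooth X)
  also have "\<dots> = 0"
  proof (intro sum.neutral ballI integral_divergence_chart_ball[OF _ smooth _ X])
    show "t \<in> chart_balls" if "t \<in> I" for t using that I(2) by blast
    show "\<theta> t q = 0" if "chart_bump t q = 0" for t q using that by (simp add: \<theta>_def)
  qed
  finally show ?thesis .
qed

lemma integration_by_parts:
  assumes f: "smooth_in A UNIV f" and X: "smooth_vfield A X"
  shows "(\<integral>p. f p * dvg X p \<partial>vol) = - (\<integral>p. X p f \<partial>vol)"
proof -
  have "0 = (\<integral>p. f p * dvg X p + X p f \<partial>vol)"
    using divergence_theorem[OF smooth_vfield_mult[OF f X]] by (simp add: divergence_mult[OF f X])
  also have "\<dots> = (\<integral>p. f p * dvg X p \<partial>vol) + (\<integral>p. X p f \<partial>vol)"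
    by (intro Bochner_Integration.integral_add integrable_vol_smooth smooth_in_mult f divergence_smooth X
        smooth_vfield_apply[OF X] open_UNIV)
  finally show ?thesis by simp
qed

section \<open>Functions annihilated by all vector fields\<close>

text \<open>Chosen so that the field applied to \<open>F\<close> is the bump times the sum of the
  squared partial derivatives of \<open>F\<close>. The vector of partials is smooth at once, unlike
  a Riemannian gradient, which involves inverting the metric.\<close>

definition bump_gradient :: "('a, 'n) chart \<times> (real ^ 'n) \<times> real \<Rightarrow> ('a \<Rightarrow> real) \<Rightarrow> 'a vfield" where
  "bump_gradient = (\<lambda>(c, a, r) F q. if q \<in> fst c then chart_tvec A c q (chart_bump (c, a, r) q *\<^sub>R
     (\<chi> i. frechet_derivative (\<lambda>y. F (cinv c y)) (at (snd c q)) (axis i 1))) else (\<lambda>f. 0))"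

lemma bump_gradient_apply:
  assumes "c \<in> A" "q \<in> fst c" "smooth_near A q f"
  shows "bump_gradient (c, a, r) F q f = (\<Sum>i\<in>UNIV. chart_bump (c, a, r) q *
    frechet_derivative (\<lambda>y. F (cinv c y)) (at (snd c q)) (axis i 1) *
    frechet_derivative (\<lambda>y. f (cinv c y)) (at (snd c q)) (axis i 1))"
  using tangent_apply_sum[OF chart_tvec_in[OF assms(1,2)] assms] assms
  by (simp add: bump_gradient_def component_chart_tvec)

lemma bump_gradient_smooth:
  assumes cb: "(c, a, r) \<in> chart_balls" and F: "smooth_in A UNIV F"
  shows "smooth_vfield A (bump_gradient (c, a, r) F)"
proof (rule smooth_vfieldI)
  have c: "c \<in> A" using cb by (auto simp: chart_balls_def)
  show "bump_gradient (c, a, r) F p \<in> tangent_space A p" for p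
    using chart_tvec_in[OF c] tangent_zero by (simp add: bump_gradient_def)
  fix W f assume W: "open W" "smooth_in A W f"
  show "smooth_in A W (\<lambda>q. bump_gradient (c, a, r) F q f)"
  proof (rule smooth_in_local)
    fix p assume p: "p \<in> W"
    show "\<exists>V. open V \<and> p \<in> V \<and> smooth_in A V (\<lambda>q. bump_gradient (c, a, r) F q f)"
    proof (cases "p \<in> fst c")
      case True
      let ?V = "fst c \<inter> W"
      have V: "open ?V" using chart_homeomorphism(1)[OF c] W by auto
      have "smooth_in A ?V (\<lambda>q. \<Sum>i\<in>UNIV. chart_bump (c, a, r) q *
          frechet_derivative (\<lambda>y. F (cinv c y)) (at (snd c q)) (axis i 1) *
          frechet_derivative (\<lambda>y. f (cinv c y)) (at (snd c q)) (axis i 1))"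
        using V by (intro smooth_in_sum smooth_in_mult smooth_in_derivative[OF c]
            smooth_in_subset[OF chart_bump_smooth[OF cb]] smooth_in_subset[OF F] smooth_in_subset[OF W(2)]) auto
      then have "smooth_in A ?V (\<lambda>q. bump_gradient (c, a, r) F q f)"
        by (rule smooth_in_cong[OF V]) (use bump_gradient_apply[OF c _ smooth_in_near[OF W(2,1)]] in simp)
      then show ?thesis using V True p by blast
    next
      case False
      let ?K = "cinv c ` cball a r"
      note K = chart_ball_support[OF cb]
      have V: "open (- ?K \<inter> W)" using K(2) W(1) by auto
      have "bump_gradient (c, a, r) F q f = 0" if "q \<notin> ?K" for q
      proof (cases "q \<in> fst c")
        case True
        \<comment> \<open>With all coefficients 0 the combination rule says that the coordinate
          vector 0 represents the zero tangent vector.\<close>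
        show ?thesis
          using K(4)[OF that] True chart_tvec_combination[OF c True, of 0 0 0 0]
          by (simp add: bump_gradient_def)
      qed (simp add: bump_gradient_def)
      then have "smooth_in A (- ?K \<inter> W) (\<lambda>q. bump_gradient (c, a, r) F q f)"
        by (intro smooth_in_cong[OF V smooth_in_const[of _ 0]]) simp
      moreover have "p \<in> - ?K \<inter> W" using False K(3) p by blast
      ultimately show ?thesis using V by blast
    qed
  qed
qed

text \<open>The test field applied to \<open>F\<close> is continuous and nonnegative with integral
  0, hence 0 everywhere. At \<open>p\<close> the bump is positive, so all partial derivatives of
  \<open>F\<close> vanish there.\<close>

lemma derivative_zero_if_weakly_zero:
  assumes F: "smooth_in A UNIV F" and weak: "\<And>X. smooth_vfield A X \<Longrightarrow> (\<integral>p. X p F \<partial>vol) = 0"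
    and v: "v \<in> tangent_space A p"
  shows "v F = 0"
proof -
  obtain c where c: "c \<in> A" "p \<in> fst c" by (rule chart_cover)
  have near: "smooth_near A q F" for q using smooth_in_near[OF F] by simp
  obtain r where r: "r > 0" and cb: "(c, snd c p, r) \<in> chart_balls"
    using chart_ball_at[OF c open_UNIV] by auto
  let ?w = "bump_gradient (c, snd c p, r) F"
  have w: "smooth_vfield A ?w" by (rule bump_gradient_smooth[OF cb F])
  have pos: "chart_bump (c, snd c p, r) p > 0"
    using r c by (intro chart_bump_pos[OF cb]) (auto simp: region_def)
  have "?w p F = 0"
  proof (rule integral_zero_imp_zero[OF _ _ weak[OF w]])
    show "continuous_on UNIV (\<lambda>q. ?w q F)"
      using smooth_in_continuous[OF smooth_vfield_apply[OF w open_UNIV F] open_UNIV] .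
    show "0 \<le> ?w q F" for q
    proof (cases "q \<in> fst c")
      case True
      then show ?thesis
        unfolding bump_gradient_apply[OF c(1) True near]
        by (intro sum_nonneg) (simp add: mult.assoc chart_bump_nonneg)
    qed (simp add: bump_gradient_def)
  qed
  then have "(\<Sum>i\<in>UNIV. chart_bump (c, snd c p, r) p *
      frechet_derivative (\<lambda>y. F (cinv c y)) (at (snd c p)) (axis i 1) *
      frechet_derivative (\<lambda>y. F (cinv c y)) (at (snd c p)) (axis i 1)) = 0"
    using bump_gradient_apply[OF c near] by simp
  then have "frechet_derivative (\<lambda>y. F (cinv c y)) (at (snd c p)) (axis i 1) = 0" for i
    using pos by (subst (asm) sum_nonneg_eq_0_iff) (auto simp: mult.assoc chart_bump_nonneg)
  then show ?thesis
    unfolding tangent_apply_sum[OF v c near] by simp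
qed

text \<open>On a chart ball, which is convex, a vanishing derivative forces a constant. The set
  where \<open>F\<close> takes its value at \<open>p\<close> is therefore open, and it is closed by
  continuity.\<close>

lemma constant_if_derivative_zero:
  assumes conn: "connected (UNIV :: 'a set)" and F: "smooth_in A UNIV F"
    and zero: "\<And>p v. v \<in> tangent_space A p \<Longrightarrow> v F = 0"
  shows "F p = F q"
proof -
  have near: "smooth_near A q F" for q using smooth_in_near[OF F] by simp
  have loc: "\<exists>V. open V \<and> p \<in> V \<and> (\<forall>q\<in>V. F q = F p)" for p
  proof -
    obtain c where c: "c \<in> A" "p \<in> fst c" by (rule chart_cover)
    obtain r where r: "r > 0" "cball (snd c p) r \<subseteq> snd c ` (fst c \<inter> UNIV)" and cb: "(c, snd c p, r) \<in> chart_balls"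
      by (rule chart_ball_at[OF c open_UNIV UNIV_I])
    have "((\<lambda>y. F (cinv c y)) has_derivative (\<lambda>h. 0)) (at y within ball (snd c p) r)" if y: "y \<in> ball (snd c p) r" for y
    proof -
      have y': "y \<in> cran c" using y r(2) by auto
      let ?q = "cinv c y"
      have q: "?q \<in> fst c" "snd c ?q = y" using cinv_in[OF y'] chart_cinv[OF y'] by auto
      have "frechet_derivative (\<lambda>y. F (cinv c y)) (at y) h = 0" for h
        using zero[OF chart_tvec_in[OF c(1) q(1), of h]] chart_tvec_eq[OF near, of c ?q h] q(2) by simp
      then have "frechet_derivative (\<lambda>y. F (cinv c y)) (at y) = (\<lambda>h. 0)" by blast
      then have "((\<lambda>y. F (cinv c y)) has_derivative (\<lambda>h. 0)) (at y)"
        using near_has_derivative[OF near c(1) q(1)] q(2) by simp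
      then show ?thesis by (rule has_derivative_at_withinI)
    qed
    then have "\<exists>k. \<forall>y\<in>ball (snd c p) r. F (cinv c y) = k"
      by (intro has_derivative_zero_constant convex_ball)
    then obtain k where k: "\<And>y. y \<in> ball (snd c p) r \<Longrightarrow> F (cinv c y) = k" by blast
    have "F q = k" if "q \<in> region (c, snd c p, r)" for q
      using k[of "snd c q"] that c(1) by (simp add: region_def)
    moreover have "p \<in> region (c, snd c p, r)" using r c by (simp add: region_def)
    ultimately show ?thesis using open_region[OF cb] by blast
  qed
  let ?V = "{q. F q = F p}"
  have "open ?V" by (subst open_subopen) (use loc in fastforce)
  moreover have "closed ?V"
    using smooth_in_continuous[OF F open_UNIV] by (intro closed_Collect_eq) auto
  moreover have "\<forall>T :: 'a set. open T \<and> closed T \<longrightarrow> T = {} \<or> T = UNIV"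
    using conn by (simp add: connected_clopen)
  ultimately have "?V = {} \<or> ?V = UNIV" by blast
  moreover have "p \<in> ?V" by simp
  ultimately have "q \<in> ?V" by blast
  then show ?thesis by simp
qed

end

section \<open>Time-dependent vector fields\<close>

lemma smooth_on_slice: "smooth_on S (\<lambda>y. (t, y))" for S :: "'a::real_normed_vector set" and t :: "'b::real_normed_vector"
proof -
  have "Ck_on k UNIV (\<lambda>y :: 'a. (t, 0 :: 'a) + (0, y))" for k
    by (intro Ck_on_add Ck_on_const Ck_on_bounded_linear bounded_linear_Pair bounded_linear_zero bounded_linear_ident) auto
  then have "Ck_on k UNIV (\<lambda>y :: 'a. (t, y))" for k by simp
  then show ?thesis unfolding smooth_on_def using Ck_on_subset by blast
qed

lemma partial_derivative_slice:
  assumes "(F has_derivative F') (at (t, y))"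
  shows "((\<lambda>y. F (t, y)) has_derivative (\<lambda>h. F' (0, h))) (at y)"
proof -
  have "((\<lambda>y. (t, y)) has_derivative (\<lambda>h. (0, h))) (at y)"
    by (rule has_derivative_Pair[OF has_derivative_const has_derivative_ident])
  from has_derivative_compose[OF this assms] show ?thesis .
qed

lemma partial_derivative_time:
  fixes F :: "real \<times> 'a::real_normed_vector \<Rightarrow> real"
  assumes "(F has_derivative F') (at (t, y))"
  shows "((\<lambda>s. F (s, y)) has_real_derivative F' (1, 0)) (at t)"
  using line_derivative[of F F' "(0, y)" t "(1, 0)"] assms by simp

context manifold
begin

lemma time_component_smooth:
  assumes "smooth_time_vfield A J u" "c \<in> A"
  shows "smooth_on (J \<times> cran c) (\<lambda>z. component c i (u (fst z) (cinv c (snd z))))"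
  using assms unfolding smooth_time_vfield_def by (fastforce simp: case_prod_unfold)

lemma time_slice_smooth:
  assumes u: "smooth_time_vfield A J u" and t: "t \<in> J"
  shows "smooth_vfield A (u t)"
  unfolding smooth_vfield_def
proof (intro conjI allI ballI, goal_cases)
  case (1 p)
  then show ?case using u t unfolding smooth_time_vfield_def by blast
next
  case (2 c)
  have "smooth_on (cran c) (\<lambda>y. component c i (u (fst (t, y)) (cinv c (snd (t, y)))))" for i
    using t by (intro smooth_on_compose[OF chart_homeomorphism(2)[OF 2] time_component_smooth[OF u 2] smooth_on_slice]) auto
  then show ?case by (simp add: split_beta)
qed

text \<open>For fixed \<open>p\<close> and \<open>f\<close>, the value \<open>u s p f\<close> is a
  finite combination of the components with coefficients independent of time, so only the components
  are differentiated. Where \<open>f\<close> is not smooth near \<open>p\<close>, the value is 0 at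
  all times in \<open>J\<close>.\<close>

lemma time_deriv_chart:
  assumes u: "smooth_time_vfield A J u" and J: "open J" and t: "t \<in> J" and c: "c \<in> A" "p \<in> fst c"
  shows "time_deriv u t p = chart_tvec A c p
    (\<chi> i. frechet_derivative (\<lambda>z. component c i (u (fst z) (cinv c (snd z)))) (at (t, snd c p)) (1, 0))"
    (is "_ = chart_tvec A c p ?\<xi>")
proof
  fix f
  let ?U = "\<lambda>i z. component c i (u (fst z) (cinv c (snd z)))"
  have tangent: "u s p \<in> tangent_space A p" if "s \<in> J" for s
    using smooth_vfield_tangent[OF time_slice_smooth[OF u that]] .
  show "time_deriv u t p f = chart_tvec A c p ?\<xi> f"
  proof (cases "smooth_near A p f")
    case True
    let ?d = "\<lambda>i. frechet_derivative (\<lambda>y. f (cinv c y)) (at (snd c p)) (axis i 1)"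
    have "(t, snd c p) \<in> J \<times> cran c" using t c by simp
    then have "((\<lambda>s. ?U i (s, snd c p)) has_real_derivative ?\<xi> $ i) (at t)" for i
      using partial_derivative_time[OF smooth_on_has_derivative[OF time_component_smooth[OF u c(1)]]] by simp
    then have "((\<lambda>s. \<Sum>i\<in>UNIV. ?U i (s, snd c p) * ?d i) has_real_derivative (\<Sum>i\<in>UNIV. ?\<xi> $ i * ?d i)) (at t)"
      by (intro DERIV_sum DERIV_cmult_right)
    then have "((\<lambda>s. u s p f) has_real_derivative (\<Sum>i\<in>UNIV. ?\<xi> $ i * ?d i)) (at t)"
    proof (rule has_field_derivative_transform_within_open[OF _ J t])
      fix s assume "s \<in> J"
      then show "(\<Sum>i\<in>UNIV. ?U i (s, snd c p) * ?d i) = u s p f"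
        using tangent_apply_sum[OF tangent c True] c by simp
    qed
    moreover have "chart_tvec A c p ?\<xi> f = (\<Sum>i\<in>UNIV. ?\<xi> $ i * ?d i)"
      using tangent_apply_sum[OF chart_tvec_in[OF c] c True, of ?\<xi>] by (simp only: component_chart_tvec[OF c])
    ultimately show ?thesis by (simp add: time_deriv_def DERIV_imp_deriv)
  next
    case False
    have "((\<lambda>s. u s p f) has_real_derivative 0) (at t)"
      by (rule has_field_derivative_transform_within_open[OF DERIV_const[of 0] J t])
        (use tangent_not_smooth[OF tangent False] in simp)
    then show ?thesis using False by (simp add: time_deriv_def DERIV_imp_deriv chart_tvec_def)
  qed
qed

lemma time_deriv_smooth:
  assumes u: "smooth_time_vfield A J u" and J: "open J" and t: "t \<in> J"
  shows "smooth_vfield A (time_deriv u t)"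
  unfolding smooth_vfield_def
proof (intro conjI allI ballI, goal_cases)
  case (1 p)
  obtain c where c: "c \<in> A" "p \<in> fst c" by (rule chart_cover)
  show ?case using time_deriv_chart[OF u J t c] chart_tvec_in[OF c] by simp
next
  case (2 c)
  have "smooth_on (cran c) (\<lambda>y. component c i (time_deriv u t (cinv c y)))" for i
  proof (rule smooth_on_cong[OF chart_homeomorphism(2)[OF 2]])
    let ?D = "\<lambda>z. frechet_derivative (\<lambda>z. component c i (u (fst z) (cinv c (snd z)))) (at z) (1, 0)"
    show "smooth_on (cran c) (\<lambda>y. ?D (t, y))"
      using t by (intro smooth_on_compose[OF chart_homeomorphism(2)[OF 2]
          smooth_on_derivative[OF time_component_smooth[OF u 2]] smooth_on_slice]) auto
    show "?D (t, y) = component c i (time_deriv u t (cinv c y))" if "y \<in> cran c" for y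
      using time_deriv_chart[OF u J t 2 cinv_in[OF that]] component_chart_tvec[OF 2 cinv_in[OF that]] chart_cinv[OF that]
      by simp
  qed
  then show ?case by (simp add: split_beta)
qed

end

text \<open>The claim is the exchange of time and space derivatives of density times component:
  symmetry of second derivatives on \<open>J \<times> cran c\<close> in the directions
  \<open>(1, 0)\<close> and \<open>(0, h)\<close>.\<close>

lemma (in compact_manifold_volume) time_derivative_divergence:
  assumes u: "smooth_time_vfield A J u" and J: "open J" and t: "t \<in> J"
  shows "((\<lambda>s. dvg (u s) p) has_real_derivative dvg (time_deriv u t) p) (at t)"
proof -
  obtain c where c: "c \<in> A" "p \<in> fst c" by (rule chart_cover)
  let ?y = "snd c p" and ?S = "J \<times> cran c"
  let ?U = "\<lambda>i z. component c i (u (fst z) (cinv c (snd z)))"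
  let ?V = "\<lambda>i z. dens c (snd z) * ?U i z"
  let ?DV = "\<lambda>i v z. frechet_derivative (?V i) (at z) v"
  have S: "open ?S" using J chart_homeomorphism(2)[OF c(1)] by (rule open_Times)
  have y: "(t, ?y) \<in> ?S" "?y \<in> cran c" using t c by auto
  have "smooth_on ?S (\<lambda>z. dens c (snd z))"
    by (rule smooth_on_compose[OF S dens_smooth[OF c(1)] smooth_on_bounded_linear[OF bounded_linear_snd]]) auto
  then have V: "smooth_on ?S (?V i)" for i
    using S time_component_smooth[OF u c(1)] by (intro smooth_on_mult)
  have slice: "frechet_derivative (\<lambda>y. ?V i (s, y)) (at y) h = ?DV i (0, h) (s, y)" if "(s, y) \<in> ?S" for s y h i
    using has_derivative_frechet[OF partial_derivative_slice[OF smooth_on_has_derivative[OF V that]]] by metis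
  have DVt: "?DV i (1, 0) (t, y) = dens c y * component c i (time_deriv u t (cinv c y))" if y: "y \<in> cran c" for i y
  proof -
    have ty: "(t, y) \<in> ?S" using t y by simp
    have "((\<lambda>s. ?V i (s, y)) has_real_derivative ?DV i (1, 0) (t, y)) (at t)"
      by (rule partial_derivative_time[OF smooth_on_has_derivative[OF V ty]])
    moreover have "((\<lambda>s. dens c y * ?U i (s, y)) has_real_derivative
        dens c y * frechet_derivative (?U i) (at (t, y)) (1, 0)) (at t)"
      by (intro DERIV_cmult partial_derivative_time smooth_on_has_derivative[OF time_component_smooth[OF u c(1)] ty])
    ultimately have "?DV i (1, 0) (t, y) = dens c y * frechet_derivative (?U i) (at (t, y)) (1, 0)"
      using DERIV_unique by simp
    then show ?thesis
      using time_deriv_chart[OF u J t c(1) cinv_in[OF y]] component_chart_tvec[OF c(1) cinv_in[OF y]] chart_cinv[OF y] by simp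
  qed
  have mixed: "frechet_derivative (?DV i (0, h)) (at (t, ?y)) (1, 0) =
      frechet_derivative (\<lambda>y. dens c y * component c i (time_deriv u t (cinv c y))) (at ?y) h" for i h
  proof -
    have "frechet_derivative (?DV i (0, h)) (at (t, ?y)) (1, 0) = frechet_derivative (?DV i (1, 0)) (at (t, ?y)) (0, h)"
      using V by (intro mixed_derivatives_commute[OF S y(1)]) (simp add: smooth_on_def)
    moreover have "((\<lambda>y. ?DV i (1, 0) (t, y)) has_derivative (\<lambda>h. frechet_derivative (?DV i (1, 0)) (at (t, ?y)) (0, h))) (at ?y)"
      by (rule partial_derivative_slice[OF smooth_on_has_derivative[OF smooth_on_derivative[OF V] y(1)]])
    then have "((\<lambda>y. dens c y * component c i (time_deriv u t (cinv c y))) has_derivative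
        (\<lambda>h. frechet_derivative (?DV i (1, 0)) (at (t, ?y)) (0, h))) (at ?y)"
      by (rule has_derivative_transform_within_open[OF _ chart_homeomorphism(2)[OF c(1)] y(2)]) (rule DVt)
    from has_derivative_frechet[OF this]
    have "frechet_derivative (\<lambda>y. dens c y * component c i (time_deriv u t (cinv c y))) (at ?y) h =
        frechet_derivative (?DV i (1, 0)) (at (t, ?y)) (0, h)" by simp
    ultimately show ?thesis by simp
  qed
  have "((\<lambda>s. ?DV i (0, h) (s, ?y)) has_real_derivative frechet_derivative (?DV i (0, h)) (at (t, ?y)) (1, 0)) (at t)" for i h
    by (rule partial_derivative_time[OF smooth_on_has_derivative[OF smooth_on_derivative[OF V] y(1)]])
  then have "((\<lambda>s. ?DV i (0, h) (s, ?y)) has_real_derivative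
      frechet_derivative (\<lambda>y. dens c y * component c i (time_deriv u t (cinv c y))) (at ?y) h) (at t)" for i h
    by (simp only: mixed)
  then have "((\<lambda>s. (\<Sum>i\<in>UNIV. ?DV i (0, axis i 1) (s, ?y)) / dens c ?y) has_real_derivative
      chart_divergence A \<mu> c (time_deriv u t) p) (at t)"
    unfolding chart_divergence_def by (intro DERIV_cdivide DERIV_sum)
  then have "((\<lambda>s. dvg (u s) p) has_real_derivative chart_divergence A \<mu> c (time_deriv u t) p) (at t)"
  proof (rule has_field_derivative_transform_within_open[OF _ J t])
    fix s assume s: "s \<in> J"
    then have "(s, ?y) \<in> ?S" using y by simp
    from slice[OF this] show "(\<Sum>i\<in>UNIV. ?DV i (0, axis i 1) (s, ?y)) / dens c ?y = dvg (u s) p"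
      unfolding divergence_chart[OF time_slice_smooth[OF u s] c] chart_divergence_def by simp
  qed
  then show ?thesis
    using divergence_chart[OF time_deriv_smooth[OF u J t] c] by simp
qed

section \<open>Gradients\<close>

locale riemannian_manifold = manifold A for A :: "('a::t2_space, 'n::finite) chart set" +
  fixes g :: "'a metric_tensor"
  assumes metric: "riemannian_metric A g"
begin

lemma metric_linear:
  assumes "v \<in> tangent_space A p" "w \<in> tangent_space A p" "z \<in> tangent_space A p"
  shows "g p (\<lambda>f. a * v f + b * w f) z = a * g p v z + b * g p w z"
proof -
  have "\<forall>p. \<forall>v\<in>tangent_space A p. \<forall>w\<in>tangent_space A p. \<forall>z\<in>tangent_space A p. \<forall>a b.
        g p (\<lambda>f. a * v f + b * w f) z = a * g p v z + b * g p w z"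
    using metric unfolding riemannian_metric_def by (rule conjunct1)
  then show ?thesis using assms by simp
qed

lemma metric_sym:
  assumes "v \<in> tangent_space A p" "w \<in> tangent_space A p"
  shows "g p v w = g p w v"
proof -
  have "\<forall>p. \<forall>v\<in>tangent_space A p. \<forall>w\<in>tangent_space A p. g p v w = g p w v"
    using metric unfolding riemannian_metric_def by (elim conjE)
  then show ?thesis using assms by simp
qed

lemma metric_nondegenerate:
  assumes v: "v \<in> tangent_space A p" "g p v v = 0"
  shows "v = (\<lambda>f. 0)"
proof (rule ccontr)
  assume "v \<noteq> (\<lambda>f. 0)"
  moreover have "\<forall>p. \<forall>v\<in>tangent_space A p. v \<noteq> (\<lambda>f. 0) \<longrightarrow> g p v v > 0"
    using metric unfolding riemannian_metric_def by (elim conjE)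
  ultimately have "g p v v > 0" using v(1) by blast
  then show False using v(2) by simp
qed

text \<open>In coordinates the metric is a linear map from vectors to covectors. Positive
  definiteness makes it injective, hence surjective by equality of dimensions, and a preimage of the
  vector of partials of \<open>f\<close> is the gradient.\<close>

lemma gradient_exists:
  assumes f: "smooth_near A p f"
  shows "\<exists>v. v \<in> tangent_space A p \<and> (\<forall>w\<in>tangent_space A p. g p v w = w f)"
proof -
  obtain c where c: "c \<in> A" "p \<in> fst c" by (rule chart_cover)
  let ?t = "chart_tvec A c p"
  let ?B = "\<lambda>\<xi> \<eta>. g p (?t \<xi>) (?t \<eta>)"
  note T = chart_tvec_in[OF c]
  have B1: "?B (a *\<^sub>R \<xi> + b *\<^sub>R \<xi>') \<eta> = a * ?B \<xi> \<eta> + b * ?B \<xi>' \<eta>" for a b \<xi> \<xi>' \<eta>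
    unfolding chart_tvec_combination[OF c] by (rule metric_linear[OF T T T])
  have sym: "?B \<xi> \<eta> = ?B \<eta> \<xi>" for \<xi> \<eta> by (rule metric_sym[OF T T])
  have lin: "linear (\<lambda>\<xi>. ?B \<xi> \<eta>)" for \<eta>
    by (rule linearI) (use B1[of 1 _ 1] B1[of _ _ 0 0] in \<open>simp_all\<close>)
  have expand: "?B \<xi> \<eta> = (\<Sum>i\<in>UNIV. \<eta> $ i * ?B \<xi> (axis i 1))" for \<xi> \<eta>
    using linear_expand_axis[OF lin[of \<xi>], of \<eta>] by (simp only: sym[of \<xi>])
  let ?\<Phi> = "\<lambda>\<xi>. \<chi> i. ?B \<xi> (axis i 1)"
  have lin\<Phi>: "linear ?\<Phi>"
    by (intro linearI) (simp_all add: vec_eq_iff linear_add[OF lin] linear_scale[OF lin])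
  have "\<xi> = 0" if "?\<Phi> \<xi> = 0" for \<xi>
  proof -
    have "?B \<xi> (axis i 1) = 0" for i using that by (simp add: vec_eq_iff)
    then have "?B \<xi> \<xi> = 0" using expand[of \<xi> \<xi>] by simp
    then have "?t \<xi> = (\<lambda>f. 0)" by (rule metric_nondegenerate[OF T])
    then have "cvec c (?t \<xi>) = 0" by (simp add: vec_eq_iff component_zero)
    then show ?thesis by (simp add: cvec_chart_tvec[OF c])
  qed
  then have "inj ?\<Phi>" using linear_injective_0[OF lin\<Phi>] by blast
  then have "surj ?\<Phi>" using linear_injective_imp_surjective[OF lin\<Phi>] by blast
  then obtain \<xi> where "(\<chi> i. ?t (axis i 1) f) = ?\<Phi> \<xi>" by (rule surjE)
  then have \<xi>: "?B \<xi> (axis i 1) = ?t (axis i 1) f" for i by (simp add: vec_eq_iff)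
  have "g p (?t \<xi>) w = w f" if w: "w \<in> tangent_space A p" for w
  proof -
    have "g p (?t \<xi>) w = ?B \<xi> (cvec c w)" using tangent_in_chart[OF w c] by simp
    also have "\<dots> = (\<Sum>i\<in>UNIV. component c i w * ?t (axis i 1) f)"
      by (subst expand) (simp add: \<xi>)
    also have "\<dots> = w f" by (simp add: tangent_apply_sum[OF w c f] chart_tvec_eq[OF f])
    finally show ?thesis .
  qed
  then show ?thesis using T by blast
qed

lemma gradient:
  assumes f: "smooth_near A p f"
  shows "gradient A g f p \<in> tangent_space A p"
    and "w \<in> tangent_space A p \<Longrightarrow> g p (gradient A g f p) w = w f"
proof -
  have "\<exists>!v. v \<in> tangent_space A p \<and> (\<forall>w\<in>tangent_space A p. g p v w = w f)"
  proof (rule ex_ex1I[OF gradient_exists[OF f]])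
    fix v v' assume v: "v \<in> tangent_space A p \<and> (\<forall>w\<in>tangent_space A p. g p v w = w f)"
      and v': "v' \<in> tangent_space A p \<and> (\<forall>w\<in>tangent_space A p. g p v' w = w f)"
    \<comment> \<open>Definiteness forces this difference to vanish; it is written as a linear
      combination to fit \<open>metric_linear\<close>.\<close>
    let ?d = "\<lambda>f. 1 * v f + (- 1) * v' f"
    have d: "?d \<in> tangent_space A p" using v v' by (intro tangent_combination) auto
    have "g p ?d ?d = 1 * g p v ?d + (- 1) * g p v' ?d" using v v' d by (intro metric_linear) auto
    also have "\<dots> = 0" using v v' d by simp
    finally have "?d = (\<lambda>f. 0)" by (rule metric_nondegenerate[OF d])
    then have "v f = v' f" for f by (drule_tac fun_cong[of _ _ f]) simp
    then show "v = v'" by blast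
  qed
  from theI'[OF this] show "gradient A g f p \<in> tangent_space A p"
    and "w \<in> tangent_space A p \<Longrightarrow> g p (gradient A g f p) w = w f"
    unfolding gradient_def by auto
qed

text \<open>Pairing with a tangent vector turns gradients into derivatives. For the converse the
  combination itself is the test vector, and definiteness applies.\<close>

lemma gradient_combination_zero_iff:
  assumes f: "smooth_near A p f1" "smooth_near A p f2" "smooth_near A p f3"
  shows "(\<lambda>f. gradient A g f1 p f + k * gradient A g f2 p f + gradient A g f3 p f) = (\<lambda>f. 0) \<longleftrightarrow>
    (\<forall>w\<in>tangent_space A p. w f1 + k * w f2 + w f3 = 0)"
proof -
  let ?v = "\<lambda>f. gradient A g f1 p f + k * gradient A g f2 p f"
  let ?V = "\<lambda>f. ?v f + gradient A g f3 p f"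
  note T = gradient(1)[OF f(1)] gradient(1)[OF f(2)] gradient(1)[OF f(3)]
  have v: "?v \<in> tangent_space A p" using tangent_combination[OF T(1,2), of 1 k] by simp
  have V: "?V \<in> tangent_space A p" using tangent_combination[OF v T(3), of 1 1] by simp
  have gV: "g p ?V w = w f1 + k * w f2 + w f3" if w: "w \<in> tangent_space A p" for w
    using metric_linear[OF v T(3) w, of 1 1] metric_linear[OF T(1,2) w, of 1 k]
      gradient(2)[OF f(1) w] gradient(2)[OF f(2) w] gradient(2)[OF f(3) w] by simp
  show ?thesis
  proof
    assume "?V = (\<lambda>f. 0)"
    moreover have "g p (\<lambda>f. 0) w = 0" if "w \<in> tangent_space A p" for w
      using metric_linear[OF that that that, of 0 0] by simp
    ultimately show "\<forall>w\<in>tangent_space A p. w f1 + k * w f2 + w f3 = 0" using gV by metis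
  next
    assume zero: "\<forall>w\<in>tangent_space A p. w f1 + k * w f2 + w f3 = 0"
    have "g p ?V ?V = 0" by (rule trans[OF gV[OF V] bspec[OF zero V]])
    then show "?V = (\<lambda>f. 0)" by (rule metric_nondegenerate[OF V])
  qed
qed

end

section \<open>The Euler-Arnold equation\<close>

context compact_manifold_volume
begin

lemma ad_smooth: "smooth_vfield A X \<Longrightarrow> smooth_vfield A Y \<Longrightarrow> smooth_vfield A (ad A X Y)"
  using smooth_vfield_mult[OF smooth_in_const[of UNIV "- 1"] smooth_vfield_lie_bracket[of X Y]]
  by (simp add: ad_def[abs_def])

text \<open>No formula for the divergence of a bracket is needed: both sides are integrated by parts.\<close>

lemma integral_divergence_ad:
  assumes X: "smooth_vfield A X" and w: "smooth_vfield A w"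
  defines "h \<equiv> dvg X"
  shows "(\<integral>p. h p * dvg (ad A X w) p \<partial>vol) = (\<integral>p. (X p h + 1 / 2 * (h p)\<^sup>2) * dvg w p \<partial>vol)"
proof -
  have h: "smooth_in A UNIV h" unfolding h_def by (rule divergence_smooth[OF X])
  have near: "smooth_near A p h" for p using smooth_in_near[OF h] by simp
  have Xh: "smooth_in A UNIV (\<lambda>p. X p h)" and wh: "smooth_in A UNIV (\<lambda>p. w p h)"
    using smooth_vfield_apply[OF _ open_UNIV h] X w by auto
  have hh: "smooth_in A UNIV (\<lambda>p. h p * h p)" using h by (intro smooth_in_mult) auto
  have div: "smooth_in A UNIV (dvg w)" by (rule divergence_smooth[OF w])
  note int = integrable_vol_smooth
  have sq: "(\<integral>p. w p h * h p \<partial>vol) = - (\<integral>p. 1 / 2 * (h p * h p * dvg w p) \<partial>vol)"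
  proof -
    have "w p (\<lambda>q. h q * h q) = 2 * (w p h * h p)" for p
      using tangent_mult[OF smooth_vfield_tangent[OF w] near near] by simp
    then have "(\<integral>p. h p * h p * dvg w p \<partial>vol) = - (2 * (\<integral>p. w p h * h p \<partial>vol))"
      using integration_by_parts[OF hh w] by simp
    then show ?thesis by simp
  qed
  have "(\<integral>p. h p * dvg (ad A X w) p \<partial>vol) = - (\<integral>p. ad A X w p h \<partial>vol)"
    by (rule integration_by_parts[OF h ad_smooth[OF X w]])
  also have "\<dots> = (\<integral>p. X p (\<lambda>q. w q h) - w p (\<lambda>q. X q h) \<partial>vol)"
    by (simp add: ad_def lie_bracket_def near flip: Bochner_Integration.integral_minus)
  also have "\<dots> = (\<integral>p. X p (\<lambda>q. w q h) \<partial>vol) - (\<integral>p. w p (\<lambda>q. X q h) \<partial>vol)"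
    by (rule Bochner_Integration.integral_diff[OF int[OF smooth_vfield_apply[OF X open_UNIV wh]]
          int[OF smooth_vfield_apply[OF w open_UNIV Xh]]])
  \<comment> \<open>In the first integral the derivative along \<open>X\<close> is traded for the
    factor div X = h, which produces the product evaluated by \<open>sq\<close>.\<close>
  also have "\<dots> = - (\<integral>p. w p h * h p \<partial>vol) + (\<integral>p. X p h * dvg w p \<partial>vol)"
    using integration_by_parts[OF wh X] integration_by_parts[OF Xh w] by (simp add: h_def)
  also have "\<dots> = (\<integral>p. X p h * dvg w p \<partial>vol) + (\<integral>p. 1 / 2 * (h p * h p * dvg w p) \<partial>vol)"
    unfolding sq by simp
  also have "\<dots> = (\<integral>p. X p h * dvg w p + 1 / 2 * (h p * h p * dvg w p) \<partial>vol)"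
    by (rule Bochner_Integration.integral_add[symmetric, OF int[OF smooth_in_mult[OF open_UNIV Xh div]]
          int[OF smooth_in_mult[OF open_UNIV smooth_in_const smooth_in_mult[OF open_UNIV hh div]]]])
  finally show ?thesis by (simp add: algebra_simps power2_eq_square)
qed

text \<open>The gradient of \<open>F\<close> is the left-hand side of the first form of the equation.\<close>

lemma H1dot_equation_iff:
  assumes X: "smooth_vfield A X" and Y: "smooth_vfield A Y"
  defines "h \<equiv> dvg X"
  defines "F \<equiv> \<lambda>p. dvg Y p + X p h + 1 / 2 * (h p)\<^sup>2"
  shows "(\<forall>w. smooth_vfield A w \<longrightarrow> H1dot_inner A \<mu> Y w = - H1dot_inner A \<mu> X (ad A X w)) \<longleftrightarrow>
      (\<forall>p. \<forall>v\<in>tangent_space A p. v F = 0)"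
    and "smooth_in A UNIV F"
    and "(\<integral>p. F p \<partial>vol) = - (1 / 2) * (\<integral>p. (h p)\<^sup>2 \<partial>vol)"
proof -
  have h: "smooth_in A UNIV h" unfolding h_def by (rule divergence_smooth[OF X])
  have Xh: "smooth_in A UNIV (\<lambda>p. X p h)" by (rule smooth_vfield_apply[OF X open_UNIV h])
  have dY: "smooth_in A UNIV (dvg Y)" by (rule divergence_smooth[OF Y])
  have h2: "smooth_in A UNIV (\<lambda>p. 1 / 2 * (h p)\<^sup>2)"
    unfolding power2_eq_square by (intro smooth_in_mult smooth_in_const h open_UNIV)
  have Q: "smooth_in A UNIV (\<lambda>p. X p h + 1 / 2 * (h p)\<^sup>2)"
    by (intro smooth_in_add Xh h2 open_UNIV)
  have F_eq: "F = (\<lambda>p. dvg Y p + (X p h + 1 / 2 * (h p)\<^sup>2))" by (auto simp: F_def)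
  show F: "smooth_in A UNIV F"
    unfolding F_eq by (intro smooth_in_add dY Q open_UNIV)
  \<comment> \<open>The factor 1/4 cancels, and the equation tested with \<open>w\<close> says that
    \<open>F\<close> is orthogonal to \<open>dvg w\<close> in L^2; a final integration by parts
    moves the derivative onto \<open>F\<close>.\<close>
  have step: "H1dot_inner A \<mu> Y w = - H1dot_inner A \<mu> X (ad A X w) \<longleftrightarrow> (\<integral>p. w p F \<partial>vol) = 0"
    if w: "smooth_vfield A w" for w
  proof -
    have dw: "smooth_in A UNIV (dvg w)" by (rule divergence_smooth[OF w])
    have "H1dot_inner A \<mu> Y w = - H1dot_inner A \<mu> X (ad A X w) \<longleftrightarrow>
        (\<integral>p. dvg Y p * dvg w p \<partial>vol) + (\<integral>p. (X p h + 1 / 2 * (h p)\<^sup>2) * dvg w p \<partial>vol) = 0"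
      unfolding H1dot_inner_def using integral_divergence_ad[OF X w] by (auto simp: h_def)
    also have "(\<integral>p. dvg Y p * dvg w p \<partial>vol) + (\<integral>p. (X p h + 1 / 2 * (h p)\<^sup>2) * dvg w p \<partial>vol) =
        (\<integral>p. dvg Y p * dvg w p + (X p h + 1 / 2 * (h p)\<^sup>2) * dvg w p \<partial>vol)"
      by (intro Bochner_Integration.integral_add[symmetric] integrable_vol_smooth smooth_in_mult dY dw Q open_UNIV)
    also have "\<dots> = (\<integral>p. F p * dvg w p \<partial>vol)" by (simp only: F_eq distrib_right)
    also have "\<dots> = - (\<integral>p. w p F \<partial>vol)" by (rule integration_by_parts[OF F w])
    finally show ?thesis by simp
  qed
  show "(\<forall>w. smooth_vfield A w \<longrightarrow> H1dot_inner A \<mu> Y w = - H1dot_inner A \<mu> X (ad A X w)) \<longleftrightarrow>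
      (\<forall>p. \<forall>v\<in>tangent_space A p. v F = 0)"
  proof
    assume "\<forall>w. smooth_vfield A w \<longrightarrow> H1dot_inner A \<mu> Y w = - H1dot_inner A \<mu> X (ad A X w)"
    then have weak: "(\<integral>p. w p F \<partial>vol) = 0" if "smooth_vfield A w" for w using step that by simp
    show "\<forall>p. \<forall>v\<in>tangent_space A p. v F = 0"
    proof (intro allI ballI)
      show "v F = 0" if "v \<in> tangent_space A p" for p v
        by (rule derivative_zero_if_weakly_zero[OF F _ that]) (rule weak)
    qed
  next
    assume "\<forall>p. \<forall>v\<in>tangent_space A p. v F = 0"
    then have zero: "w p F = 0" if "smooth_vfield A w" for w p using smooth_vfield_tangent[OF that] by blast
    show "\<forall>w. smooth_vfield A w \<longrightarrow> H1dot_inner A \<mu> Y w = - H1dot_inner A \<mu> X (ad A X w)"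
    proof (intro allI impI)
      fix w assume w: "smooth_vfield A w"
      show "H1dot_inner A \<mu> Y w = - H1dot_inner A \<mu> X (ad A X w)"
        unfolding step[OF w] zero[OF w] by simp
    qed
  qed
  \<comment> \<open>The three summands contribute 0, -1 and 1/2 times the integral of h^2, whence
    the factor -1/2.\<close>
  have "(\<integral>p. F p \<partial>vol) = (\<integral>p. dvg Y p \<partial>vol) + (\<integral>p. X p h + 1 / 2 * (h p)\<^sup>2 \<partial>vol)"
    unfolding F_eq by (intro Bochner_Integration.integral_add integrable_vol_smooth dY Q)
  also have "(\<integral>p. X p h + 1 / 2 * (h p)\<^sup>2 \<partial>vol) = (\<integral>p. X p h \<partial>vol) + (\<integral>p. 1 / 2 * (h p)\<^sup>2 \<partial>vol)"
    by (intro Bochner_Integration.integral_add integrable_vol_smooth Xh h2)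
  also have "(\<integral>p. X p h \<partial>vol) = - (\<integral>p. (h p)\<^sup>2 \<partial>vol)"
    using integration_by_parts[OF h X] by (simp add: h_def power2_eq_square)
  finally show "(\<integral>p. F p \<partial>vol) = - (1 / 2) * (\<integral>p. (h p)\<^sup>2 \<partial>vol)"
    using divergence_theorem[OF Y] by simp
qed

text \<open>A constant function equals its mean. This turns the unspecified constant into an
  integral and is the source of the division by the total volume.\<close>

lemma derivative_zero_iff_mean_value:
  assumes conn: "connected (UNIV :: 'a set)" and F: "smooth_in A UNIV F"
  shows "(\<forall>p. \<forall>v\<in>tangent_space A p. v F = 0) \<longleftrightarrow> (\<forall>p. F p = (\<integral>q. F q \<partial>vol) / measure vol UNIV)"
proof
  assume "\<forall>p. \<forall>v\<in>tangent_space A p. v F = 0"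
  then have const: "F p = F q" for p q using constant_if_derivative_zero[OF conn F] by simp
  show "\<forall>p. F p = (\<integral>q. F q \<partial>vol) / measure vol UNIV"
  proof
    fix p
    have "(\<integral>q. F q \<partial>vol) = (\<integral>q. F p \<partial>vol)"
      by (rule Bochner_Integration.integral_cong[OF refl const])
    then show "F p = (\<integral>q. F q \<partial>vol) / measure vol UNIV"
      using measure_vol_pos by (simp add: space_vol)
  qed
next
  let ?k = "(\<integral>q. F q \<partial>vol) / measure vol UNIV"
  assume "\<forall>p. F p = ?k"
  then have "F = (\<lambda>p. ?k)" by (intro ext) blast
  then show "\<forall>p. \<forall>v\<in>tangent_space A p. v F = 0" using tangent_const[of _ _ ?k] by metis
qed

end

theorem theorem6p1:
  fixes A :: "('a::t2_space, 'n::finite) chart set"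
    and g :: "'a metric_tensor"
    and \<mu> :: "('a, 'n) top_form"
    and J :: "real set"
    and u :: "real \<Rightarrow> 'a vfield"
  assumes "compact (UNIV :: 'a set)"
    and "connected (UNIV :: 'a set)"
    and "oriented_atlas A"
    and "riemannian_metric A g"
    and "volume_form A \<mu>"
    and "open J" and "is_interval J"
    and "smooth_time_vfield A J u"
  shows "(euler_arnold A (H1dot_inner A \<mu>) J u \<longleftrightarrow>
           (\<forall>t\<in>J. \<forall>p.
              (let h = divergence A \<mu> (u t) in
               (\<lambda>f. gradient A g (divergence A \<mu> (time_deriv u t)) p f
                  + h p * gradient A g h p f
                  + gradient A g (\<lambda>q. g q (u t q) (gradient A g h q)) p f) = (\<lambda>f. 0)))) \<and>
         (euler_arnold A (H1dot_inner A \<mu>) J u \<longleftrightarrow>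
           (let h = (\<lambda>t. divergence A \<mu> (u t)) in
            \<forall>t\<in>J. \<forall>p.
              deriv (\<lambda>s. h s p) t + g p (u t p) (gradient A g (h t) p) + 1 / 2 * (h t p)\<^sup>2
                = - 1 / (2 * measure (form_measure A \<mu>) UNIV)
                    * (\<integral>q. (h t q)\<^sup>2 \<partial>form_measure A \<mu>)))"
proof -
  interpret compact_manifold_volume A \<mu> by unfold_locales (use assms in auto)
  interpret riemannian_manifold A g by unfold_locales (use assms in auto)
  note J = \<open>open J\<close> and u = \<open>smooth_time_vfield A J u\<close>
  \<comment> \<open>h_t enters as the divergence of \<open>time_deriv u t\<close>; it is identified
    with the pointwise time derivative of h in \<open>second\<close>.\<close>
  define F where "F t p = dvg (time_deriv u t) p + u t p (dvg (u t)) + 1 / 2 * (dvg (u t) p)\<^sup>2" for t p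
  have X: "smooth_vfield A (u t)" and Y: "smooth_vfield A (time_deriv u t)" if "t \<in> J" for t
    using time_slice_smooth[OF u that] time_deriv_smooth[OF u J that] by auto
  have near: "smooth_near A p f" if "smooth_in A UNIV f" for p f
    using smooth_in_near[OF that] by simp
  have h: "smooth_in A UNIV (dvg (u t))" "smooth_in A UNIV (dvg (time_deriv u t))"
    "smooth_in A UNIV (\<lambda>q. u t q (dvg (u t)))" "smooth_in A UNIV (F t)" if "t \<in> J" for t
    using divergence_smooth[OF X[OF that]] divergence_smooth[OF Y[OF that]]
      smooth_vfield_apply[OF X[OF that] open_UNIV] H1dot_equation_iff(2)[OF X[OF that] Y[OF that]]
    by (auto simp: F_def[abs_def])
  have grad: "g p (u t p) (gradient A g (dvg (u t)) p) = u t p (dvg (u t))" if "t \<in> J" for t p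
    using metric_sym[OF smooth_vfield_tangent[OF X[OF that]] gradient(1)[OF near[OF h(1)[OF that]]]]
      gradient(2)[OF near[OF h(1)[OF that]] smooth_vfield_tangent[OF X[OF that]]] by simp
  have weak: "euler_arnold A (H1dot_inner A \<mu>) J u \<longleftrightarrow> (\<forall>t\<in>J. \<forall>p. \<forall>v\<in>tangent_space A p. v (F t) = 0)"
    unfolding euler_arnold_def F_def[abs_def]
    by (intro ball_cong refl H1dot_equation_iff(1) X Y)
  have dF: "v (F t) = v (dvg (time_deriv u t)) + dvg (u t) p * v (dvg (u t)) + v (\<lambda>q. u t q (dvg (u t)))"
    if t: "t \<in> J" and v: "v \<in> tangent_space A p" for t p v
  proof -
    note n = near[OF h(1)[OF t]] near[OF h(2)[OF t]] near[OF h(3)[OF t]]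
    let ?h = "dvg (u t)"
    have hh: "smooth_near A p (\<lambda>q. ?h q * ?h q)" by (rule near_mult[OF n(1,1)])
    have c: "smooth_near A p (\<lambda>q. 1 / 2)" by (rule near[OF smooth_in_const])
    \<comment> \<open>The three summands of \<open>F\<close> are indexed by 0, 1, 2 so that
      \<open>tangent_sum\<close> applies.\<close>
    have "v (\<lambda>q. \<Sum>i\<in>{0, 1, 2::nat}. if i = 0 then dvg (time_deriv u t) q else if i = 1 then u t q ?h else 1 / 2 * (?h q * ?h q)) =
      (\<Sum>i\<in>{0, 1, 2::nat}. v (\<lambda>q. if i = 0 then dvg (time_deriv u t) q else if i = 1 then u t q ?h else 1 / 2 * (?h q * ?h q)))"
      using n near_mult[OF c hh] by (intro tangent_sum[OF v]) auto
    moreover have "v (\<lambda>q. 1 / 2 * (?h q * ?h q)) = ?h p * v ?h"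
      using tangent_mult[OF v c hh] tangent_mult[OF v n(1,1)] tangent_const[OF v] by simp
    ultimately show ?thesis
      unfolding F_def[abs_def] by (simp add: power2_eq_square add.assoc add_ac)
  qed
  have first: "(\<forall>v\<in>tangent_space A p. v (F t) = 0) \<longleftrightarrow>
      (let h = dvg (u t) in
        (\<lambda>f. gradient A g (dvg (time_deriv u t)) p f + h p * gradient A g h p f
          + gradient A g (\<lambda>q. g q (u t q) (gradient A g h q)) p f) = (\<lambda>f. 0))" if t: "t \<in> J" for t p
    unfolding Let_def grad[OF t]
      gradient_combination_zero_iff[OF near[OF h(2)[OF t]] near[OF h(1)[OF t]] near[OF h(3)[OF t]]]
    using dF[OF t] by simp
  \<comment> \<open>Unlike \<open>first\<close>, this equivalence is not pointwise in
    \<open>p\<close>: constancy of \<open>F\<close> is global, and its value is an integral over the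
    whole manifold.\<close>
  have second: "(\<forall>p. \<forall>v\<in>tangent_space A p. v (F t) = 0) \<longleftrightarrow>
      (\<forall>p. deriv (\<lambda>s. dvg (u s) p) t + g p (u t p) (gradient A g (dvg (u t)) p) + 1 / 2 * (dvg (u t) p)\<^sup>2 =
        - 1 / (2 * measure vol UNIV) * (\<integral>q. (dvg (u t) q)\<^sup>2 \<partial>vol))" if t: "t \<in> J" for t
  proof -
    have "deriv (\<lambda>s. dvg (u s) p) t = dvg (time_deriv u t) p" for p
      by (rule DERIV_imp_deriv[OF time_derivative_divergence[OF u J t]])
    then show ?thesis
      unfolding derivative_zero_iff_mean_value[OF assms(2) h(4)[OF t]] grad[OF t]
      using H1dot_equation_iff(3)[OF X[OF t] Y[OF t]] by (simp add: F_def[abs_def])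
  qed
  show ?thesis
    unfolding weak using first second by (simp add: Let_def)
qed

end
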